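(* Let $K$ be a compact convex subset of a locally convex Hausdorff space over $\mathbb{R}$. Suppose that the Banach space $A(K)$ has a Banach predual. Then the following conditions are equivalent. (i) $K$ is a Bauer simplex. (ii) $K$ is a Choquet simplex. (iii) Any pair $(f_k)_{k=1}^2$ and $(g_j)_{j=1}^2$ of $2$-outcome measurements on $A(K)$ are compatible.
   Context: All linear spaces are over $\mathbb{R}$. For a compact convex subset $K$ of a locally convex Hausdorff space, $A(K)$ denotes the Banach space of continuous real affine functionals on $K$ with the supremum norm $\|f\| = \sup_{x\in K}|f(x)|$, ordered pointwise with positive cone $A(K)_+ = \{f \in A(K) : f(x)\ge 0 \ \forall x\in K\}$; $1_K$ is the constant functional equal to $1$. A Banach space $E$ is said to have a Banach predual $E_*$ if $E_*$ is a Banach space whose Banach dual $(E_* )^*$ is isometrically isomorphic to $E$. $K$ is called a Choquet simplex if the Banach dual $A(K)^*$, ordered by the dual positive cone $A(K)^*_+ = \{\psi\in A(K)^* : \psi(f)\ge 0 \ \forall f\in A(K)_+\}$, is a lattice. $K$ is called a Bauer simplex if the set $\partial_{\mathrm e}K$ of extremal points of $K$ is compact and any point of $K$ is the barycenter of a unique boundary measure. Here a boundary measure representing a point is a Radon probability measure on $K$ that is maximal in the Choquet order ($\mu\prec\nu$ iff $\int f\,d\mu\le\int f\,d\nu$ for all continuous convex $f:K\to\mathbb{R}$), and $x\in K$ is the barycenter of $\mu$ if $f(x)=\int f\,d\mu$ for all $f\in A(K)$. An $m$-outcome measurement on $A(K)$ is a finite sequence $(f_k)_{k=1}^m\in A(K)^m$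 with $f_k\ge 0$ for $1\le k\le m$ and $\sum_{k=1}^m f_k = 1_K$. Two measurements $(f_k)_{k=1}^m$ and $(g_j)_{j=1}^n$ on $A(K)$ are called compatible if there exists a family $(h_{k,j})_{1\le k\le m,\,1\le j\le n}$ in $A(K)$ such that $h_{k,j}\ge 0$, $f_k = \sum_{j'=1}^n h_{k,j'}$ and $g_j = \sum_{k'=1}^m h_{k',j}$ for all $1\le k\le m$, $1\le j\le n$. *)

theory Defs
  imports "HOL-Probability.Probability" "HOL-Algebra.Lattice"
begin

class locally_convex_space = real_vector + topological_ab_group_add + t2_space +
  assumes tendsto_scaleR_nhds:
    "((\<lambda>p. fst p *\<^sub>R snd p) \<longlongrightarrow> c *\<^sub>R x) (nhds c \<times>\<^sub>F nhds x)"
  assumes locally_convex_zero: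
    "open U \<Longrightarrow> 0 \<in> U \<Longrightarrow>
      \<exists>V. open V \<and> 0 \<in> V \<and> V \<subseteq> U \<and>
        (\<forall>x\<in>V. \<forall>y\<in>V. \<forall>u\<ge>0. \<forall>v\<ge>0. u + v = 1 \<longrightarrow> u *\<^sub>R x + v *\<^sub>R y \<in> V)"

instance real_normed_vector \<subseteq> locally_convex_space
proof
  fix c :: real and x :: 'a
  show "((\<lambda>p. fst p *\<^sub>R snd p) \<longlongrightarrow> c *\<^sub>R x) (nhds c \<times>\<^sub>F nhds x)"
    by (intro tendsto_scaleR filterlim_fst filterlim_snd)
next
  fix U :: "'a set"
  assume "open U" "0 \<in> U"
  then obtain e where "e > 0" "ball 0 e \<subseteq> U"
    by (auto simp: open_contains_ball)
  moreover have "convex (ball (0::'a) e)"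
    by (rule convex_ball)
  ultimately show "\<exists>V. open V \<and> 0 \<in> V \<and> V \<subseteq> U \<and>
      (\<forall>x\<in>V. \<forall>y\<in>V. \<forall>u\<ge>0. \<forall>v\<ge>0. u + v = 1 \<longrightarrow> u *\<^sub>R x + v *\<^sub>R y \<in> V)"
    unfolding convex_def by (intro exI[of _ "ball 0 e"]) auto
qed

definition affine_fun_on :: "'a::real_vector set \<Rightarrow> ('a \<Rightarrow> real) \<Rightarrow> bool" where
  "affine_fun_on K f \<longleftrightarrow>
    (\<forall>x\<in>K. \<forall>y\<in>K. \<forall>u\<ge>0. \<forall>v\<ge>0. u + v = 1 \<longrightarrow>
      f (u *\<^sub>R x + v *\<^sub>R y) = u * f x + v * f y)"

text \<open>
  A function on \<open>K\<close> is represented by its extension by \<open>0\<close> to the whole type, so that equality of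
  elements of \<open>A(K)\<close> is equality in HOL and pointwise linear combinations stay inside the
  carrier. Functionals on \<open>A(K)\<close> are treated in the same way.
\<close>

definition A_space :: "'a::{real_vector, topological_space} set \<Rightarrow> ('a \<Rightarrow> real) set" where
  "A_space K = {f. continuous_on K f \<and> affine_fun_on K f \<and> (\<forall>x. x \<notin> K \<longrightarrow> f x = 0)}"

definition A_pos :: "'a::{real_vector, topological_space} set \<Rightarrow> ('a \<Rightarrow> real) set" where
  "A_pos K = {f \<in> A_space K. \<forall>x\<in>K. 0 \<le> f x}"

text \<open>The supremum of the empty set of reals is unspecified in HOL, hence the case distinction.\<close>

definition A_norm :: "'a set \<Rightarrow> ('a \<Rightarrow> real) \<Rightarrow> real" where
  "A_norm K f = (if K = {} then 0 else (SUP x\<in>K. \<bar>f x\<bar>))"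

text \<open>
  Existence of a Banach predual is expressed by an assumption \<open>\<exists>\<Phi>. predual_iso K \<Phi>\<close> with a free
  type variable \<open>'p\<close>: HOL cannot quantify over types inside a formula, but \<open>'p\<close> occurs in that
  assumption only, so its outer universal quantification is an existential one in the assumption.
\<close>

definition predual_iso ::
  "'a::{real_vector, topological_space} set \<Rightarrow> (('p::banach \<Rightarrow>\<^sub>L real) \<Rightarrow> 'a \<Rightarrow> real) \<Rightarrow> bool" where
  "predual_iso K \<Phi> \<longleftrightarrow>
    bij_betw \<Phi> UNIV (A_space K) \<and>
    (\<forall>\<phi> \<psi>. \<Phi> (\<phi> + \<psi>) = (\<lambda>x. \<Phi> \<phi> x + \<Phi> \<psi> x)) \<and>
    (\<forall>c \<phi>. \<Phi> (c *\<^sub>R \<phi>) = (\<lambda>x. c * \<Phi> \<phi> x)) \<and>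
    (\<forall>\<phi>. A_norm K (\<Phi> \<phi>) = norm \<phi>)"

definition A_dual :: "'a::{real_vector, topological_space} set \<Rightarrow> (('a \<Rightarrow> real) \<Rightarrow> real) set" where
  "A_dual K = {\<psi>.
    (\<forall>f\<in>A_space K. \<forall>g\<in>A_space K. \<psi> (\<lambda>x. f x + g x) = \<psi> f + \<psi> g) \<and>
    (\<forall>c. \<forall>f\<in>A_space K. \<psi> (\<lambda>x. c * f x) = c * \<psi> f) \<and>
    (\<exists>C. \<forall>f\<in>A_space K. \<bar>\<psi> f\<bar> \<le> C * A_norm K f) \<and>
    (\<forall>f. f \<notin> A_space K \<longrightarrow> \<psi> f = 0)}"

definition A_dual_pos :: "'a::{real_vector, topological_space} set \<Rightarrow> (('a \<Rightarrow> real) \<Rightarrow> real) set" where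
  "A_dual_pos K = {\<psi> \<in> A_dual K. \<forall>f\<in>A_pos K. 0 \<le> \<psi> f}"

definition A_dual_order ::
  "'a::{real_vector, topological_space} set \<Rightarrow> (('a \<Rightarrow> real) \<Rightarrow> real) gorder" where
  "A_dual_order K =
    \<lparr>carrier = A_dual K, eq = (=), le = (\<lambda>\<phi> \<psi>. (\<lambda>f. \<psi> f - \<phi> f) \<in> A_dual_pos K)\<rparr>"

definition Choquet_simplex :: "'a::{real_vector, topological_space} set \<Rightarrow> bool" where
  "Choquet_simplex K \<longleftrightarrow> Lattice.lattice (A_dual_order K)"

text \<open>
  Radon probability measures: Borel probability measures on \<open>K\<close> that are inner regular with
  respect to compact sets. For finite measures on a compact Hausdorff space this already yields
  outer regularity.
\<close>

definition radon_prob :: "'a::topological_space set \<Rightarrow> 'a measure \<Rightarrow> bool" where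
  "radon_prob K \<mu> \<longleftrightarrow>
    sets \<mu> = sets (restrict_space borel K) \<and> prob_space \<mu> \<and>
    (\<forall>B\<in>sets \<mu>. emeasure \<mu> B = (SUP C\<in>{C. compact C \<and> C \<subseteq> B}. emeasure \<mu> C))"

definition choquet_le ::
  "'a::{real_vector, topological_space} set \<Rightarrow> 'a measure \<Rightarrow> 'a measure \<Rightarrow> bool" where
  "choquet_le K \<mu> \<nu> \<longleftrightarrow>
    (\<forall>f::'a \<Rightarrow> real. continuous_on K f \<and> convex_on K f \<longrightarrow> (\<integral>x. f x \<partial>\<mu>) \<le> (\<integral>x. f x \<partial>\<nu>))"

definition boundary_measure :: "'a::{real_vector, topological_space} set \<Rightarrow> 'a measure \<Rightarrow> bool" where
  "boundary_measure K \<mu> \<longleftrightarrow>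
    radon_prob K \<mu> \<and> (\<forall>\<nu>. radon_prob K \<nu> \<and> choquet_le K \<mu> \<nu> \<longrightarrow> \<nu> = \<mu>)"

definition is_barycenter ::
  "'a::{real_vector, topological_space} set \<Rightarrow> 'a \<Rightarrow> 'a measure \<Rightarrow> bool" where
  "is_barycenter K x \<mu> \<longleftrightarrow> x \<in> K \<and> (\<forall>f\<in>A_space K. f x = (\<integral>y. f y \<partial>\<mu>))"

definition Bauer_simplex :: "'a::{real_vector, topological_space} set \<Rightarrow> bool" where
  "Bauer_simplex K \<longleftrightarrow>
    compact {x. x extreme_point_of K} \<and>
    (\<forall>x\<in>K. \<exists>!\<mu>. boundary_measure K \<mu> \<and> is_barycenter K x \<mu>)"

definition measurement ::
  "'a::{real_vector, topological_space} set \<Rightarrow> nat \<Rightarrow> (nat \<Rightarrow> 'a \<Rightarrow> real) \<Rightarrow> bool" where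
  "measurement K m f \<longleftrightarrow>
    (\<forall>k\<in>{1..m}. f k \<in> A_pos K) \<and> (\<forall>x\<in>K. (\<Sum>k=1..m. f k x) = 1)"

definition compatible ::
  "'a::{real_vector, topological_space} set \<Rightarrow> nat \<Rightarrow> (nat \<Rightarrow> 'a \<Rightarrow> real) \<Rightarrow>
    nat \<Rightarrow> (nat \<Rightarrow> 'a \<Rightarrow> real) \<Rightarrow> bool" where
  "compatible K m f n g \<longleftrightarrow>
    (\<exists>h. (\<forall>k\<in>{1..m}. \<forall>j\<in>{1..n}. h k j \<in> A_pos K) \<and>
      (\<forall>k\<in>{1..m}. f k = (\<lambda>x. \<Sum>j=1..n. h k j x)) \<and>
      (\<forall>j\<in>{1..n}. g j = (\<lambda>x. \<Sum>k=1..m. h k j x)))"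

end

theory Submission
  imports Defs
begin

text \<open>
  Compatibility of all pairs of binary measurements says that \<open>[0,1] = [0,e] + [0,1-e]\<close> for every effect \<open>e\<close>.
  A predual makes \<open>[0,1]\<close> weak-* compact, since \<open>2[0,1] - 1\<close> is the unit ball. For an extreme point \<open>e\<close> of
  \<open>[0,1]\<close> the decomposition is unique and defines a projection \<open>T\<close> on \<open>A(K)\<close> with \<open>0 \<le> T \<le> id\<close> and \<open>T 1 = e\<close>.
  The operators between \<open>0\<close> and \<open>id\<close> form a compact convex set, so by Krein--Milman every effect is \<open>T 1\<close>
  for one of them. At an extreme point \<open>x\<close> of \<open>K\<close> one has \<open>(T f)(x) = (T 1)(x) f(x)\<close>, hence \<open>A(K)\<close> is closed
  under multiplication on the extreme boundary. This forces the boundary to be closed and \<open>A(K)\<close> to be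
  all of its continuous functions, which gives both simplex properties.

  Conversely, in a Bauer simplex the upper and lower affine envelopes of \<open>min(f,g)\<close> agree, and in a Choquet
  simplex the infimum of \<open>f\<close> and \<open>g\<close> exists in the bidual and restricts to the predual.
\<close>

subsection \<open>Compact convex sets in products of lines\<close>

text \<open>Point evaluations on K need not be weak-* continuous, so the multiplication rule at an
  extreme point cannot be carried from extreme effects to all effects by weak-* limits. The detour
  through operators solves this: \<open>0 \<le> T \<le> id\<close> on positive elements amounts to
  weak-* ball conditions, survives limits, and only afterwards yields the rule at extreme points.
  The same obstacle returns in the Choquet direction: a functional known only on the predual says
  nothing directly about values at points of K, so pointwise inequalities are obtained by showing
  that a combination lies in the unit interval, which is a ball. Krein--Milman enters as two facts:
  every linear functional attains its maximum at an extreme point, and a point that no finite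
  combination of coordinates separates from a compact convex set belongs to it. Maximal measures are
  handled by affine majorants: at an extreme point the upper envelope of a continuous function is
  the function itself, since evaluation is the only state that represents such a point.\<close>

lemma compact_fun_product:
  fixes B :: "'i \<Rightarrow> 'b::topological_space set"
  assumes "\<And>i. compact (B i)"
  shows "compact {w. \<forall>i. w i \<in> B i}"
proof -
  have "compactin (product_topology (\<lambda>_. euclidean) UNIV) (PiE UNIV B)"
    using assms by (simp add: compactin_PiE)
  moreover have "PiE UNIV B = {w. \<forall>i. w i \<in> B i}"
    by auto
  ultimately show ?thesis
    by (metis euclidean_product_topology compactin_euclidean_iff)
qed

lemma continuous_fun_coordinate [continuous_intros]:
  "continuous_on S (\<lambda>w::'i \<Rightarrow> 'b::topological_space. w i)"
  by (rule continuous_on_subset[OF continuous_on_product_coordinates]) auto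

text \<open>
  Hahn--Banach separation in a product of lines needs no choice of a functional on an infinite
  dimensional space: for finitely many coordinates the point of \<open>S\<close> nearest to \<open>z\<close> does the job,
  and compactness takes care of the rest.
\<close>

lemma compact_convex_product_mem:
  fixes S :: "('i \<Rightarrow> real) set"
  assumes S: "compact S" "S \<noteq> {}"
    and conv: "\<And>s t c. s \<in> S \<Longrightarrow> t \<in> S \<Longrightarrow> 0 \<le> c \<Longrightarrow> c \<le> 1 \<Longrightarrow> (\<lambda>i. (1 - c) * s i + c * t i) \<in> S"
    and dom: "\<And>F c. finite F \<Longrightarrow> F \<subseteq> I \<Longrightarrow> \<exists>s\<in>S. (\<Sum>i\<in>F. c i * z i) \<le> (\<Sum>i\<in>F. c i * s i)"
  shows "\<exists>s\<in>S. \<forall>i\<in>I. s i = z i"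
proof -
  have fin: "\<exists>s\<in>S. \<forall>i\<in>F. s i = z i" if F: "finite F" "F \<subseteq> I" for F
  proof -
    have "continuous_on S (\<lambda>s. \<Sum>i\<in>F. (s i - z i)\<^sup>2)"
      by (intro continuous_intros)
    from continuous_attains_inf[OF S this]
    obtain s where s: "s \<in> S" and min: "\<And>t. t \<in> S \<Longrightarrow> (\<Sum>i\<in>F. (s i - z i)\<^sup>2) \<le> (\<Sum>i\<in>F. (t i - z i)\<^sup>2)"
      by blast
    \<comment> \<open>Variational inequality for the nearest point \<open>s\<close>: moving towards
      \<open>t\<close> cannot decrease the distance to \<open>z\<close>.\<close>
    have var: "0 \<le> (\<Sum>i\<in>F. (s i - z i) * (t i - s i))" if t: "t \<in> S" for t
    proof (rule ccontr)
      define a where "a = (\<Sum>i\<in>F. (s i - z i) * (t i - s i))"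
      define b where "b = (\<Sum>i\<in>F. (t i - s i)\<^sup>2)"
      assume "\<not> ?thesis"
      then have a: "a < 0" by (simp add: a_def)
      have b: "b \<ge> 0" by (simp add: b_def sum_nonneg)
      \<comment> \<open>Moving by \<open>c\<close> changes the squared distance by
        \<open>c * (2 * a + c * b)\<close>. This choice gives \<open>c * b \<le> - a\<close>, so the
        change is negative when \<open>a < 0\<close>; the \<open>+ 1\<close> avoids division by
        zero.\<close>
      define c where "c = min 1 (- a / (b + 1))"
      have c: "0 < c" "c \<le> 1" "c * (b + 1) \<le> - a"
      proof -
        show "0 < c" "c \<le> 1" using a b by (auto simp: c_def divide_neg_pos)
        have "c * (b + 1) \<le> (- a / (b + 1)) * (b + 1)"
          using b by (intro mult_right_mono) (auto simp: c_def)
        then show "c * (b + 1) \<le> - a" using b by simp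
      qed
      have "(\<Sum>i\<in>F. (s i - z i)\<^sup>2) \<le> (\<Sum>i\<in>F. (((1 - c) * s i + c * t i) - z i)\<^sup>2)"
        by (rule min[OF conv[OF s t]]) (use c in auto)
      also have "\<dots> = (\<Sum>i\<in>F. (s i - z i)\<^sup>2 + 2 * c * ((s i - z i) * (t i - s i)) + c\<^sup>2 * (t i - s i)\<^sup>2)"
        by (rule sum.cong) (auto simp: power2_eq_square algebra_simps)
      also have "\<dots> = (\<Sum>i\<in>F. (s i - z i)\<^sup>2) + 2 * c * a + c\<^sup>2 * b"
        by (simp add: sum.distrib sum_distrib_left a_def b_def)
      finally have "0 \<le> c * (2 * a + c * b)"
        by (simp add: power2_eq_square algebra_simps)
      then have "0 \<le> 2 * a + c * b"
        using c by (simp add: zero_le_mult_iff)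
      moreover have "c * b \<le> - a" using c by (simp add: algebra_simps)
      ultimately show False using a by simp
    qed
    \<comment> \<open>The functional pointing from \<open>s\<close> to \<open>z\<close>: some
      \<open>t\<close> reaches at least as far in that direction as \<open>z\<close>, which
      \<open>var\<close> permits only if the distance is zero.\<close>
    obtain t where t: "t \<in> S" and le: "(\<Sum>i\<in>F. (z i - s i) * z i) \<le> (\<Sum>i\<in>F. (z i - s i) * t i)"
      using dom[OF F, of "\<lambda>i. z i - s i"] by auto
    have "(\<Sum>i\<in>F. (s i - z i)\<^sup>2) =
        (\<Sum>i\<in>F. (z i - s i) * z i) - (\<Sum>i\<in>F. (z i - s i) * t i) - (\<Sum>i\<in>F. (s i - z i) * (t i - s i))"
      unfolding sum_subtractf[symmetric]
      by (rule sum.cong) (auto simp: power2_eq_square algebra_simps)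
    then have "(\<Sum>i\<in>F. (s i - z i)\<^sup>2) \<le> 0"
      using le var[OF t] by linarith
    then have 0: "(\<Sum>i\<in>F. (s i - z i)\<^sup>2) = 0" by (intro antisym sum_nonneg) auto
    have "(s i - z i)\<^sup>2 = 0" if "i \<in> F" for i
      by (rule sum_nonneg_0[OF F(1) _ 0 that]) auto
    then show ?thesis using s by (intro bexI[of _ s]) auto
  qed
  have "S \<inter> (\<Inter>i\<in>I. {s. s i = z i}) \<noteq> {}"
  proof (rule compact_imp_fip_image[OF \<open>compact S\<close>])
    show "closed {s. s i = z i}" for i
      by (intro closed_Collect_eq continuous_intros)
    show "S \<inter> (\<Inter>i\<in>F. {s. s i = z i}) \<noteq> {}" if "finite F" "F \<subseteq> I" for F
      using fin[OF that] by auto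
  qed
  then show ?thesis by auto
qed

text \<open>Zorn and compactness give a minimal closed extremal subset of \<open>C\<close>. The
  points of it where some \<open>f\<close> in \<open>F\<close> is maximal form again a closed
  extremal set, so every \<open>f\<close> is constant there and separation leaves a single point.
  Betweenness is abstract because it is used both for open segments in K and for midpoints of
  functionals.\<close>

lemma extremal_point_exists:
  fixes K :: "'x::topological_space set" and btw :: "'x \<Rightarrow> 'x \<Rightarrow> 'x \<Rightarrow> bool"
  assumes K: "compact K"
    and cont: "\<And>f. f \<in> F \<Longrightarrow> continuous_on K f"
    and aff: "\<And>f x y z. f \<in> F \<Longrightarrow> x \<in> K \<Longrightarrow> y \<in> K \<Longrightarrow> z \<in> K \<Longrightarrow> btw x y z \<Longrightarrow>
        \<exists>t. 0 < t \<and> t < 1 \<and> f x = (1 - t) * f y + t * (f z :: real)"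
    and sep: "\<And>x y. x \<in> K \<Longrightarrow> y \<in> K \<Longrightarrow> x \<noteq> y \<Longrightarrow> \<exists>f\<in>F. f x \<noteq> f y"
    and C: "closedin (top_of_set K) C" "C \<noteq> {}"
    and C_ext: "\<And>x y z. x \<in> C \<Longrightarrow> y \<in> K \<Longrightarrow> z \<in> K \<Longrightarrow> btw x y z \<Longrightarrow> y \<in> C \<and> z \<in> C"
  shows "\<exists>x\<in>C. \<forall>y\<in>K. \<forall>z\<in>K. btw x y z \<longrightarrow> y = x \<and> z = x"
proof -
  define \<A> where "\<A> = {D. closedin (top_of_set K) D \<and> D \<noteq> {} \<and> D \<subseteq> C \<and>
      (\<forall>x\<in>D. \<forall>y\<in>K. \<forall>z\<in>K. btw x y z \<longrightarrow> y \<in> D \<and> z \<in> D)}"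
  have "\<exists>M\<in>\<A>. \<forall>D\<in>\<A>. M \<supseteq> D \<longrightarrow> D = M"
  proof (rule predicate_Zorn)
    show "partial_order_on \<A> (relation_of (\<supseteq>) \<A>)"
      by (rule partial_order_on_relation_ofI) auto
  next
    fix \<C> assume "\<C> \<in> Chains (relation_of (\<supseteq>) \<A>)"
    then have sub: "\<C> \<subseteq> \<A>" and chain: "\<And>D D'. D \<in> \<C> \<Longrightarrow> D' \<in> \<C> \<Longrightarrow> D \<subseteq> D' \<or> D' \<subseteq> D"
      by (auto simp: Chains_def relation_of_def)
    show "\<exists>u\<in>\<A>. \<forall>a\<in>\<C>. a \<supseteq> u"
    proof (cases "\<C> = {}")
      case True
      have "C \<in> \<A>" unfolding \<A>_def using C C_ext by blast
      with True show ?thesis by auto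
    next
      case False
      have fin: "\<Inter>\<F> \<in> \<F>" if "finite \<F>" "\<F> \<noteq> {}" "\<F> \<subseteq> \<C>" for \<F>
        using that
      proof (induction \<F> rule: finite_ne_induct)
        case (insert D \<F>)
        then have "D \<subseteq> \<Inter>\<F> \<or> \<Inter>\<F> \<subseteq> D" using chain by (metis insert_subset subsetD)
        then show ?case using insert by (auto simp: Int_absorb1 Int_absorb2)
      qed auto
      have "\<Inter>\<C> \<noteq> {}"
      proof -
        have "compact_space (top_of_set K)"
          using K by (simp add: compact_space_subtopology compactin_euclidean_iff)
        moreover have "\<forall>D\<in>\<C>. closedin (top_of_set K) D" using sub by (auto simp: \<A>_def)
        moreover have "\<Inter>\<F> \<noteq> {}" if "finite \<F>" "\<F> \<subseteq> \<C>" for \<F>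
        proof (cases "\<F> = {}")
          case False
          then show ?thesis using fin[of \<F>] that sub by (auto simp: \<A>_def)
        qed auto
        ultimately show ?thesis unfolding compact_space_fip by blast
      qed
      moreover have "closedin (top_of_set K) (\<Inter>\<C>)"
        using sub False by (intro closedin_Inter) (auto simp: \<A>_def)
      moreover have "\<Inter>\<C> \<subseteq> C" using sub False by (auto simp: \<A>_def)
      moreover have "y \<in> \<Inter>\<C> \<and> z \<in> \<Inter>\<C>" if "x \<in> \<Inter>\<C>" "y \<in> K" "z \<in> K" "btw x y z" for x y z
      proof -
        have "y \<in> D \<and> z \<in> D" if "D \<in> \<C>" for D
        proof -
          have "D \<in> \<A>" "x \<in> D" using sub that \<open>x \<in> \<Inter>\<C>\<close> by auto
          then show ?thesis using \<open>y \<in> K\<close> \<open>z \<in> K\<close> \<open>btw x y z\<close> unfolding \<A>_def by blast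
        qed
        then show ?thesis by blast
      qed
      ultimately have "\<Inter>\<C> \<in> \<A>" unfolding \<A>_def by blast
      then show ?thesis by blast
    qed
  qed
  then obtain M where M: "M \<in> \<A>" and min: "\<And>D. D \<in> \<A> \<Longrightarrow> D \<subseteq> M \<Longrightarrow> D = M" by auto
  have MK: "M \<subseteq> K" "closedin (top_of_set K) M" "M \<noteq> {}" "M \<subseteq> C"
    using M by (auto simp: \<A>_def dest: closedin_imp_subset)
  have const: "f x = f y" if f: "f \<in> F" and xy: "x \<in> M" "y \<in> M" for f x y
  proof -
    have "compact M" using K MK(2) by (rule closedin_compact)
    then obtain m where m: "m \<in> M" "\<And>w. w \<in> M \<Longrightarrow> f w \<le> f m"
      using continuous_attains_sup[of M f] MK cont[OF f] continuous_on_subset by metis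
    let ?D = "M \<inter> {w \<in> K. f w = f m}"
    have "?D \<in> \<A>"
    proof -
      have "closedin (top_of_set K) ?D"
        using MK(2) continuous_closedin_preimage_constant[OF cont[OF f]] by (rule closedin_Int)
      moreover have "y \<in> ?D \<and> z \<in> ?D" if h: "x \<in> ?D" "y \<in> K" "z \<in> K" "btw x y z" for x y z
      proof -
        have "x \<in> M" using h by blast
        then have yz: "y \<in> M" "z \<in> M" using M h(2-4) unfolding \<A>_def by blast+
        obtain t where t: "0 < t" "t < 1" "f x = (1 - t) * f y + t * f z"
          using aff[OF f] h by blast
        have y': "f y \<le> f m" "f z \<le> f m" using m(2) yz by auto
        have e: "f m = (1 - t) * f y + t * f z" using t h by auto
        have "(1 - t) * (f m - f y) + t * (f m - f z) = 0" using e by (simp add: algebra_simps)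
        moreover have "(1 - t) * (f m - f y) \<ge> 0" "t * (f m - f z) \<ge> 0" using t y' by auto
        ultimately have "(1 - t) * (f m - f y) = 0" "t * (f m - f z) = 0" by linarith+
        then have "f y = f m" "f z = f m" using t by auto
        then show ?thesis using yz MK by auto
      qed
      moreover have "?D \<noteq> {}" "?D \<subseteq> C" using m(1) MK by auto
      ultimately show ?thesis unfolding \<A>_def by blast
    qed
    then have "?D = M" using min by blast
    then have "x \<in> ?D" "y \<in> ?D" using xy by blast+
    then show ?thesis by simp
  qed
  obtain x where x: "x \<in> M" using MK by auto
  have "y = x" if "y \<in> M" for y using const[OF _ x that] sep[of x y] x that MK by blast
  then have "M = {x}" using x by blast
  moreover have "x \<in> C" using x MK by blast
  moreover have "y \<in> M \<and> z \<in> M" if "y \<in> K" "z \<in> K" "btw x y z" for y z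
    using M x that unfolding \<A>_def by blast
  ultimately show ?thesis by blast
qed

subsection \<open>Separation of points by continuous linear functionals\<close>

definition sublinear :: "('a::real_vector \<Rightarrow> real) \<Rightarrow> bool" where
  "sublinear q \<longleftrightarrow> (\<forall>x y. q (x + y) \<le> q x + q y) \<and> (\<forall>c>0. \<forall>x. q (c *\<^sub>R x) \<le> c * q x)"

lemma sublinear_scale:
  assumes "sublinear q" "c > 0" shows "q (c *\<^sub>R x) = c * q x"
proof -
  have "q (inverse c *\<^sub>R (c *\<^sub>R x)) \<le> inverse c * q (c *\<^sub>R x)"
    using assms by (auto simp: sublinear_def simp del: scaleR_scaleR)
  then have "c * q x \<le> q (c *\<^sub>R x)" using assms by (simp add: field_simps)
  then show ?thesis using assms by (auto simp: sublinear_def intro: antisym)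
qed

lemma sublinear_0: "sublinear q \<Longrightarrow> q 0 = 0"
  using sublinear_scale[of q 2 0] by simp

lemma sublinear_ge_uminus:
  assumes "sublinear q" shows "- q (- x) \<le> q x"
proof -
  have "q (x + - x) \<le> q x + q (- x)" using assms unfolding sublinear_def by blast
  then show ?thesis using sublinear_0[OF assms] by simp
qed

text \<open>The auxiliary functional of Hahn--Banach: \<open>t = 0\<close> shows that it lies below
  \<open>q\<close>, and \<open>t = 1\<close> that its value at \<open>- a\<close> is at most
  \<open>- q a\<close>. A minimal sublinear functional coincides with all its reducts, and this
  makes it additive.\<close>

definition sublinear_reduct :: "('a::real_vector \<Rightarrow> real) \<Rightarrow> 'a \<Rightarrow> 'a \<Rightarrow> real" where
  "sublinear_reduct q a x = (INF t\<in>{0..}. q (x + t *\<^sub>R a) - t * q a)"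

lemma sublinear_reduct_bdd:
  assumes "sublinear q" shows "bdd_below ((\<lambda>t. q (x + t *\<^sub>R a) - t * q a) ` {0..})"
proof (rule bdd_belowI2)
  fix t :: real assume t: "t \<in> {0..}"
  have "t * q a = q (t *\<^sub>R a)"
    using sublinear_scale[OF assms, of t a] sublinear_0[OF assms] t by (cases "t = 0") auto
  also have "\<dots> = q ((x + t *\<^sub>R a) + - x)" by simp
  also have "\<dots> \<le> q (x + t *\<^sub>R a) + q (- x)" using assms unfolding sublinear_def by blast
  finally show "- q (- x) \<le> q (x + t *\<^sub>R a) - t * q a" by simp
qed

lemma sublinear_reduct_le:
  assumes "sublinear q" "t \<ge> 0" shows "sublinear_reduct q a x \<le> q (x + t *\<^sub>R a) - t * q a"
  unfolding sublinear_reduct_def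
  by (rule cINF_lower[OF sublinear_reduct_bdd[OF assms(1)]]) (use assms in auto)

lemma sublinear_sublinear_reduct:
  assumes q: "sublinear q" shows "sublinear (sublinear_reduct q a)"
  unfolding sublinear_def
proof (intro conjI allI impI)
  fix x y
  have *: "sublinear_reduct q a (x + y) \<le> (q (x + t *\<^sub>R a) - t * q a) + (q (y + s *\<^sub>R a) - s * q a)"
    if "t \<ge> 0" "s \<ge> 0" for t s
  proof -
    have "sublinear_reduct q a (x + y) \<le> q ((x + y) + (t + s) *\<^sub>R a) - (t + s) * q a"
      by (rule sublinear_reduct_le[OF q]) (use that in auto)
    also have "(x + y) + (t + s) *\<^sub>R a = (x + t *\<^sub>R a) + (y + s *\<^sub>R a)"
      by (simp add: algebra_simps)
    also have "q \<dots> \<le> q (x + t *\<^sub>R a) + q (y + s *\<^sub>R a)" using q unfolding sublinear_def by blast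
    finally show ?thesis by (simp add: algebra_simps)
  qed
  have "sublinear_reduct q a (x + y) - (q (x + t *\<^sub>R a) - t * q a) \<le> sublinear_reduct q a y"
    if "t \<ge> 0" for t
    unfolding sublinear_reduct_def[of q a y]
    by (rule cINF_greatest) (use *[OF that] in \<open>auto simp: algebra_simps\<close>)
  then have "sublinear_reduct q a (x + y) - sublinear_reduct q a y \<le> sublinear_reduct q a x"
    unfolding sublinear_reduct_def[of q a x]
    by (intro cINF_greatest) (auto simp: algebra_simps)
  then show "sublinear_reduct q a (x + y) \<le> sublinear_reduct q a x + sublinear_reduct q a y" by simp
next
  fix c :: real and x assume c: "c > 0"
  have "sublinear_reduct q a (c *\<^sub>R x) / c \<le> q (x + t *\<^sub>R a) - t * q a" if "t \<ge> 0" for t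
  proof -
    have "sublinear_reduct q a (c *\<^sub>R x) \<le> q (c *\<^sub>R x + (c * t) *\<^sub>R a) - (c * t) * q a"
      by (rule sublinear_reduct_le[OF q]) (use c that in auto)
    also have "c *\<^sub>R x + (c * t) *\<^sub>R a = c *\<^sub>R (x + t *\<^sub>R a)" by (simp add: algebra_simps)
    also have "q \<dots> = c * q (x + t *\<^sub>R a)" by (rule sublinear_scale[OF q c])
    finally have "sublinear_reduct q a (c *\<^sub>R x) \<le> c * (q (x + t *\<^sub>R a) - t * q a)"
      by (simp add: right_diff_distrib)
    then show ?thesis using c by (simp add: field_simps)
  qed
  then have "sublinear_reduct q a (c *\<^sub>R x) / c \<le> sublinear_reduct q a x"
    unfolding sublinear_reduct_def[of q a x] by (intro cINF_greatest) auto
  then show "sublinear_reduct q a (c *\<^sub>R x) \<le> c * sublinear_reduct q a x"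
    using c by (simp add: field_simps)
qed

text \<open>Zorn gives a minimal sublinear functional, which equals its own reducts and is therefore
  linear. It is sought below the reduct of \<open>p\<close> at \<open>x0\<close> instead of below
  \<open>p\<close>, which forces \<open>l (- x0) \<le> - p x0\<close> and thus equality at
  \<open>x0\<close>.\<close>

lemma sublinear_dominates_linear:
  fixes p :: "'a::real_vector \<Rightarrow> real"
  assumes p: "sublinear p"
  shows "\<exists>l. linear l \<and> (\<forall>x. l x \<le> p x) \<and> l x0 = p x0"
proof -
  define p' where "p' = sublinear_reduct p x0"
  have p': "sublinear p'" unfolding p'_def by (rule sublinear_sublinear_reduct[OF p])
  define \<A> where "\<A> = {q. sublinear q \<and> (\<forall>x. q x \<le> p' x)}"
  have "\<exists>m\<in>\<A>. \<forall>q\<in>\<A>. m \<ge> q \<longrightarrow> q = m"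
  proof (rule predicate_Zorn)
    show "partial_order_on \<A> (relation_of (\<ge>) \<A>)"
      by (rule partial_order_on_relation_ofI) auto
  next
    fix \<C> assume "\<C> \<in> Chains (relation_of (\<ge>) \<A>)"
    then have sub: "\<C> \<subseteq> \<A>" and chain: "\<And>q r. q \<in> \<C> \<Longrightarrow> r \<in> \<C> \<Longrightarrow> q \<le> r \<or> r \<le> q"
      by (auto simp: Chains_def relation_of_def)
    show "\<exists>u\<in>\<A>. \<forall>q\<in>\<C>. q \<ge> u"
    proof (cases "\<C> = {}")
      case True
      have "p' \<in> \<A>" using p' by (auto simp: \<A>_def)
      with True show ?thesis by auto
    next
      case False
      define u where "u x = (INF q\<in>\<C>. q x)" for x
      have bdd: "bdd_below ((\<lambda>q. q x) ` \<C>)" for x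
      proof (rule bdd_belowI2)
        fix q assume "q \<in> \<C>"
        then have q: "sublinear q" "\<And>x. q x \<le> p' x" using sub by (auto simp: \<A>_def)
        show "- p' (- x) \<le> q x" using sublinear_ge_uminus[OF q(1), of x] q(2)[of "- x"] by linarith
      qed
      have u_le: "u x \<le> q x" if "q \<in> \<C>" for q x
        unfolding u_def by (rule cINF_lower[OF bdd that])
      have "u (x + y) \<le> u x + u y" for x y
      proof -
        have *: "u (x + y) \<le> q x + r y" if qr: "q \<in> \<C>" "r \<in> \<C>" for q r
        proof -
          obtain s where s: "s \<in> \<C>" "s \<le> q" "s \<le> r" using chain[OF qr] qr by blast
          have "u (x + y) \<le> s (x + y)" using u_le s by blast
          also have "\<dots> \<le> s x + s y" using s sub by (auto simp: \<A>_def sublinear_def)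
          also have "\<dots> \<le> q x + r y" using s by (auto simp: le_fun_def intro: add_mono)
          finally show ?thesis .
        qed
        have "u (x + y) - q x \<le> u y" if "q \<in> \<C>" for q
          unfolding u_def[of y] by (rule cINF_greatest) (use False *[OF that] in \<open>auto simp: algebra_simps\<close>)
        then have "u (x + y) - u y \<le> u x"
          unfolding u_def[of x] by (intro cINF_greatest) (use False in \<open>auto simp: algebra_simps\<close>)
        then show ?thesis by simp
      qed
      moreover have "u (c *\<^sub>R x) \<le> c * u x" if c: "c > 0" for c x
      proof -
        have "u (c *\<^sub>R x) / c \<le> q x" if "q \<in> \<C>" for q
        proof -
          have "u (c *\<^sub>R x) \<le> q (c *\<^sub>R x)" by (rule u_le[OF that])
          also have "\<dots> \<le> c * q x" using that sub c by (auto simp: \<A>_def sublinear_def)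
          finally show ?thesis using c by (simp add: field_simps)
        qed
        then have "u (c *\<^sub>R x) / c \<le> u x" unfolding u_def[of x] by (intro cINF_greatest False) auto
        then show ?thesis using c by (simp add: field_simps)
      qed
      moreover have "u x \<le> p' x" for x
      proof -
        obtain q where "q \<in> \<C>" using False by blast
        then show ?thesis using u_le[of q x] sub by (auto simp: \<A>_def intro: order_trans)
      qed
      ultimately have "u \<in> \<A>" by (auto simp: \<A>_def sublinear_def)
      then show ?thesis using u_le by (auto simp: le_fun_def)
    qed
  qed
  then obtain l where l: "l \<in> \<A>" and min: "\<And>q. q \<in> \<A> \<Longrightarrow> q \<le> l \<Longrightarrow> q = l" by auto
  have lsub: "sublinear l" and lp': "\<And>x. l x \<le> p' x" using l by (auto simp: \<A>_def)
  have "sublinear_reduct l a = l" for a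
  proof (rule min)
    have "sublinear_reduct l a x \<le> l x" for x
      using sublinear_reduct_le[OF lsub, of 0 a x] by simp
    then show "sublinear_reduct l a \<le> l" "sublinear_reduct l a \<in> \<A>"
      using sublinear_sublinear_reduct[OF lsub] lp' by (auto simp: \<A>_def le_fun_def intro: order_trans)
  qed
  \<comment> \<open>Taking \<open>t = 1\<close> in the reduct gives superadditivity; subadditivity
    is already known.\<close>
  then have "l x \<le> l (x + a) - l a" for x a
    using sublinear_reduct_le[OF lsub, of 1 a x] by simp
  then have add: "l (x + a) = l x + l a" for x a
    using lsub unfolding sublinear_def by (metis add_le_imp_le_right diff_add_cancel order_antisym)
  have neg: "l (- x) = - l x" for x
    using add[of x "- x"] sublinear_0[OF lsub] by simp
  have "l (c *\<^sub>R x) = c * l x" for c x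
  proof (cases c "0::real" rule: linorder_cases)
    case less
    then have "l ((- c) *\<^sub>R x) = (- c) * l x" by (intro sublinear_scale[OF lsub]) auto
    then show ?thesis using neg[of "c *\<^sub>R x"] by simp
  qed (use sublinear_0[OF lsub] sublinear_scale[OF lsub] in auto)
  then have lin: "linear l" using add by (intro linearI) auto
  have p'_le: "p' x \<le> p x" for x
    using sublinear_reduct_le[OF p, of 0 x0 x] by (simp add: p'_def)
  have "l (- x0) \<le> p' (- x0)" by (rule lp')
  also have "\<dots> \<le> - p x0"
    using sublinear_reduct_le[OF p, of 1 x0 "- x0"] sublinear_0[OF p] by (simp add: p'_def)
  finally have "p x0 \<le> l x0" using neg by simp
  moreover have "l x \<le> p x" for x using lp'[of x] p'_le[of x] by simp
  ultimately show ?thesis using lin by (auto intro: antisym)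
qed

lemma tendsto_scaleR_lcs:
  fixes x :: "'a::locally_convex_space"
  assumes "(f \<longlongrightarrow> c) F" "(g \<longlongrightarrow> x) F"
  shows "((\<lambda>t. f t *\<^sub>R g t) \<longlongrightarrow> c *\<^sub>R x) F"
  using filterlim_compose[OF tendsto_scaleR_nhds filterlim_Pair[OF assms]] by simp

text \<open>The Minkowski functional of a convex neighbourhood of 0 that misses \<open>z\<close> is
  sublinear and at least 1 at \<open>z\<close>. A linear functional below it that touches it at
  \<open>z\<close> is at most 1 on the neighbourhood, hence continuous.\<close>

lemma linear_functional_separates:
  fixes z :: "'a::locally_convex_space"
  assumes "z \<noteq> 0"
  shows "\<exists>l. linear l \<and> continuous_on UNIV l \<and> l z \<noteq> (0::real)"
proof -
  obtain U where U: "open U" "0 \<in> U" "z \<notin> U"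
    using assms t1_space[of 0 z] by metis
  obtain V where V: "open V" "0 \<in> V" "V \<subseteq> U"
    and Vc: "\<And>x y u v. x \<in> V \<Longrightarrow> y \<in> V \<Longrightarrow> u \<ge> 0 \<Longrightarrow> v \<ge> 0 \<Longrightarrow> u + v = 1 \<Longrightarrow> u *\<^sub>R x + v *\<^sub>R y \<in> V"
    using locally_convex_zero[OF U(1,2)] by metis
  define P where "P x = {t. 0 < t \<and> inverse t *\<^sub>R x \<in> V}" for x
  define p where "p x = Inf (P x)" for x
  have ne: "P x \<noteq> {}" for x
  proof -
    have "((\<lambda>t. inverse t *\<^sub>R x) \<longlongrightarrow> 0 *\<^sub>R x) at_top"
      by (rule tendsto_scaleR_lcs[OF tendsto_inverse_0_at_top[OF filterlim_ident] tendsto_const])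
    then have "eventually (\<lambda>t. inverse t *\<^sub>R x \<in> V) at_top"
      using V by (auto simp: tendsto_def)
    then have "eventually (\<lambda>t. inverse t *\<^sub>R x \<in> V \<and> t > 0) at_top"
      using eventually_gt_at_top by (rule eventually_conj)
    then obtain t :: real where "inverse t *\<^sub>R x \<in> V" "t > 0"
      using eventually_happens'[of "at_top :: real filter"] by fastforce
    then show ?thesis by (auto simp: P_def)
  qed
  have bdd: "bdd_below (P x)" for x by (rule bdd_belowI[of _ 0]) (auto simp: P_def)
  have p_le: "p x \<le> t" if "t \<in> P x" for x t
    unfolding p_def by (rule cInf_lower[OF that bdd])
  have "sublinear p"
    unfolding sublinear_def
  proof (intro conjI allI impI)
    fix x y
    have *: "p (x + y) \<le> t + s" if ts: "t \<in> P x" "s \<in> P y" for t s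
    proof (rule p_le)
      \<comment> \<open>The vector \<open>(x + y) / (t + s)\<close> is the convex combination of
        \<open>x / t\<close> and \<open>y / s\<close> with these weights.\<close>
      have "(t / (t + s)) *\<^sub>R (inverse t *\<^sub>R x) + (s / (t + s)) *\<^sub>R (inverse s *\<^sub>R y) \<in> V"
        by (rule Vc) (use ts in \<open>auto simp: P_def add_divide_distrib[symmetric]\<close>)
      moreover have "(t / (t + s)) *\<^sub>R (inverse t *\<^sub>R x) + (s / (t + s)) *\<^sub>R (inverse s *\<^sub>R y) =
          inverse (t + s) *\<^sub>R (x + y)"
        using ts by (simp add: P_def scaleR_add_right divide_inverse mult.assoc mult.left_commute[of _ "inverse (t + s)"])
      ultimately show "t + s \<in> P (x + y)" using ts by (auto simp: P_def)
    qed
    have "p (x + y) - t \<le> p y" if "t \<in> P x" for t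
      unfolding p_def[of y] by (rule cInf_greatest[OF ne]) (use *[OF that] in \<open>auto simp: algebra_simps\<close>)
    then have "p (x + y) - p y \<le> p x"
      unfolding p_def[of x] by (intro cInf_greatest[OF ne]) (auto simp: algebra_simps)
    then show "p (x + y) \<le> p x + p y" by simp
  next
    fix c :: real and x assume c: "c > 0"
    have "p (c *\<^sub>R x) / c \<le> t" if t: "t \<in> P x" for t
    proof -
      have "c * t \<in> P (c *\<^sub>R x)" using t c by (simp add: P_def mult.commute[of "inverse c"] mult.assoc)
      from p_le[OF this] show ?thesis using c by (simp add: field_simps)
    qed
    then have "p (c *\<^sub>R x) / c \<le> p x" unfolding p_def[of x] by (intro cInf_greatest[OF ne])
    then show "p (c *\<^sub>R x) \<le> c * p x" using c by (simp add: field_simps)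
  qed
  from sublinear_dominates_linear[OF this, of z]
  obtain l where l: "linear l" "\<And>x. l x \<le> p x" "l z = p z" by blast
  have "1 \<le> p z"
    unfolding p_def
  proof (rule cInf_greatest[OF ne])
    fix t assume t: "t \<in> P z"
    show "1 \<le> t"
    proof (rule ccontr)
      assume "\<not> 1 \<le> t"
      then have "t *\<^sub>R (inverse t *\<^sub>R z) + (1 - t) *\<^sub>R 0 \<in> V"
        by (intro Vc) (use t V in \<open>auto simp: P_def\<close>)
      then show False using t U V by (auto simp: P_def)
    qed
  qed
  have l_V: "l x \<le> 1" if "x \<in> V" for x
    using l(2)[of x] p_le[of 1 x] that by (simp add: P_def)
  \<comment> \<open>\<open>V\<close> need not be symmetric, so both \<open>x\<close> and
    \<open>- x\<close> are required to lie in the dilated neighbourhood.\<close>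
  have l_small: "\<bar>l x\<bar> \<le> e" if "e > 0" "inverse e *\<^sub>R x \<in> V" "inverse e *\<^sub>R (- x) \<in> V" for x e
  proof -
    have "inverse e * l x \<le> 1" "inverse e * (- l x) \<le> 1"
      using l_V[OF that(2)] l_V[OF that(3)] l(1) by (simp_all add: linear_cmul linear_neg)
    then show ?thesis using that(1) by (auto simp: field_simps abs_le_iff)
  qed
  have "(l \<longlongrightarrow> l a) (nhds a)" for a
  proof (rule tendstoI)
    fix e :: real assume e: "e > 0"
    define d where "d = e / 2"
    have d: "d > 0" using e by (simp add: d_def)
    have t: "((\<lambda>x. x - a) \<longlongrightarrow> a - a) (nhds a)"
      by (intro tendsto_diff tendsto_const filterlim_ident)
    have "((\<lambda>x. inverse d *\<^sub>R (x - a)) \<longlongrightarrow> inverse d *\<^sub>R (a - a)) (nhds a)"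
      by (rule tendsto_scaleR_lcs[OF tendsto_const t])
    then have 1: "eventually (\<lambda>x. inverse d *\<^sub>R (x - a) \<in> V) (nhds a)"
      using V by (auto simp: tendsto_def)
    have "((\<lambda>x. inverse d *\<^sub>R (- (x - a))) \<longlongrightarrow> inverse d *\<^sub>R (- (a - a))) (nhds a)"
      by (rule tendsto_scaleR_lcs[OF tendsto_const tendsto_minus[OF t]])
    then have 2: "eventually (\<lambda>x. inverse d *\<^sub>R (- (x - a)) \<in> V) (nhds a)"
      using V by (auto simp: tendsto_def)
    show "eventually (\<lambda>x. dist (l x) (l a) < e) (nhds a)"
      using 1 2
    proof eventually_elim
      case (elim x)
      have "\<bar>l (x - a)\<bar> \<le> d" by (rule l_small[OF d elim])
      then show ?case using e l(1) by (simp add: linear_diff dist_real_def d_def)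
    qed
  qed
  then have "continuous_on UNIV l"
    by (auto simp: continuous_on_def intro: tendsto_mono[OF at_within_le_nhds])
  with l \<open>1 \<le> p z\<close> show ?thesis by (intro exI[of _ l]) auto
qed

subsection \<open>Continuous affine functions on a compact convex set\<close>

definition linear_functional_on :: "('a \<Rightarrow> real) set \<Rightarrow> (('a \<Rightarrow> real) \<Rightarrow> real) \<Rightarrow> bool" where
  "linear_functional_on V \<phi> \<longleftrightarrow> (\<forall>f\<in>V. \<forall>g\<in>V. \<phi> (\<lambda>x. f x + g x) = \<phi> f + \<phi> g) \<and>
     (\<forall>c. \<forall>f\<in>V. \<phi> (\<lambda>x. c * f x) = c * \<phi> f)"

definition function_space :: "('a \<Rightarrow> real) set \<Rightarrow> bool" where
  "function_space V \<longleftrightarrow> (\<lambda>_. 0) \<in> V \<and> (\<forall>f\<in>V. \<forall>g\<in>V. (\<lambda>x. f x + g x) \<in> V) \<and> (\<forall>c. \<forall>f\<in>V. (\<lambda>x. c * f x) \<in> V)"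

lemma linear_functional_on_add:
  "linear_functional_on V \<phi> \<Longrightarrow> f \<in> V \<Longrightarrow> g \<in> V \<Longrightarrow> \<phi> (\<lambda>x. f x + g x) = \<phi> f + \<phi> g"
  and linear_functional_on_scale:
  "linear_functional_on V \<phi> \<Longrightarrow> f \<in> V \<Longrightarrow> \<phi> (\<lambda>x. c * f x) = c * \<phi> f"
  by (auto simp: linear_functional_on_def)

lemma linear_functional_on_zero:
  assumes "linear_functional_on V \<phi>" "function_space V" shows "\<phi> (\<lambda>_. 0) = 0"
  using linear_functional_on_scale[OF assms(1), of "\<lambda>_. 0" 0] assms(2) by (auto simp: function_space_def)

lemma function_space_add: "function_space V \<Longrightarrow> f \<in> V \<Longrightarrow> g \<in> V \<Longrightarrow> (\<lambda>x. f x + g x) \<in> V"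
  and function_space_scale: "function_space V \<Longrightarrow> f \<in> V \<Longrightarrow> (\<lambda>x. c * f x) \<in> V"
  and function_space_zero: "function_space V \<Longrightarrow> (\<lambda>_. 0) \<in> V"
  by (auto simp: function_space_def)

lemma function_space_diff:
  assumes "function_space V" "f \<in> V" "g \<in> V" shows "(\<lambda>x. f x - g x) \<in> V"
  using function_space_add[OF assms(1,2) function_space_scale[OF assms(1,3), of "-1"]] by simp

lemma linear_functional_on_diff:
  assumes "linear_functional_on V \<phi>" "function_space V" "f \<in> V" "g \<in> V"
  shows "\<phi> (\<lambda>x. f x - g x) = \<phi> f - \<phi> g"
  using linear_functional_on_add[OF assms(1,3) function_space_scale[OF assms(2,4), of "-1"]]
    linear_functional_on_scale[OF assms(1,4), of "-1"] by simp

lemma linear_functional_on_divide: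
  "linear_functional_on V \<phi> \<Longrightarrow> linear_functional_on V (\<lambda>f. \<phi> f / c)"
  by (simp add: linear_functional_on_def add_divide_distrib)

lemma function_space_sum:
  assumes "function_space V" "\<And>i. i \<in> F \<Longrightarrow> f i \<in> V"
  shows "(\<lambda>x. \<Sum>i\<in>F. c i * f i x) \<in> V"
  using assms(2)
proof (induction F rule: infinite_finite_induct)
  case (insert i F)
  then show ?case
    using function_space_add[OF assms(1), of "\<lambda>x. c i * f i x" "\<lambda>x. \<Sum>i\<in>F. c i * f i x"]
      function_space_scale[OF assms(1)] by simp
qed (auto simp: function_space_zero[OF assms(1)])

lemma linear_functional_on_sum:
  assumes "linear_functional_on V \<phi>" "function_space V" "\<And>i. i \<in> F \<Longrightarrow> f i \<in> V"
  shows "\<phi> (\<lambda>x. \<Sum>i\<in>F. c i * f i x) = (\<Sum>i\<in>F. c i * \<phi> (f i))"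
  using assms(3)
proof (induction F rule: infinite_finite_induct)
  case (insert i F)
  then have "\<phi> (\<lambda>x. \<Sum>i\<in>insert i F. c i * f i x) = \<phi> (\<lambda>x. c i * f i x + (\<Sum>i\<in>F. c i * f i x))"
    by simp
  also have "\<dots> = c i * \<phi> (f i) + \<phi> (\<lambda>x. \<Sum>i\<in>F. c i * f i x)"
    using linear_functional_on_add[OF assms(1), of "\<lambda>x. c i * f i x" "\<lambda>x. \<Sum>i\<in>F. c i * f i x"]
      linear_functional_on_scale[OF assms(1)] insert function_space_scale[OF assms(2)]
      function_space_sum[OF assms(2), of F f c] by simp
  finally show ?case using insert by simp
qed (auto simp: linear_functional_on_zero[OF assms(1,2)])

locale compact_convex =
  fixes K :: "'a::locally_convex_space set"
  assumes compact_K: "compact K" and convex_K: "convex K" and K_ne: "K \<noteq> {}"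
begin

abbreviation "A \<equiv> A_space K"
abbreviation "X \<equiv> {x. x extreme_point_of K}"

definition unit :: "'a \<Rightarrow> real" where "unit = (\<lambda>x. if x \<in> K then 1 else 0)"

lemma X_subset: "X \<subseteq> K" by (auto simp: extreme_point_of_def)

lemma convex_combination_mem:
  "x \<in> K \<Longrightarrow> y \<in> K \<Longrightarrow> u \<ge> 0 \<Longrightarrow> v \<ge> 0 \<Longrightarrow> u + v = 1 \<Longrightarrow> u *\<^sub>R x + v *\<^sub>R y \<in> K"
  using convex_K by (auto simp: convex_def)

lemma A_continuous: "f \<in> A \<Longrightarrow> continuous_on K f"
  and A_affine: "f \<in> A \<Longrightarrow> x \<in> K \<Longrightarrow> y \<in> K \<Longrightarrow> u \<ge> 0 \<Longrightarrow> v \<ge> 0 \<Longrightarrow> u + v = 1 \<Longrightarrow>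
    f (u *\<^sub>R x + v *\<^sub>R y) = u * f x + v * f y"
  and A_outside: "f \<in> A \<Longrightarrow> x \<notin> K \<Longrightarrow> f x = 0"
  by (auto simp: A_space_def affine_fun_on_def)

lemma A_restrictI:
  assumes "continuous_on K f" "affine_fun_on K f"
  shows "(\<lambda>x. if x \<in> K then f x else 0) \<in> A"
  unfolding A_space_def
proof (intro CollectI conjI)
  show "continuous_on K (\<lambda>x. if x \<in> K then f x else 0)"
    using assms(1) by (rule continuous_on_eq) auto
  show "affine_fun_on K (\<lambda>x. if x \<in> K then f x else 0)"
    using assms(2) convex_combination_mem by (auto simp: affine_fun_on_def)
qed auto

lemma function_space_A: "function_space A"
  unfolding function_space_def A_space_def affine_fun_on_def
  by (auto intro!: continuous_intros simp: algebra_simps)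

lemmas A_add = function_space_add[OF function_space_A]
  and A_scale = function_space_scale[OF function_space_A]
  and A_diff = function_space_diff[OF function_space_A]

lemma unit_A: "unit \<in> A"
  unfolding unit_def by (rule A_restrictI) (auto simp: affine_fun_on_def)

lemma unit_eq [simp]: "x \<in> K \<Longrightarrow> unit x = 1" by (simp add: unit_def)

lemma A_eqI: "f \<in> A \<Longrightarrow> g \<in> A \<Longrightarrow> (\<And>x. x \<in> K \<Longrightarrow> f x = g x) \<Longrightarrow> f = g"
  using A_outside by (metis ext)

lemma A_separates:
  assumes "x \<in> K" "y \<in> K" "x \<noteq> y" shows "\<exists>f\<in>A. f x \<noteq> f y"
proof -
  obtain l :: "'a \<Rightarrow> real" where l: "linear l" "continuous_on UNIV l" "l (x - y) \<noteq> 0"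
    using linear_functional_separates[of "x - y"] assms by auto
  have "(\<lambda>x. if x \<in> K then l x else 0) \<in> A"
    by (rule A_restrictI)
      (use l in \<open>auto simp: affine_fun_on_def linear_add linear_cmul intro: continuous_on_subset\<close>)
  then show ?thesis
    using l assms by (intro bexI[of _ "\<lambda>x. if x \<in> K then l x else 0"]) (auto simp: linear_diff)
qed

lemma A_max: "f \<in> A \<Longrightarrow> \<exists>x\<in>K. \<forall>y\<in>K. f y \<le> f x"
  using continuous_attains_sup[OF compact_K K_ne A_continuous] by blast

lemma A_norm_attained:
  assumes "f \<in> A" obtains x where "x \<in> K" "A_norm K f = \<bar>f x\<bar>" "\<And>y. y \<in> K \<Longrightarrow> \<bar>f y\<bar> \<le> \<bar>f x\<bar>"
proof -
  have "continuous_on K (\<lambda>x. \<bar>f x\<bar>)" by (intro continuous_intros A_continuous assms)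
  from continuous_attains_sup[OF compact_K K_ne this]
  obtain x where x: "x \<in> K" "\<And>y. y \<in> K \<Longrightarrow> \<bar>f y\<bar> \<le> \<bar>f x\<bar>" by blast
  have "(SUP x\<in>K. \<bar>f x\<bar>) = \<bar>f x\<bar>"
    by (rule cSup_eq_maximum) (use x in auto)
  then show ?thesis using that x K_ne by (auto simp: A_norm_def)
qed

lemma A_norm_ge: "f \<in> A \<Longrightarrow> x \<in> K \<Longrightarrow> \<bar>f x\<bar> \<le> A_norm K f"
  by (metis A_norm_attained)

text \<open>A convex function that is maximal inside a segment is maximal at both ends, so its
  maximum set is closed and extremal. A point of this set that is extremal relative to K is an
  extreme point of K.\<close>

lemma bauer_maximum:
  assumes cont: "continuous_on K \<phi>" and conv: "convex_on K \<phi>"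
  shows "\<exists>x\<in>X. \<forall>y\<in>K. \<phi> y \<le> \<phi> x"
proof -
  obtain m where m: "m \<in> K" "\<And>y. y \<in> K \<Longrightarrow> \<phi> y \<le> \<phi> m"
    using continuous_attains_sup[OF compact_K K_ne cont] by blast
  let ?C = "{x \<in> K. \<phi> x = \<phi> m}"
  have "\<exists>x\<in>?C. \<forall>y\<in>K. \<forall>z\<in>K. x \<in> open_segment y z \<longrightarrow> y = x \<and> z = x"
  proof (rule extremal_point_exists[where F = A and btw = "\<lambda>x y z. x \<in> open_segment y z", OF compact_K])
    show "\<exists>t>0. t < 1 \<and> f x = (1 - t) * f y + t * f z"
      if h: "f \<in> A" "x \<in> K" "y \<in> K" "z \<in> K" "x \<in> open_segment y z" for f x y z
    proof -
      obtain t where t: "0 < t" "t < 1" "x = (1 - t) *\<^sub>R y + t *\<^sub>R z"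
        using h by (auto simp: in_segment)
      then show ?thesis using A_affine[OF h(1,3,4), of "1 - t" t] by auto
    qed
    show "closedin (top_of_set K) ?C"
      by (rule continuous_closedin_preimage_constant[OF cont])
    show "?C \<noteq> {}" using m by auto
    show "y \<in> ?C \<and> z \<in> ?C" if h: "x \<in> ?C" "y \<in> K" "z \<in> K" "x \<in> open_segment y z" for x y z
    proof -
      obtain t where t: "0 < t" "t < 1" "x = (1 - t) *\<^sub>R y + t *\<^sub>R z"
        using h by (auto simp: in_segment)
      have "\<phi> m \<le> (1 - t) * \<phi> y + t * \<phi> z"
        using convex_onD[OF conv, of t y z] h t by auto
      then have "(1 - t) * (\<phi> m - \<phi> y) + t * (\<phi> m - \<phi> z) \<le> 0" by (simp add: algebra_simps)
      moreover have "(1 - t) * (\<phi> m - \<phi> y) \<ge> 0" "t * (\<phi> m - \<phi> z) \<ge> 0" using t m h by auto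
      ultimately have "(1 - t) * (\<phi> m - \<phi> y) = 0" "t * (\<phi> m - \<phi> z) = 0" by linarith+
      then show ?thesis using t h by auto
    qed
  qed (auto intro: A_continuous A_separates)
  then obtain x where x: "x \<in> ?C" "\<And>y z. y \<in> K \<Longrightarrow> z \<in> K \<Longrightarrow> x \<in> open_segment y z \<Longrightarrow> y = x \<and> z = x"
    by blast
  have "x \<notin> open_segment y z" if "y \<in> K" "z \<in> K" for y z
    using x(2)[OF that] by (metis open_segment_idem empty_iff)
  then have "x \<in> X" using x(1) by (auto simp: extreme_point_of_def)
  then show ?thesis using m x(1) by (intro bexI[of _ x]) auto
qed

lemma X_ne: "X \<noteq> {}"
  using bauer_maximum[of "\<lambda>_. 0"] convex_K by (auto simp: convex_on_def)

lemma convex_le_on_extreme: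
  assumes "continuous_on K \<phi>" "convex_on K \<phi>" "\<And>x. x \<in> X \<Longrightarrow> \<phi> x \<le> c" "y \<in> K"
  shows "\<phi> y \<le> c"
  using bauer_maximum[OF assms(1,2)] assms(3,4) by force

lemma A_convex_on:
  assumes "f \<in> A" shows "convex_on K f"
  by (rule convex_onI) (use A_affine[OF assms] convex_K in auto)

lemma A_le_on_extreme:
  assumes "f \<in> A" "g \<in> A" "\<And>x. x \<in> X \<Longrightarrow> f x \<le> g x" "y \<in> K"
  shows "f y \<le> g y"
proof -
  have "(\<lambda>x. f x - g x) \<in> A" by (rule A_diff[OF assms(1,2)])
  from convex_le_on_extreme[OF A_continuous[OF this] A_convex_on[OF this], of 0 y] assms show ?thesis by force
qed

text \<open>Weights are not normalised, so that parts of arbitrary mass can be mixed; if the total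
  mass is 0, any point serves.\<close>

lemma mixture_point:
  assumes "y \<in> K" "z \<in> K" "a \<ge> 0" "b \<ge> 0"
  shows "\<exists>w\<in>K. \<forall>f\<in>A. a * f y + b * f z = (a + b) * f w"
proof (cases "a + b = 0")
  case True
  then have "a = 0" "b = 0" using assms by auto
  then show ?thesis using assms by auto
next
  case False
  let ?w = "(a / (a + b)) *\<^sub>R y + (b / (a + b)) *\<^sub>R z"
  have p: "a / (a + b) \<ge> 0" "b / (a + b) \<ge> 0" "a / (a + b) + b / (a + b) = 1"
    using assms False by (auto simp: add_divide_distrib[symmetric])
  have "a * f y + b * f z = (a + b) * f ?w" if "f \<in> A" for f
    unfolding A_affine[OF that assms(1,2) p] using False by (simp add: distrib_left)
  then show ?thesis using convex_combination_mem[OF assms(1,2) p] by blast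
qed

text \<open>Evaluations embed K as a compact convex set in a product of lines. A finite combination
  of coordinates is one affine function \<open>g\<close>, and positivity together with
  \<open>\<phi> unit = 1\<close> bounds \<open>\<phi> g\<close> by the maximum of \<open>g\<close>
  on K, so separation cannot exclude \<open>\<phi>\<close>.\<close>

lemma state_is_evaluation:
  assumes lin: "linear_functional_on A \<phi>" and pos: "\<And>f. f \<in> A_pos K \<Longrightarrow> 0 \<le> \<phi> f" and one: "\<phi> unit = 1"
  shows "\<exists>x\<in>K. \<forall>f\<in>A. \<phi> f = f x"
proof -
  \<comment> \<open>Coordinates outside \<open>A\<close> are set to 0, since an arbitrary
    \<open>f\<close> need not vary continuously with \<open>x\<close>.\<close>
  define S where "S = (\<lambda>x f. if f \<in> A then f x else 0) ` K"
  have "\<exists>s\<in>S. \<forall>f\<in>A. s f = \<phi> f"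
  proof (rule compact_convex_product_mem)
    show "compact S"
      unfolding S_def
    proof (intro compact_continuous_image continuous_on_coordinatewise_then_product compact_K)
      show "continuous_on K (\<lambda>x. if f \<in> A then f x else 0)" for f
        by (cases "f \<in> A") (auto intro: A_continuous)
    qed
    show "S \<noteq> {}" using K_ne by (auto simp: S_def)
    show "(\<lambda>f. (1 - c) * s f + c * t f) \<in> S" if st: "s \<in> S" "t \<in> S" and c: "0 \<le> c" "c \<le> 1" for s t c
    proof -
      obtain x y where xy: "x \<in> K" "y \<in> K" "s = (\<lambda>f. if f \<in> A then f x else 0)" "t = (\<lambda>f. if f \<in> A then f y else 0)"
        using st unfolding S_def by blast
      obtain w where "w \<in> K" "\<forall>f\<in>A. (1 - c) * f x + c * f y = (1 - c + c) * f w"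
        using mixture_point[of x y "1 - c" c] xy c by auto
      then show ?thesis unfolding S_def xy by (intro image_eqI[of _ _ w]) auto
    qed
    show "\<exists>s\<in>S. (\<Sum>f\<in>F. c f * \<phi> f) \<le> (\<Sum>f\<in>F. c f * s f)" if F: "finite F" "F \<subseteq> A" for F c
    proof -
      define g where "g = (\<lambda>x. \<Sum>f\<in>F. c f * f x)"
      have g: "g \<in> A" unfolding g_def by (rule function_space_sum[OF function_space_A]) (use F in auto)
      obtain x where x: "x \<in> K" "\<And>y. y \<in> K \<Longrightarrow> g y \<le> g x" using A_max[OF g] by blast
      have "(\<Sum>f\<in>F. c f * \<phi> f) = \<phi> g"
        unfolding g_def by (rule linear_functional_on_sum[OF lin function_space_A, symmetric]) (use F in auto)
      also have "\<dots> \<le> g x"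
      proof -
        have "0 \<le> \<phi> (\<lambda>y. g x * unit y - g y)"
          by (rule pos) (use x A_diff[OF A_scale[OF unit_A] g] in \<open>auto simp: A_pos_def\<close>)
        then show ?thesis
          using linear_functional_on_diff[OF lin function_space_A A_scale[OF unit_A] g, of "g x"]
            linear_functional_on_scale[OF lin unit_A, of "g x"] one by simp
      qed
      also have "\<dots> = (\<Sum>f\<in>F. c f * (if f \<in> A then f x else 0))"
        unfolding g_def using F by (intro sum.cong) auto
      finally show ?thesis
        using x(1) unfolding S_def by (intro bexI[of _ "\<lambda>f. if f \<in> A then f x else 0"]) auto
    qed
  qed
  then obtain x where "x \<in> K" "\<forall>f\<in>A. (if f \<in> A then f x else 0) = \<phi> f" unfolding S_def by blast
  then show ?thesis by (intro bexI[of _ x]) auto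
qed

text \<open>Every \<open>f\<close> in \<open>A\<close> is squeezed between two multiples of
  \<open>unit\<close>.\<close>

lemma positive_functional_zero:
  assumes lin: "linear_functional_on A \<phi>" and pos: "\<And>f. f \<in> A_pos K \<Longrightarrow> 0 \<le> \<phi> f" and zero: "\<phi> unit = 0"
    and f: "f \<in> A"
  shows "\<phi> f = 0"
proof -
  let ?c = "A_norm K f"
  have b: "f x \<le> ?c" "- f x \<le> ?c" if "x \<in> K" for x using A_norm_ge[OF f that] by auto
  have "0 \<le> \<phi> (\<lambda>x. ?c * unit x - f x)"
    by (rule pos) (use A_diff[OF A_scale[OF unit_A] f] b in \<open>auto simp: A_pos_def\<close>)
  moreover have "\<phi> (\<lambda>x. ?c * unit x - f x) = - \<phi> f"
    using linear_functional_on_diff[OF lin function_space_A A_scale[OF unit_A] f, of ?c]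
      linear_functional_on_scale[OF lin unit_A, of ?c] zero by simp
  moreover have "0 \<le> \<phi> (\<lambda>x. ?c * unit x + f x)"
    by (rule pos) (use A_add[OF A_scale[OF unit_A] f] b in \<open>fastforce simp: A_pos_def\<close>)
  moreover have "\<phi> (\<lambda>x. ?c * unit x + f x) = \<phi> f"
    using linear_functional_on_add[OF lin A_scale[OF unit_A] f, of ?c]
      linear_functional_on_scale[OF lin unit_A, of ?c] zero by simp
  ultimately show ?thesis by simp
qed

text \<open>For \<open>0 < \<phi> unit < 1\<close> the normalised \<open>\<phi>\<close> and the
  normalised remainder are states, hence evaluations at points with \<open>x\<close> between them;
  extremality makes both equal to \<open>x\<close>. If the mass is 0 or 1, \<open>\<phi>\<close> or
  the remainder vanishes. This is the source of all multiplicativity at extreme points.\<close>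

lemma functional_below_extreme:
  assumes x: "x \<in> X" and lin: "linear_functional_on A \<phi>"
    and pos: "\<And>f. f \<in> A_pos K \<Longrightarrow> 0 \<le> \<phi> f" and le: "\<And>f. f \<in> A_pos K \<Longrightarrow> \<phi> f \<le> f x"
    and f: "f \<in> A"
  shows "\<phi> f = \<phi> unit * f x"
proof -
  have xK: "x \<in> K" using x X_subset by auto
  have unit_pos: "unit \<in> A_pos K" using unit_A by (auto simp: A_pos_def)
  define t where "t = \<phi> unit"
  have t01: "0 \<le> t" "t \<le> 1" using pos[OF unit_pos] le[OF unit_pos] xK by (auto simp: t_def)
  have lin': "linear_functional_on A (\<lambda>f. f x - \<phi> f)"
    using lin by (auto simp: linear_functional_on_def algebra_simps)
  consider "t = 0" | "t = 1" | "0 < t" "t < 1" using t01 by linarith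
  then show ?thesis
  proof cases
    case 1
    then show ?thesis using positive_functional_zero[OF lin pos _ f] by (simp add: t_def)
  next
    case 2
    have "f x - \<phi> f = 0"
      by (rule positive_functional_zero[OF lin' _ _ f]) (use le 2 xK in \<open>auto simp: t_def\<close>)
    then show ?thesis using 2 by (simp add: t_def)
  next
    case 3
    have "\<exists>y\<in>K. \<forall>f\<in>A. \<phi> f / t = f y"
      by (rule state_is_evaluation)
        (use lin pos 3 in \<open>auto simp: linear_functional_on_def add_divide_distrib t_def\<close>)
    then obtain y where y: "y \<in> K" "\<And>f. f \<in> A \<Longrightarrow> \<phi> f = t * f y" using 3 by (auto simp: field_simps)
    have "\<exists>z\<in>K. \<forall>f\<in>A. (f x - \<phi> f) / (1 - t) = f z"
    proof (rule state_is_evaluation)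
      show "linear_functional_on A (\<lambda>f. (f x - \<phi> f) / (1 - t))"
        by (rule linear_functional_on_divide[OF lin'])
    qed (use le 3 xK in \<open>auto simp: t_def\<close>)
    then obtain z where z: "z \<in> K" "\<And>f. f \<in> A \<Longrightarrow> f x - \<phi> f = (1 - t) * f z"
      using 3 by (auto simp: field_simps)
    let ?w = "(1 - t) *\<^sub>R z + t *\<^sub>R y"
    have w: "?w \<in> K" using convex_combination_mem[OF z(1) y(1), of "1 - t" t] 3 by simp
    have "g x = g ?w" if "g \<in> A" for g
      using A_affine[OF that z(1) y(1), of "1 - t" t] 3 y(2)[OF that] z(2)[OF that] by simp
    then have "x = ?w" using A_separates[OF xK w] by blast
    moreover have "x \<notin> open_segment z y" using x y z unfolding extreme_point_of_def by blast
    ultimately have "z = y" using 3 unfolding in_segment by blast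
    then have "x = y" using \<open>x = ?w\<close> by (metis add.commute diff_add_cancel scaleR_add_left scaleR_one)
    then show ?thesis using y(2)[OF f] by (simp add: t_def)
  qed
qed

text \<open>The differences of evaluations with total mass \<open>C\<close> form a compact convex
  set whose support function at \<open>g\<close> is \<open>C * A_norm K g\<close>, so the norm bound
  puts \<open>\<psi>\<close> into it. The exact equality \<open>a + b = C\<close> later makes the
  norm of the predual a base norm.\<close>

lemma bounded_functional_decomposition:
  assumes lin: "linear_functional_on A \<psi>" and C: "C \<ge> 0"
    and bd: "\<And>f. f \<in> A \<Longrightarrow> \<bar>\<psi> f\<bar> \<le> C * A_norm K f"
  shows "\<exists>y\<in>K. \<exists>z\<in>K. \<exists>a\<ge>0. \<exists>b\<ge>0. a + b = C \<and> (\<forall>f\<in>A. \<psi> f = a * f y - b * f z)"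
proof -
  define T where "T p f = (if f \<in> A then C * (fst p * f (fst (snd p)) - (1 - fst p) * f (snd (snd p))) else 0)"
    for p :: "real \<times> 'a \<times> 'a" and f
  define D where "D = {0..1::real} \<times> K \<times> K"
  have "\<exists>s\<in>T ` D. \<forall>f\<in>A. s f = \<psi> f"
  proof (rule compact_convex_product_mem)
    have "compact D" unfolding D_def by (intro compact_Times compact_K compact_Icc)
    moreover have "continuous_on D (\<lambda>p. T p f)" for f
    proof (cases "f \<in> A")
      case True
      then have "continuous_on D (\<lambda>p. f (fst (snd p)))" "continuous_on D (\<lambda>p. f (snd (snd p)))"
        by (auto intro!: continuous_on_compose2[OF A_continuous[OF True]] continuous_intros simp: D_def)
      then have "continuous_on D (\<lambda>p. C * (fst p * f (fst (snd p)) - (1 - fst p) * f (snd (snd p))))"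
        by (intro continuous_intros)
      then show ?thesis using True by (simp add: T_def)
    qed (simp add: T_def)
    ultimately show "compact (T ` D)"
      by (intro compact_continuous_image continuous_on_coordinatewise_then_product)
    show "T ` D \<noteq> {}" using K_ne by (auto simp: D_def)
    show "(\<lambda>f. (1 - c) * s f + c * t f) \<in> T ` D" if st: "s \<in> T ` D" "t \<in> T ` D" and c: "0 \<le> c" "c \<le> 1" for s t c
    proof -
      obtain a y z where s: "0 \<le> a" "a \<le> 1" "y \<in> K" "z \<in> K" "s = T (a, y, z)"
        using st by (auto simp: D_def)
      obtain b y' z' where t: "0 \<le> b" "b \<le> 1" "y' \<in> K" "z' \<in> K" "t = T (b, y', z')"
        using st by (auto simp: D_def)
      \<comment> \<open>Positive parts are mixed with positive parts and negative with negative;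
        \<open>d\<close> and \<open>1 - d\<close> are the resulting shares of the mass.\<close>
      define d where "d = (1 - c) * a + c * b"
      have d1: "1 - d = (1 - c) * (1 - a) + c * (1 - b)" by (simp add: d_def algebra_simps)
      have "0 \<le> (1 - c) * (1 - a)" "0 \<le> c * (1 - b)" "0 \<le> (1 - c) * a" "0 \<le> c * b"
        using s t c by auto
      then have d: "0 \<le> d" "d \<le> 1" using d1 by (auto simp: d_def)
      obtain v where v: "v \<in> K" "\<And>f. f \<in> A \<Longrightarrow> ((1 - c) * a) * f y + (c * b) * f y' = d * f v"
        using mixture_point[of y y' "(1 - c) * a" "c * b"] s t c by (auto simp: d_def)
      obtain w where w: "w \<in> K" "\<And>f. f \<in> A \<Longrightarrow> ((1 - c) * (1 - a)) * f z + (c * (1 - b)) * f z' = (1 - d) * f w"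
        using mixture_point[of z z' "(1 - c) * (1 - a)" "c * (1 - b)"] s t c unfolding d1 by auto
      have "(1 - c) * s f + c * t f = T (d, v, w) f" for f
      proof (cases "f \<in> A")
        case True
        then have "(1 - c) * s f + c * t f = C * ((((1 - c) * a) * f y + (c * b) * f y') -
            (((1 - c) * (1 - a)) * f z + (c * (1 - b)) * f z'))"
          by (simp add: s t T_def algebra_simps)
        then show ?thesis using v(2)[OF True] w(2)[OF True] True by (simp add: T_def)
      qed (simp add: s t T_def)
      then show ?thesis using d v w by (intro image_eqI[of _ _ "(d, v, w)"]) (auto simp: D_def)
    qed
    show "\<exists>s\<in>T ` D. (\<Sum>f\<in>F. c f * \<psi> f) \<le> (\<Sum>f\<in>F. c f * s f)" if F: "finite F" "F \<subseteq> A" for F c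
    proof -
      define g where "g = (\<lambda>x. \<Sum>f\<in>F. c f * f x)"
      have g: "g \<in> A" unfolding g_def by (rule function_space_sum[OF function_space_A]) (use F in auto)
      obtain x where x: "x \<in> K" "A_norm K g = \<bar>g x\<bar>" using A_norm_attained[OF g] by metis
      \<comment> \<open>The sign of \<open>g\<close> at a point of maximal modulus decides whether
        all mass goes to the positive or to the negative part.\<close>
      define d :: real where "d = (if g x \<ge> 0 then 1 else 0)"
      have "(\<Sum>f\<in>F. c f * \<psi> f) = \<psi> g"
        unfolding g_def by (rule linear_functional_on_sum[OF lin function_space_A, symmetric]) (use F in auto)
      also have "\<dots> \<le> C * \<bar>g x\<bar>" using bd[OF g] x by simp
      also have "\<dots> = C * (d * g x - (1 - d) * g x)" by (simp add: d_def)
      also have "\<dots> = (\<Sum>f\<in>F. c f * T (d, x, x) f)"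
        unfolding g_def sum_distrib_left sum_subtractf[symmetric]
        by (rule sum.cong) (use F in \<open>auto simp: T_def algebra_simps\<close>)
      finally show ?thesis using x by (intro bexI[of _ "T (d, x, x)"]) (auto simp: D_def d_def)
    qed
  qed
  then obtain t y z where p: "0 \<le> t" "t \<le> 1" "y \<in> K" "z \<in> K" and eq: "\<And>f. f \<in> A \<Longrightarrow> T (t, y, z) f = \<psi> f"
    by (auto simp: D_def)
  have "0 \<le> C * t" "0 \<le> C * (1 - t)" "C * t + C * (1 - t) = C"
    using p C by (auto simp: right_diff_distrib mult_left_le)
  moreover have "\<psi> f = (C * t) * f y - (C * (1 - t)) * f z" if "f \<in> A" for f
    using eq[OF that] that by (simp add: T_def algebra_simps)
  ultimately show ?thesis using p(3,4) by blast
qed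

end

subsection \<open>States on continuous functions\<close>

text \<open>The second clause normalises \<open>\<Lambda>\<close> off \<open>C(Y)\<close>, so that the states form a compact subset of a product of lines.\<close>

definition state_on :: "'a::topological_space set \<Rightarrow> (('a \<Rightarrow> real) \<Rightarrow> real) \<Rightarrow> bool" where
  "state_on Y \<Lambda> \<longleftrightarrow> linear_functional_on {f. continuous_on Y f} \<Lambda> \<and> (\<forall>f. \<not> continuous_on Y f \<longrightarrow> \<Lambda> f = 0) \<and>
     (\<forall>f. continuous_on Y f \<longrightarrow> (\<forall>y\<in>Y. 0 \<le> f y) \<longrightarrow> 0 \<le> \<Lambda> f) \<and> \<Lambda> (\<lambda>_. 1) = 1"

lemma function_space_continuous: "function_space {f. continuous_on Y f}"
  by (auto simp: function_space_def intro!: continuous_intros)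

lemma state_on_add:
  assumes "state_on Y \<Lambda>" "continuous_on Y f" "continuous_on Y g"
  shows "\<Lambda> (\<lambda>x. f x + g x) = \<Lambda> f + \<Lambda> g"
  using assms by (intro linear_functional_on_add[of "{f. continuous_on Y f}"]) (simp_all add: state_on_def)

lemma state_on_scale:
  assumes "state_on Y \<Lambda>" "continuous_on Y f"
  shows "\<Lambda> (\<lambda>x. c * f x) = c * \<Lambda> f"
  using assms by (intro linear_functional_on_scale[of "{f. continuous_on Y f}"]) (simp_all add: state_on_def)

lemma state_on_diff:
  assumes "state_on Y \<Lambda>" "continuous_on Y f" "continuous_on Y g"
  shows "\<Lambda> (\<lambda>x. f x - g x) = \<Lambda> f - \<Lambda> g"
  using assms by (intro linear_functional_on_diff[OF _ function_space_continuous]) (simp_all add: state_on_def)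

lemma state_on_const: "state_on Y \<Lambda> \<Longrightarrow> \<Lambda> (\<lambda>_. c) = c"
  using state_on_scale[of Y \<Lambda> "\<lambda>_. 1" c] by (simp add: state_on_def)

lemma state_on_mono:
  assumes "state_on Y \<Lambda>" "continuous_on Y f" "continuous_on Y g" "\<And>y. y \<in> Y \<Longrightarrow> f y \<le> g y"
  shows "\<Lambda> f \<le> \<Lambda> g"
proof -
  have "0 \<le> \<Lambda> (\<lambda>x. g x - f x)"
    using assms by (auto simp: state_on_def intro!: continuous_intros)
  then show ?thesis using state_on_diff[OF assms(1,3,2)] by simp
qed

lemma state_on_cong:
  assumes "state_on Y \<Lambda>" "continuous_on Y f" "\<And>y. y \<in> Y \<Longrightarrow> f y = g y"
  shows "\<Lambda> f = \<Lambda> g"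
proof -
  have "continuous_on Y g" using continuous_on_eq[OF assms(2,3)] .
  then show ?thesis
    using state_on_mono[OF assms(1,2), of g] state_on_mono[OF assms(1) _ assms(2), of g] assms(3) by force
qed

lemma state_on_abs_le:
  assumes "state_on Y \<Lambda>" "continuous_on Y f" "\<And>y. y \<in> Y \<Longrightarrow> \<bar>f y\<bar> \<le> b"
  shows "\<bar>\<Lambda> f\<bar> \<le> b"
proof -
  have "\<Lambda> f \<le> b"
    using state_on_mono[OF assms(1,2), of "\<lambda>_. b"] assms(3) state_on_const[OF assms(1), of b] by force
  moreover have "- b \<le> \<Lambda> f"
    using state_on_mono[OF assms(1) _ assms(2), of "\<lambda>_. - b"] assms(3) state_on_const[OF assms(1), of "- b"] by force
  ultimately show ?thesis by auto
qed

lemma state_on_evaluation: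
  assumes "y \<in> Y" shows "state_on Y (\<lambda>f. if continuous_on Y f then f y else 0)"
  using assms unfolding state_on_def linear_functional_on_def
  by (simp add: continuous_on_add continuous_on_mult_left)

lemma state_on_convex:
  assumes "state_on Y \<Lambda>" "state_on Y \<Lambda>'" "0 \<le> c" "c \<le> 1"
  shows "state_on Y (\<lambda>f. (1 - c) * \<Lambda> f + c * \<Lambda>' f)"
proof -
  have "linear_functional_on {f. continuous_on Y f} (\<lambda>f. (1 - c) * \<Lambda> f + c * \<Lambda>' f)"
    using assms unfolding state_on_def linear_functional_on_def by (auto simp: algebra_simps)
  moreover have "0 \<le> (1 - c) * \<Lambda> f + c * \<Lambda>' f" if "continuous_on Y f" "\<forall>y\<in>Y. 0 \<le> f y" for f
    using assms that unfolding state_on_def by (intro add_nonneg_nonneg mult_nonneg_nonneg) auto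
  ultimately show ?thesis using assms unfolding state_on_def by auto
qed

lemma closed_linear_functionals: "closed {w. linear_functional_on V w}"
proof -
  have "{w. linear_functional_on V w} = (\<Inter>f\<in>V. \<Inter>g\<in>V. {w. w (\<lambda>x. f x + g x) = w f + w g}) \<inter>
      (\<Inter>c. \<Inter>f\<in>V. {w. w (\<lambda>x. c * f x) = c * w f})"
    by (auto simp: linear_functional_on_def)
  then show ?thesis
    by (auto intro!: closed_INT closed_Int closed_Collect_eq continuous_intros)
qed

text \<open>Banach--Alaoglu in product form: a box given by sup bounds, cut by closed conditions
  that involve finitely many coordinates each. The factor is the point 0 at functions that are not
  continuous on \<open>Y\<close>, in line with the normalisation in \<open>state_on\<close>.\<close>

lemma compact_states:
  assumes "compact Y" shows "compact {\<Lambda>. state_on Y \<Lambda>}"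
proof -
  have "\<exists>b. \<forall>y\<in>Y. \<bar>f y\<bar> \<le> b" if "continuous_on Y f" for f :: "'a \<Rightarrow> real"
    using compact_imp_bounded[OF compact_continuous_image[OF that assms]]
    by (auto simp: bounded_real)
  then obtain b :: "('a \<Rightarrow> real) \<Rightarrow> real" where b: "\<And>f y. continuous_on Y f \<Longrightarrow> y \<in> Y \<Longrightarrow> \<bar>f y\<bar> \<le> b f"
    by metis
  define B where "B f = (if continuous_on Y f then {- b f..b f} else {0})" for f
  let ?L = "{w. linear_functional_on {f. continuous_on Y f} w}"
  let ?P = "\<Inter>f\<in>{f. continuous_on Y f \<and> (\<forall>y\<in>Y. 0 \<le> f y)}. {w. 0 \<le> w f}"
  let ?N = "{w. w (\<lambda>_::'a. 1::real) = (1::real)}"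
  have "{\<Lambda>. state_on Y \<Lambda>} = {w. \<forall>f. w f \<in> B f} \<inter> (?L \<inter> ?P \<inter> ?N)"
  proof (intro equalityI subsetI)
    fix \<Lambda> assume L: "\<Lambda> \<in> {\<Lambda>. state_on Y \<Lambda>}"
    have "\<Lambda> f \<in> B f" for f
      using L state_on_abs_le[of Y \<Lambda> f "b f"] b by (auto simp: B_def state_on_def abs_le_iff)
    then show "\<Lambda> \<in> {w. \<forall>f. w f \<in> B f} \<inter> (?L \<inter> ?P \<inter> ?N)"
      using L by (auto simp: state_on_def)
  next
    fix \<Lambda> assume L: "\<Lambda> \<in> {w. \<forall>f. w f \<in> B f} \<inter> (?L \<inter> ?P \<inter> ?N)"
    then have "\<Lambda> f \<in> B f" for f by blast
    then have "\<Lambda> f = 0" if "\<not> continuous_on Y f" for f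
      using that by (metis B_def singletonD)
    with L show "\<Lambda> \<in> {\<Lambda>. state_on Y \<Lambda>}" by (auto simp: state_on_def)
  qed
  moreover have "compact ({w. \<forall>f. w f \<in> B f} \<inter> (?L \<inter> ?P \<inter> ?N))"
  proof (rule compact_Int_closed)
    show "compact {w. \<forall>f. w f \<in> B f}"
      by (rule compact_fun_product) (simp add: B_def)
    show "closed (?L \<inter> ?P \<inter> ?N)"
      by (intro closed_Int closed_linear_functionals closed_INT ballI closed_Collect_le closed_Collect_eq continuous_intros)
  qed
  ultimately show ?thesis by simp
qed

section \<open>States that extend an evaluation, and their uniqueness at extreme points\<close>

context compact_convex
begin

lemma A_continuous_subset: "f \<in> A \<Longrightarrow> Y \<subseteq> K \<Longrightarrow> continuous_on Y f"
  by (rule continuous_on_subset[OF A_continuous])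

text \<open>One-step Hahn--Banach extension in separation form. A finite combination is
  \<open>g + k \<psi>\<close> with \<open>g\<close> affine, and its maximum \<open>m\<close> on
  \<open>Y\<close> must dominate \<open>g x + k s\<close>. The affine function
  \<open>(m - g) / k\<close> lies above \<open>\<psi>\<close> on \<open>Y\<close> for
  \<open>k > 0\<close> and below it for \<open>k < 0\<close>, so \<open>up\<close> or
  \<open>lo\<close> applies; for \<open>k = 0\<close> the bound passes from \<open>X\<close> to
  K.\<close>

lemma evaluation_extends:
  assumes Y: "compact Y" "X \<subseteq> Y" "Y \<subseteq> K" and x: "x \<in> K" and \<psi>: "continuous_on Y \<psi>"
    and up: "\<And>h. h \<in> A \<Longrightarrow> (\<And>y. y \<in> Y \<Longrightarrow> \<psi> y \<le> h y) \<Longrightarrow> s \<le> h x"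
    and lo: "\<And>h. h \<in> A \<Longrightarrow> (\<And>y. y \<in> Y \<Longrightarrow> h y \<le> \<psi> y) \<Longrightarrow> h x \<le> s"
  shows "\<exists>\<Lambda>. state_on Y \<Lambda> \<and> (\<forall>f\<in>A. \<Lambda> f = f x) \<and> \<Lambda> \<psi> = s"
proof -
  define z where "z f = (if f = \<psi> then s else f x)" for f
  have "\<exists>\<Lambda>\<in>{\<Lambda>. state_on Y \<Lambda>}. \<forall>f\<in>insert \<psi> A. \<Lambda> f = z f"
  proof (rule compact_convex_product_mem[OF compact_states[OF Y(1)]])
    show "{\<Lambda>. state_on Y \<Lambda>} \<noteq> {}"
      using X_ne Y(2) state_on_evaluation by blast
    show "(\<lambda>f. (1 - c) * \<Lambda> f + c * \<Lambda>' f) \<in> {\<Lambda>. state_on Y \<Lambda>}"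
      if "\<Lambda> \<in> {\<Lambda>. state_on Y \<Lambda>}" "\<Lambda>' \<in> {\<Lambda>. state_on Y \<Lambda>}" "0 \<le> c" "c \<le> 1" for \<Lambda> \<Lambda>' c
      using that state_on_convex by blast
    show "\<exists>\<Lambda>\<in>{\<Lambda>. state_on Y \<Lambda>}. (\<Sum>f\<in>F. c f * z f) \<le> (\<Sum>f\<in>F. c f * \<Lambda> f)"
      if F: "finite F" "F \<subseteq> insert \<psi> A" for F c
    proof -
      define g where "g = (\<lambda>x. \<Sum>f\<in>F - {\<psi>}. c f * f x)"
      define k where "k = (if \<psi> \<in> F then c \<psi> else 0)"
      have g: "g \<in> A" unfolding g_def by (rule function_space_sum[OF function_space_A]) (use F in auto)
      have split: "(\<Sum>f\<in>F. c f * w f) = (\<Sum>f\<in>F - {\<psi>}. c f * w f) + k * w \<psi>" for w :: "('a \<Rightarrow> real) \<Rightarrow> real"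
        using F(1) by (auto simp: k_def sum.remove)
      have "continuous_on Y (\<lambda>y. g y + k * \<psi> y)"
        by (intro continuous_intros \<psi> A_continuous_subset[OF g Y(3)])
      moreover have "Y \<noteq> {}" using X_ne Y(2) by auto
      ultimately obtain y where y: "y \<in> Y" "\<And>y'. y' \<in> Y \<Longrightarrow> g y' + k * \<psi> y' \<le> g y + k * \<psi> y"
        using continuous_attains_sup[OF Y(1)] by blast
      define m where "m = g y + k * \<psi> y"
      have m: "g y' + k * \<psi> y' \<le> m" if "y' \<in> Y" for y' using y that by (simp add: m_def)
      define e :: "('a \<Rightarrow> real) \<Rightarrow> real" where "e = (\<lambda>f. if continuous_on Y f then f y else 0)"
      have "(\<Sum>f\<in>F. c f * z f) = g x + k * s"
        unfolding split g_def by (simp add: z_def)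
      also have "\<dots> \<le> m"
      proof -
        consider "k = 0" | "k > 0" | "k < 0" by linarith
        then show ?thesis
        proof cases
          case 1
          have "(\<lambda>y. m * unit y) \<in> A" by (rule A_scale[OF unit_A])
          from A_le_on_extreme[OF g this _ x] m 1 Y(2) X_subset x show ?thesis by fastforce
        next
          case 2
          have "s \<le> (\<lambda>y. (1 / k) * (m * unit y - g y)) x"
          proof (rule up)
            show "(\<lambda>y. (1 / k) * (m * unit y - g y)) \<in> A" by (intro A_scale A_diff unit_A g)
            show "\<psi> y \<le> (1 / k) * (m * unit y - g y)" if "y \<in> Y" for y
              using m[OF that] that Y(3) 2 by (auto simp: field_simps)
          qed
          then show ?thesis using 2 x by (simp add: field_simps)
        next
          case 3
          have "(\<lambda>y. (1 / k) * (m * unit y - g y)) x \<le> s"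
          proof (rule lo)
            show "(\<lambda>y. (1 / k) * (m * unit y - g y)) \<in> A" by (intro A_scale A_diff unit_A g)
            show "(1 / k) * (m * unit y - g y) \<le> \<psi> y" if "y \<in> Y" for y
              using m[OF that] that Y(3) 3 by (auto simp: field_simps)
          qed
          then show ?thesis using 3 x by (simp add: field_simps)
        qed
      qed
      also have "m = (\<Sum>f\<in>F. c f * e f)"
      proof -
        have "e \<psi> = \<psi> y" using \<psi> by (simp add: e_def)
        moreover have "(\<Sum>f\<in>F - {\<psi>}. c f * e f) = g y"
          unfolding g_def by (rule sum.cong) (use F A_continuous_subset[OF _ Y(3)] in \<open>auto simp: e_def\<close>)
        ultimately show ?thesis unfolding split by (simp add: m_def)
      qed
      finally have "(\<Sum>f\<in>F. c f * z f) \<le> (\<Sum>f\<in>F. c f * e f)" .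
      moreover have "state_on Y e" unfolding e_def by (rule state_on_evaluation[OF y(1)])
      ultimately show ?thesis by (intro bexI[of _ e]) auto
    qed
  qed
  then obtain \<Lambda> where L: "state_on Y \<Lambda>" "\<And>f. f \<in> insert \<psi> A \<Longrightarrow> \<Lambda> f = z f" by auto
  \<comment> \<open>The prescription \<open>z\<close> overrides the value at \<open>\<psi>\<close>;
    if \<open>\<psi>\<close> is itself affine, both bounds applied to it show that nothing was
    changed.\<close>
  have "s = \<psi> x" if "\<psi> \<in> A" using up[OF that] lo[OF that] by auto
  then have "\<Lambda> f = f x" if "f \<in> A" for f using L(2)[of f] that by (auto simp: z_def)
  moreover have "\<Lambda> \<psi> = s" using L(2)[of \<psi>] by (simp add: z_def)
  ultimately show ?thesis using L(1) by blast
qed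

text \<open>For \<open>0 \<le> w \<le> 1\<close> the functional
  \<open>f \<mapsto> \<Lambda> (w f)\<close> lies between 0 and evaluation at \<open>x\<close> on
  the positive cone, so extremality makes it a multiple of that evaluation. A general
  \<open>w\<close> is an affine image of such a function.\<close>

lemma state_representing_extreme_mult:
  assumes x: "x \<in> X" and L: "state_on K \<Lambda>" and ev: "\<And>f. f \<in> A \<Longrightarrow> \<Lambda> f = f x"
    and w: "continuous_on K w" and f: "f \<in> A"
  shows "\<Lambda> (\<lambda>y. w y * f y) = \<Lambda> w * f x"
proof -
  have *: "\<Lambda> (\<lambda>y. w y * f y) = \<Lambda> w * f x"
    if w: "continuous_on K w" and w01: "\<And>y. y \<in> K \<Longrightarrow> 0 \<le> w y \<and> w y \<le> 1" for w
  proof -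
    have c: "continuous_on K (\<lambda>y. w y * f y)" if "f \<in> A" for f
      by (intro continuous_intros w A_continuous that)
    have "\<Lambda> (\<lambda>y. w y * f y) = \<Lambda> (\<lambda>y. w y * unit y) * f x"
    proof (rule functional_below_extreme[OF x _ _ _ f])
      show "linear_functional_on A (\<lambda>f. \<Lambda> (\<lambda>y. w y * f y))"
        unfolding linear_functional_on_def
      proof (intro conjI ballI allI)
        show "\<Lambda> (\<lambda>y. w y * (f y + g y)) = \<Lambda> (\<lambda>y. w y * f y) + \<Lambda> (\<lambda>y. w y * g y)"
          if "f \<in> A" "g \<in> A" for f g
          using state_on_add[OF L c[OF that(1)] c[OF that(2)]] by (simp add: distrib_left)
        show "\<Lambda> (\<lambda>y. w y * (k * f y)) = k * \<Lambda> (\<lambda>y. w y * f y)" if "f \<in> A" for f k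
          using state_on_scale[OF L c[OF that], of k] by (simp add: mult.left_commute)
      qed
      fix g assume g: "g \<in> A_pos K"
      then have gA: "g \<in> A" by (simp add: A_pos_def)
      show "0 \<le> \<Lambda> (\<lambda>y. w y * g y)"
        using L c[OF gA] w01 g by (auto simp: state_on_def A_pos_def)
      have "\<Lambda> (\<lambda>y. w y * g y) \<le> \<Lambda> g"
        by (rule state_on_mono[OF L c[OF gA] A_continuous[OF gA]])
          (use w01 g in \<open>auto simp: A_pos_def mult_left_le_one_le\<close>)
      then show "\<Lambda> (\<lambda>y. w y * g y) \<le> g x" using ev[OF gA] by simp
    qed
    also have "\<Lambda> (\<lambda>y. w y * unit y) = \<Lambda> w"
      by (rule state_on_cong[OF L c[OF unit_A]]) auto
    finally show ?thesis .
  qed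
  obtain m where m: "\<And>y. y \<in> K \<Longrightarrow> \<bar>w y\<bar> \<le> m" "m > 0"
    using compact_imp_bounded[OF compact_continuous_image[OF w compact_K]]
    unfolding bounded_pos by auto
  define v where "v y = (w y + m) / (2 * m)" for y
  have v: "continuous_on K v" unfolding v_def using m by (intro continuous_intros w) auto
  have v01: "0 \<le> v y \<and> v y \<le> 1" if "y \<in> K" for y
    using m(1)[OF that] m(2) by (auto simp: v_def abs_le_iff)
  have wv: "w y = 2 * m * v y - m" for y using m by (simp add: v_def)
  have cf: "continuous_on K f" by (rule A_continuous[OF f])
  have cvf: "continuous_on K (\<lambda>y. v y * f y)" by (intro continuous_intros v cf)
  have "\<Lambda> (\<lambda>y. w y * f y) = \<Lambda> (\<lambda>y. 2 * m * (v y * f y) - m * f y)"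
    by (simp add: wv algebra_simps)
  also have "\<dots> = 2 * m * \<Lambda> (\<lambda>y. v y * f y) - m * \<Lambda> f"
    using state_on_diff[OF L, of "\<lambda>y. 2 * m * (v y * f y)" "\<lambda>y. m * f y"]
      state_on_scale[OF L cvf, of "2 * m"] state_on_scale[OF L cf, of m] cf cvf
    by (simp add: continuous_intros)
  also have "\<dots> = (2 * m * \<Lambda> v - m) * f x"
    using *[OF v v01] ev[OF f] by (simp add: algebra_simps)
  also have "2 * m * \<Lambda> v - m = \<Lambda> (\<lambda>y. 2 * m * v y - m)"
    using state_on_diff[OF L, of "\<lambda>y. 2 * m * v y" "\<lambda>y. m"] state_on_scale[OF L v, of "2 * m"]
      state_on_const[OF L, of m] v by (simp add: continuous_intros)
  also have "(\<lambda>y. 2 * m * v y - m) = w" by (simp add: wv fun_eq_iff)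
  finally show ?thesis .
qed

text \<open>The functions \<open>g\<close> that factor out of \<open>\<Lambda> (w g)\<close> for
  every continuous \<open>w\<close> form a ring, because \<open>w f\<close> is again an admissible
  weight. The ring contains \<open>A\<close> and hence separates points, so Stone--Weierstrass makes
  it dense.\<close>

lemma state_representing_extreme:
  assumes x: "x \<in> X" and L: "state_on K \<Lambda>" and ev: "\<And>f. f \<in> A \<Longrightarrow> \<Lambda> f = f x"
    and \<phi>: "continuous_on K \<phi>"
  shows "\<Lambda> \<phi> = \<phi> x"
proof -
  have xK: "x \<in> K" using x X_subset by auto
  define R where "R = {g. continuous_on K g \<and> (\<forall>w. continuous_on K w \<longrightarrow> \<Lambda> (\<lambda>y. w y * g y) = \<Lambda> w * g x)}"
  interpret function_ring_on R K
  proof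
    show "compact K" by (rule compact_K)
    show "continuous_on K f" if "f \<in> R" for f using that by (simp add: R_def)
    show "(\<lambda>x. f x + g x) \<in> R" if fg: "f \<in> R" "g \<in> R" for f g
      unfolding R_def
    proof (intro CollectI conjI allI impI)
      show "continuous_on K (\<lambda>x. f x + g x)" using fg by (auto simp: R_def intro!: continuous_intros)
      fix w :: "'a \<Rightarrow> real" assume w: "continuous_on K w"
      show "\<Lambda> (\<lambda>y. w y * (f y + g y)) = \<Lambda> w * (f x + g x)"
        using fg w state_on_add[OF L, of "\<lambda>y. w y * f y" "\<lambda>y. w y * g y"]
        by (simp add: R_def distrib_left continuous_intros)
    qed
    show "(\<lambda>x. f x * g x) \<in> R" if fg: "f \<in> R" "g \<in> R" for f g
      unfolding R_def
    proof (intro CollectI conjI allI impI)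
      show "continuous_on K (\<lambda>x. f x * g x)" using fg by (auto simp: R_def intro!: continuous_intros)
      fix w :: "'a \<Rightarrow> real" assume w: "continuous_on K w"
      have "continuous_on K (\<lambda>y. w y * f y)" using fg w by (auto simp: R_def intro!: continuous_intros)
      then have "\<Lambda> (\<lambda>y. (w y * f y) * g y) = \<Lambda> (\<lambda>y. w y * f y) * g x"
        using fg(2) by (auto simp: R_def)
      also have "\<Lambda> (\<lambda>y. w y * f y) = \<Lambda> w * f x" using fg(1) w by (auto simp: R_def)
      finally show "\<Lambda> (\<lambda>y. w y * (f y * g y)) = \<Lambda> w * (f x * g x)" by (simp add: mult.assoc)
    qed
    show "(\<lambda>_. c) \<in> R" for c
      using state_on_scale[OF L, of _ c] by (auto simp: R_def mult.commute[of _ c])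
    show "\<exists>f\<in>R. f y \<noteq> f z" if yz: "y \<in> K" "z \<in> K" "y \<noteq> z" for y z
    proof -
      obtain f where "f \<in> A" "f y \<noteq> f z" using A_separates[OF yz] by blast
      moreover have "f \<in> R" if "f \<in> A" for f
        using state_representing_extreme_mult[OF x L ev _ that] A_continuous[OF that] by (simp add: R_def)
      ultimately show ?thesis by blast
    qed
  qed
  have "\<bar>\<Lambda> \<phi> - \<phi> x\<bar> \<le> 2 * e" if e: "e > 0" for e
  proof -
    obtain g where g: "g \<in> R" "\<And>y. y \<in> K \<Longrightarrow> \<bar>\<phi> y - g y\<bar> < e"
      using Stone_Weierstrass_basic[OF \<phi> e] by blast
    have cg: "continuous_on K g" using g(1) by (simp add: R_def)
    have "continuous_on K w \<longrightarrow> \<Lambda> (\<lambda>y. w y * g y) = \<Lambda> w * g x" for w using g(1) by (simp add: R_def)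
    from this[of "\<lambda>_. 1"] have "\<Lambda> (\<lambda>y. 1 * g y) = \<Lambda> (\<lambda>_. 1) * g x" by simp
    then have "\<Lambda> g = g x" using state_on_const[OF L, of 1] by simp
    moreover have "\<bar>\<Lambda> (\<lambda>y. \<phi> y - g y)\<bar> \<le> e"
      using g(2) by (intro state_on_abs_le[OF L] continuous_intros \<phi> cg) (auto intro: less_imp_le)
    moreover have "\<bar>\<phi> x - g x\<bar> < e" by (rule g(2)[OF xK])
    ultimately show ?thesis using state_on_diff[OF L \<phi> cg] by linarith
  qed
  then have "\<bar>\<Lambda> \<phi> - \<phi> x\<bar> \<le> 0 + e" if "e > 0" for e
    using that by (metis add_0 field_sum_of_halves half_gt_zero mult_2)
  then have "\<bar>\<Lambda> \<phi> - \<phi> x\<bar> \<le> 0" by (rule field_le_epsilon)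
  then show ?thesis by simp
qed

text \<open>Otherwise \<open>\<phi> x + e\<close> would be an admissible value for extending
  evaluation at \<open>x\<close>, giving a state that represents \<open>x\<close> without being the
  evaluation. In other words, the upper affine envelope touches \<open>\<phi>\<close> on
  \<open>X\<close>.\<close>

lemma affine_majorant_at_extreme:
  assumes x: "x \<in> X" and \<phi>: "continuous_on K \<phi>" and e: "e > 0"
  shows "\<exists>h\<in>A. (\<forall>y\<in>K. \<phi> y \<le> h y) \<and> h x < \<phi> x + e"
proof (rule ccontr)
  assume "\<not> ?thesis"
  then have no: "\<phi> x + e \<le> h x" if "h \<in> A" "\<And>y. y \<in> K \<Longrightarrow> \<phi> y \<le> h y" for h
    using that by (meson not_le)
  have xK: "x \<in> K" using x X_subset by auto
  have "\<exists>\<Lambda>. state_on K \<Lambda> \<and> (\<forall>f\<in>A. \<Lambda> f = f x) \<and> \<Lambda> \<phi> = \<phi> x + e"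
  proof (rule evaluation_extends[OF compact_K X_subset order_refl xK \<phi>])
    show "\<phi> x + e \<le> h x" if "h \<in> A" "\<And>y. y \<in> K \<Longrightarrow> \<phi> y \<le> h y" for h by (rule no[OF that])
    show "h x \<le> \<phi> x + e" if "h \<in> A" "\<And>y. y \<in> K \<Longrightarrow> h y \<le> \<phi> y" for h
      using that(2)[OF xK] e by simp
  qed
  then obtain \<Lambda> where "state_on K \<Lambda>" "\<forall>f\<in>A. \<Lambda> f = f x" "\<Lambda> \<phi> = \<phi> x + e" by blast
  then show False using state_representing_extreme[OF x, of \<Lambda> \<phi>] \<phi> e by auto
qed

end

subsection \<open>Riesz representation\<close>

lemma urysohn_compact:
  fixes K :: "'a::t2_space set"
  assumes "compact K" "closedin (top_of_set K) C" "closedin (top_of_set K) D" "C \<inter> D = {}"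
  obtains w :: "'a \<Rightarrow> real" where "continuous_on K w" "\<And>x. x \<in> K \<Longrightarrow> 0 \<le> w x \<and> w x \<le> 1"
    "\<And>x. x \<in> C \<Longrightarrow> w x = 0" "\<And>x. x \<in> D \<Longrightarrow> w x = 1"
proof -
  have "Hausdorff_space (euclidean :: 'a topology)"
    unfolding Hausdorff_space_def disjnt_def using hausdorff by (metis open_openin)
  then have "compact_space (top_of_set K)" "Hausdorff_space (top_of_set K)"
    using assms(1) by (simp_all add: compact_space_subtopology compactin_euclidean_iff Hausdorff_space_subtopology)
  then have "normal_space (top_of_set K)"
    by (simp add: compact_Hausdorff_or_regular_imp_normal_space)
  then obtain w where w: "continuous_map (top_of_set K) (top_of_set {0..1::real}) w" "w ` C \<subseteq> {0}" "w ` D \<subseteq> {1}"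
    using Urysohn_lemma[of "top_of_set K" C D 0 1] assms by (auto simp: disjnt_def)
  have "continuous_on K w" "w \<in> K \<rightarrow> {0..1}"
    using w(1) by (simp_all add: continuous_map_in_subtopology image_subset_iff_funcset)
  moreover have "\<And>x. x \<in> C \<Longrightarrow> w x = 0" "\<And>x. x \<in> D \<Longrightarrow> w x = 1" using w(2,3) by auto
  ultimately show ?thesis using that[of w] by (auto simp: Pi_iff)
qed

lemma radon_prob_space: "radon_prob K \<mu> \<Longrightarrow> prob_space \<mu>"
  and radon_sets: "radon_prob K \<mu> \<Longrightarrow> sets \<mu> = sets (restrict_space borel K)"
  by (auto simp: radon_prob_def)

lemma radon_space: "radon_prob K \<mu> \<Longrightarrow> space \<mu> = K"
  using sets_eq_imp_space_eq[OF radon_sets] by (auto simp: space_restrict_space)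

lemma closedin_measurable:
  fixes K :: "'a::t2_space set"
  assumes "closedin (top_of_set K) C" shows "C \<in> sets (restrict_space borel K)"
  using assms by (auto simp: closedin_closed sets_restrict_space)

lemma openin_measurable:
  fixes K :: "'a::t2_space set"
  assumes "openin (top_of_set K) C" shows "C \<in> sets (restrict_space borel K)"
  using assms by (auto simp: openin_open sets_restrict_space)

lemma compact_closedin:
  fixes K :: "'a::t2_space set"
  assumes "compact C" "C \<subseteq> K" shows "closedin (top_of_set K) C"
  using assms by (auto intro: closed_subset compact_imp_closed)

lemma radon_integrable:
  fixes K :: "'a::t2_space set"
  assumes "compact K" "radon_prob K \<mu>" "continuous_on K (f :: 'a \<Rightarrow> real)"
  shows "integrable \<mu> f"
proof -
  interpret prob_space \<mu> by (rule radon_prob_space[OF assms(2)])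
  have "f \<in> borel_measurable \<mu>"
    using borel_measurable_continuous_on_restrict[OF assms(3)] measurable_cong_sets[OF radon_sets[OF assms(2)] refl]
    by blast
  moreover obtain B where "\<forall>x\<in>K. norm (f x) \<le> B"
    using compact_imp_bounded[OF compact_continuous_image[OF assms(3,1)]] by (auto simp: bounded_iff)
  ultimately show ?thesis
    using radon_space[OF assms(2)] by (intro integrable_const_bound[of _ B]) auto
qed

lemma radon_measure_inner:
  fixes K :: "'a::t2_space set"
  assumes "radon_prob K \<mu>" "B \<in> sets \<mu>" "e > 0"
  obtains C where "compact C" "C \<subseteq> B" "measure \<mu> B \<le> measure \<mu> C + e"
proof -
  interpret prob_space \<mu> by (rule radon_prob_space[OF assms(1)])
  have BK: "B \<subseteq> K" using sets.sets_into_space[OF assms(2)] radon_space[OF assms(1)] by simp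
  \<comment> \<open>If the measure of \<open>B\<close> is at most \<open>e\<close>, the
    \<open>ennreal\<close> difference is truncated to 0 and a strict approximation need not exist;
    hence the disjunction.\<close>
  have "\<exists>C\<in>{C. compact C \<and> C \<subseteq> B}. emeasure \<mu> B - ennreal e < emeasure \<mu> C \<or> emeasure \<mu> B \<le> ennreal e"
  proof (cases "emeasure \<mu> B \<le> ennreal e")
    case False
    then have "emeasure \<mu> B - ennreal e < emeasure \<mu> B"
      using assms(3) by (intro ennreal_between) (auto simp: emeasure_eq_measure not_le)
    also have "\<dots> = (SUP C\<in>{C. compact C \<and> C \<subseteq> B}. emeasure \<mu> C)"
      using assms(1,2) by (auto simp: radon_prob_def)
    finally show ?thesis unfolding less_SUP_iff by blast
  qed auto
  then obtain C where C: "compact C" "C \<subseteq> B" "emeasure \<mu> B - ennreal e < emeasure \<mu> C \<or> emeasure \<mu> B \<le> ennreal e"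
    by blast
  have "measure \<mu> B \<le> measure \<mu> C + e"
    using C(3)
  proof
    assume "emeasure \<mu> B - ennreal e < emeasure \<mu> C"
    then have "ennreal (measure \<mu> B - e) < ennreal (measure \<mu> C)"
      using assms(3) by (simp add: emeasure_eq_measure ennreal_minus)
    then have "measure \<mu> B - e \<le> measure \<mu> C" using ennreal_leI[of "measure \<mu> C" "measure \<mu> B - e"] by force
    then show ?thesis by simp
  next
    assume "emeasure \<mu> B \<le> ennreal e"
    then have "measure \<mu> B \<le> e" using assms(3) by (simp add: emeasure_eq_measure)
    then show ?thesis using measure_nonneg[of \<mu> C] by linarith
  qed
  then show ?thesis using that C by blast
qed

text \<open>Inner regularity, applied to the complement of a compact \<open>C\<close>, approximates
  \<open>C\<close> from outside by complements of compact sets \<open>D\<close>. An Urysohn function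
  that is 1 on \<open>C\<close> and 0 on \<open>D\<close> then compares the two measures.\<close>

lemma radon_prob_eqI:
  fixes K :: "'a::t2_space set"
  assumes K: "compact K" and \<mu>: "radon_prob K \<mu>" and \<nu>: "radon_prob K \<nu>"
    and eq: "\<And>f :: 'a \<Rightarrow> real. continuous_on K f \<Longrightarrow> (\<integral>x. f x \<partial>\<mu>) = (\<integral>x. f x \<partial>\<nu>)"
  shows "\<mu> = \<nu>"
proof -
  have le: "emeasure \<mu> C \<le> emeasure \<nu> C"
    if \<mu>: "radon_prob K \<mu>" and \<nu>: "radon_prob K \<nu>" and C: "compact C" "C \<subseteq> K"
      and eq: "\<And>f :: 'a \<Rightarrow> real. continuous_on K f \<Longrightarrow> (\<integral>x. f x \<partial>\<mu>) = (\<integral>x. f x \<partial>\<nu>)" for \<mu> \<nu> C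
  proof -
    interpret M: prob_space \<mu> by (rule radon_prob_space[OF \<mu>])
    interpret N: prob_space \<nu> by (rule radon_prob_space[OF \<nu>])
    have clC: "closedin (top_of_set K) C" by (rule compact_closedin[OF C])
    have CM: "C \<in> sets \<mu>" "C \<in> sets \<nu>"
      using closedin_measurable[OF clC] radon_sets[OF \<mu>] radon_sets[OF \<nu>] by auto
    have sp: "space \<mu> = K" "space \<nu> = K" using radon_space[OF \<mu>] radon_space[OF \<nu>] by auto
    have "measure \<mu> C \<le> measure \<nu> C + e" if e: "e > 0" for e
    proof -
      have KC: "K - C \<in> sets \<nu>" using CM(2) sp(2) by (metis sets.compl_sets)
      obtain D where D: "compact D" "D \<subseteq> K - C" "measure \<nu> (K - C) \<le> measure \<nu> D + e"
        using radon_measure_inner[OF \<nu> KC e] by blast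
      have clD: "closedin (top_of_set K) D" using D by (intro compact_closedin) auto
      have DM: "D \<in> sets \<nu>" using closedin_measurable[OF clD] radon_sets[OF \<nu>] by auto
      have KD: "K - D \<in> sets \<nu>" using DM sp(2) by (metis sets.compl_sets)
      obtain w where w: "continuous_on K w" "\<And>x. x \<in> K \<Longrightarrow> 0 \<le> w x \<and> w x \<le> 1"
          "\<And>x. x \<in> D \<Longrightarrow> w x = (0::real)" "\<And>x. x \<in> C \<Longrightarrow> w x = 1"
        using urysohn_compact[OF K clD clC] D(2) by blast
      have "measure \<mu> C = (\<integral>x. indicator C x \<partial>\<mu>)" using CM by simp
      also have "\<dots> \<le> (\<integral>x. w x \<partial>\<mu>)"
        by (intro integral_mono radon_integrable[OF K \<mu> w(1)] integrable_real_indicator CM)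
          (use w sp in \<open>auto simp: indicator_def M.emeasure_eq_measure\<close>)
      also have "\<dots> = (\<integral>x. w x \<partial>\<nu>)" by (rule eq[OF w(1)])
      also have "\<dots> \<le> (\<integral>x. indicator (K - D) x \<partial>\<nu>)"
        by (intro integral_mono radon_integrable[OF K \<nu> w(1)] integrable_real_indicator KD)
          (use w sp in \<open>auto simp: indicator_def N.emeasure_eq_measure\<close>)
      also have "\<dots> = measure \<nu> (K - D)" using KD by simp
      also have "\<dots> = 1 - measure \<nu> D" using N.prob_compl[OF DM] sp by simp
      also have "\<dots> \<le> 1 - measure \<nu> (K - C) + e" using D(3) by simp
      also have "\<dots> = measure \<nu> C + e" using N.prob_compl[OF CM(2)] sp by simp
      finally show ?thesis .
    qed
    then have "measure \<mu> C \<le> measure \<nu> C" by (rule field_le_epsilon)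
    then show ?thesis by (simp add: M.emeasure_eq_measure N.emeasure_eq_measure)
  qed
  have sets_eq: "sets \<mu> = sets \<nu>" using radon_sets[OF \<mu>] radon_sets[OF \<nu>] by simp
  show ?thesis
  proof (rule measure_eqI[OF sets_eq])
    fix B assume B: "B \<in> sets \<mu>"
    have BK: "B \<subseteq> K" using sets.sets_into_space[OF B] radon_space[OF \<mu>] by simp
    have "emeasure \<mu> C = emeasure \<nu> C" if "compact C" "C \<subseteq> B" for C
    proof (rule antisym)
      have CK: "C \<subseteq> K" using that BK by blast
      show "emeasure \<mu> C \<le> emeasure \<nu> C" by (rule le[OF \<mu> \<nu> that(1) CK eq])
      show "emeasure \<nu> C \<le> emeasure \<mu> C" by (rule le[OF \<nu> \<mu> that(1) CK eq[symmetric]])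
    qed
    then have "(SUP C\<in>{C. compact C \<and> C \<subseteq> B}. emeasure \<mu> C) = (SUP C\<in>{C. compact C \<and> C \<subseteq> B}. emeasure \<nu> C)"
      by (intro SUP_cong) auto
    then show "emeasure \<mu> B = emeasure \<nu> B"
      using \<mu> \<nu> B sets_eq unfolding radon_prob_def by metis
  qed
qed

locale riesz =
  fixes K :: "'a::t2_space set" and \<Lambda> :: "('a \<Rightarrow> real) \<Rightarrow> real"
  assumes compact_K: "compact K" and state: "state_on K \<Lambda>"
begin

text \<open>Test functions merely vanish off \<open>U\<close> instead of having compact support in
  \<open>U\<close>; truncating them at a small height moves what remains into a closed subset of
  \<open>U\<close>.\<close>

definition minorants :: "'a set \<Rightarrow> ('a \<Rightarrow> real) set" where
  "minorants U = {f. continuous_on K f \<and> (\<forall>x\<in>K. 0 \<le> f x \<and> f x \<le> 1) \<and> (\<forall>x\<in>K - U. f x = 0)}"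

definition content :: "'a set \<Rightarrow> ennreal" where
  "content U = (SUP f\<in>minorants U. ennreal (\<Lambda> f))"

definition outer :: "'a set \<Rightarrow> ennreal" where
  "outer S = (INF U\<in>{U. openin (top_of_set K) U \<and> S \<subseteq> U}. content U)"

lemma minorants_zero: "(\<lambda>_. 0) \<in> minorants U"
  by (auto simp: minorants_def)

lemma minorants_ne: "minorants U \<noteq> {}"
  using minorants_zero by blast

lemma minorants_nonneg: "f \<in> minorants U \<Longrightarrow> 0 \<le> \<Lambda> f"
  using state by (auto simp: minorants_def state_on_def)

lemma le_content: "f \<in> minorants U \<Longrightarrow> ennreal (\<Lambda> f) \<le> content U"
  unfolding content_def by (rule SUP_upper)

lemma content_mono: "U \<subseteq> V \<Longrightarrow> content U \<le> content V"
  unfolding content_def by (rule SUP_subset_mono) (auto simp: minorants_def)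

lemma content_empty: "content {} = 0"
proof -
  have "\<Lambda> f = 0" if "f \<in> minorants {}" for f
    using state_on_cong[OF state, of f "\<lambda>_. 0"] state_on_const[OF state, of 0] that by (auto simp: minorants_def)
  then have "content {} \<le> 0" unfolding content_def by (intro SUP_least) auto
  then show ?thesis by simp
qed

lemma content_K: "content K = 1"
proof (rule antisym)
  show "content K \<le> 1"
    unfolding content_def
  proof (rule SUP_least)
    fix f assume "f \<in> minorants K"
    then have "\<Lambda> f \<le> \<Lambda> (\<lambda>_. 1)" by (intro state_on_mono[OF state]) (auto simp: minorants_def)
    then show "ennreal (\<Lambda> f) \<le> 1" using state_on_const[OF state, of 1] by simp
  qed
  have "(\<lambda>_. 1) \<in> minorants K" by (auto simp: minorants_def)
  from le_content[OF this] show "1 \<le> content K" using state_on_const[OF state, of 1] by simp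
qed

text \<open>The part cut off is at most \<open>e\<close> pointwise, so it costs a state at most
  \<open>e\<close>. The rest vanishes off the closed set where \<open>f\<close> is at least
  \<open>e\<close>, to which compactness and Urysohn functions apply.\<close>

lemma cut_minorant:
  assumes "f \<in> minorants U" "e > 0"
  shows "continuous_on K (\<lambda>x. max (f x - e) 0)" "\<And>x. x \<in> K \<Longrightarrow> 0 \<le> max (f x - e) 0 \<and> max (f x - e) 0 \<le> 1"
    "\<Lambda> f \<le> \<Lambda> (\<lambda>x. max (f x - e) 0) + e"
proof -
  have f: "continuous_on K f" using assms by (simp add: minorants_def)
  show c: "continuous_on K (\<lambda>x. max (f x - e) 0)" by (intro continuous_intros f)
  show "0 \<le> max (f x - e) 0 \<and> max (f x - e) 0 \<le> 1" if "x \<in> K" for x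
    using assms that by (auto simp: minorants_def max_def)
  have "\<Lambda> f \<le> \<Lambda> (\<lambda>x. max (f x - e) 0 + e)"
    by (intro state_on_mono[OF state f] continuous_intros f) auto
  then show "\<Lambda> f \<le> \<Lambda> (\<lambda>x. max (f x - e) 0) + e"
    using state_on_add[OF state c, of "\<lambda>_. e"] state_on_const[OF state, of e] by simp
qed

lemma superlevel_closedin:
  assumes "continuous_on K f" shows "closedin (top_of_set K) {x \<in> K. e \<le> (f x :: real)}"
  using continuous_closedin_preimage[OF assms, of "{e..}"] by (simp add: vimage_def Int_def)

lemma sublevel_openin:
  assumes "continuous_on K f" shows "openin (top_of_set K) {x \<in> K. f x < (e :: real)}"
  using continuous_openin_preimage_gen[OF assms, of "{..<e}"] by (simp add: vimage_def Int_def)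

lemma superlevel_openin:
  assumes "continuous_on K f" shows "openin (top_of_set K) {x \<in> K. (e :: real) < f x}"
  using continuous_openin_preimage_gen[OF assms, of "{e<..}"] by (simp add: vimage_def Int_def)

text \<open>The parts of \<open>{e \<le> f}\<close> outside \<open>U\<close> and outside
  \<open>V\<close> are disjoint closed sets. A function that is 0 on the first and 1 on the second
  splits the truncated \<open>f\<close> into a test function of \<open>U\<close> and one of
  \<open>V\<close>.\<close>

lemma content_Un:
  assumes "openin (top_of_set K) U" "openin (top_of_set K) V"
  shows "content (U \<union> V) \<le> content U + content V"
  unfolding content_def[of "U \<union> V"]
proof (rule SUP_least, rule ennreal_le_epsilon)
  fix f e assume f: "f \<in> minorants (U \<union> V)" and e: "(0::real) < e"
  let ?f = "\<lambda>x. max (f x - e) 0"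
  note cut = cut_minorant[OF f e]
  have fc: "continuous_on K f" using f by (simp add: minorants_def)
  let ?L = "{x \<in> K. e \<le> f x}"
  have cl: "closedin (top_of_set K) (?L - U)" "closedin (top_of_set K) (?L - V)"
    using superlevel_closedin[OF fc, of e] assms by (auto intro: closedin_diff)
  have disj: "(?L - U) \<inter> (?L - V) = {}"
    using f e by (auto simp: minorants_def)
  obtain w where w: "continuous_on K w" "\<And>x. x \<in> K \<Longrightarrow> 0 \<le> w x \<and> w x \<le> 1"
      "\<And>x. x \<in> ?L - U \<Longrightarrow> w x = (0::real)" "\<And>x. x \<in> ?L - V \<Longrightarrow> w x = 1"
    using urysohn_compact[OF compact_K cl disj] by blast
  have b: "0 \<le> a * b \<and> a * b \<le> 1" if "0 \<le> a \<and> a \<le> 1" "0 \<le> b \<and> b \<le> 1" for a b :: real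
    using that by (auto intro: mult_le_one)
  have g: "(\<lambda>x. w x * ?f x) \<in> minorants U"
    unfolding minorants_def
  proof (intro CollectI conjI ballI)
    show "continuous_on K (\<lambda>x. w x * ?f x)" by (intro continuous_intros w fc)
    show "0 \<le> w x * ?f x" "w x * ?f x \<le> 1" if "x \<in> K" for x
      using b[OF w(2)[OF that] cut(2)[OF that]] by auto
    show "w x * ?f x = 0" if "x \<in> K - U" for x
      using w(3)[of x] that by (cases "e \<le> f x") auto
  qed
  have h: "(\<lambda>x. (1 - w x) * ?f x) \<in> minorants V"
    unfolding minorants_def
  proof (intro CollectI conjI ballI)
    show "continuous_on K (\<lambda>x. (1 - w x) * ?f x)" by (intro continuous_intros w fc)
    show "0 \<le> (1 - w x) * ?f x" "(1 - w x) * ?f x \<le> 1" if "x \<in> K" for x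
      using b[OF _ cut(2)[OF that], of "1 - w x"] w(2)[OF that] by auto
    show "(1 - w x) * ?f x = 0" if "x \<in> K - V" for x
      using w(4)[of x] that by (cases "e \<le> f x") auto
  qed
  have "\<Lambda> f \<le> \<Lambda> (\<lambda>x. w x * ?f x + (1 - w x) * ?f x) + e"
    using cut(3) by (simp add: algebra_simps)
  also have "\<Lambda> (\<lambda>x. w x * ?f x + (1 - w x) * ?f x) = \<Lambda> (\<lambda>x. w x * ?f x) + \<Lambda> (\<lambda>x. (1 - w x) * ?f x)"
    using g h by (intro state_on_add[OF state]) (auto simp: minorants_def)
  finally have "ennreal (\<Lambda> f) \<le> ennreal (\<Lambda> (\<lambda>x. w x * ?f x) + \<Lambda> (\<lambda>x. (1 - w x) * ?f x) + e)"
    by (rule ennreal_leI)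
  also have "\<dots> = ennreal (\<Lambda> (\<lambda>x. w x * ?f x)) + ennreal (\<Lambda> (\<lambda>x. (1 - w x) * ?f x)) + ennreal e"
    using minorants_nonneg[OF g] minorants_nonneg[OF h] e by (simp add: ennreal_plus)
  also have "\<dots> \<le> content U + content V + ennreal e"
    by (intro add_mono le_content g h order_refl)
  finally show "ennreal (\<Lambda> f) \<le> content U + content V + ennreal e" .
qed

lemma content_UN_finite:
  assumes "\<And>n::nat. openin (top_of_set K) (U n)"
  shows "content (\<Union>n<N. U n) \<le> (\<Sum>n<N. content (U n))"
proof (induction N)
  case 0 then show ?case by (simp add: content_empty)
next
  case (Suc N)
  have "(\<Union>n<Suc N. U n) = (\<Union>n<N. U n) \<union> U N" by (auto simp: less_Suc_eq)
  moreover have "openin (top_of_set K) (\<Union>n<N. U n)" using assms by blast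
  ultimately have "content (\<Union>n<Suc N. U n) \<le> content (\<Union>n<N. U n) + content (U N)"
    using content_Un assms by simp
  also have "\<dots> \<le> (\<Sum>n<N. content (U n)) + content (U N)" by (intro add_mono Suc order_refl)
  finally show ?case by simp
qed

text \<open>Since \<open>{e \<le> f}\<close> is compact, the truncated function is already a test
  function of a finite subunion.\<close>

lemma content_UN:
  assumes "\<And>n::nat. openin (top_of_set K) (U n)"
  shows "content (\<Union>n. U n) \<le> (\<Sum>n. content (U n))"
  unfolding content_def[of "\<Union>n. U n"]
proof (rule SUP_least, rule ennreal_le_epsilon)
  fix f e assume f: "f \<in> minorants (\<Union>n. U n)" and e: "(0::real) < e"
  let ?f = "\<lambda>x. max (f x - e) 0"
  note cut = cut_minorant[OF f e]
  have fc: "continuous_on K f" using f by (simp add: minorants_def)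
  let ?L = "{x \<in> K. e \<le> f x}"
  obtain V where V: "\<And>n. open (V n)" "\<And>n. U n = K \<inter> V n"
    using assms unfolding openin_open by metis
  have "compact ?L" by (rule closedin_compact[OF compact_K superlevel_closedin[OF fc]])
  moreover have "?L \<subseteq> (\<Union>n\<in>UNIV. V n)" using f e V(2) by (force simp: minorants_def)
  ultimately obtain T where T: "finite T" "?L \<subseteq> (\<Union>n\<in>T. V n)"
    using V(1) compactE_image[of ?L UNIV V] by (metis (no_types, lifting))
  obtain N where N: "T \<subseteq> {..<N}" using T(1) finite_nat_iff_bounded by blast
  have "?f \<in> minorants (\<Union>n<N. U n)"
    unfolding minorants_def
  proof (intro CollectI conjI ballI)
    show "?f x = 0" if "x \<in> K - (\<Union>n<N. U n)" for x
    proof -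
      have "x \<notin> ?L" using that T N V(2) by blast
      then show ?thesis using that by auto
    qed
  qed (use cut in auto)
  from le_content[OF this] minorants_nonneg[OF this]
  have "ennreal (\<Lambda> ?f) \<le> content (\<Union>n<N. U n)" "0 \<le> \<Lambda> ?f" by auto
  have "ennreal (\<Lambda> f) \<le> ennreal (\<Lambda> ?f + e)" by (rule ennreal_leI[OF cut(3)])
  also have "\<dots> = ennreal (\<Lambda> ?f) + ennreal e" using \<open>0 \<le> \<Lambda> ?f\<close> e by (simp add: ennreal_plus)
  also have "\<dots> \<le> (\<Sum>n<N. content (U n)) + ennreal e"
    using \<open>ennreal (\<Lambda> ?f) \<le> content (\<Union>n<N. U n)\<close> content_UN_finite[OF assms]
    by (intro add_mono order_refl) (rule order_trans)
  also have "\<dots> \<le> (\<Sum>n. content (U n)) + ennreal e"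
    by (intro add_mono order_refl sum_le_suminf summableI) auto
  finally show "ennreal (\<Lambda> f) \<le> (\<Sum>n. content (U n)) + ennreal e" .
qed

lemma outer_le: "openin (top_of_set K) U \<Longrightarrow> S \<subseteq> U \<Longrightarrow> outer S \<le> content U"
  unfolding outer_def by (rule INF_lower) auto

lemma outer_open: "openin (top_of_set K) U \<Longrightarrow> outer U = content U"
  by (intro antisym outer_le order_refl) (auto simp: outer_def intro!: INF_greatest content_mono)

lemma outer_mono: "S \<subseteq> T \<Longrightarrow> outer S \<le> outer T"
  unfolding outer_def by (rule INF_superset_mono) auto

lemma outer_approx:
  assumes "S \<subseteq> K" "e > 0"
  obtains U where "openin (top_of_set K) U" "S \<subseteq> U" "content U \<le> outer S + ennreal e"
proof -
  have "outer S \<le> 1" using outer_le[of K S] assms(1) content_K by simp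
  then have "outer S < outer S + ennreal e"
    using assms(2) by (cases "outer S" rule: ennreal_cases) (auto simp: ennreal_less_iff top_unique simp flip: ennreal_plus)
  then have "(INF U\<in>{U. openin (top_of_set K) U \<and> S \<subseteq> U}. content U) < outer S + ennreal e"
    by (simp add: outer_def)
  then obtain U where "openin (top_of_set K) U" "S \<subseteq> U" "content U < outer S + ennreal e"
    unfolding INF_less_iff by blast
  then show ?thesis using that by auto
qed

lemma outer_measure: "outer_measure_space (Pow K) outer"
  unfolding outer_measure_space_def
proof (intro conjI)
  show "positive (Pow K) outer"
    using outer_open[of "{}"] by (simp add: positive_def content_empty)
  show "increasing (Pow K) outer" by (simp add: increasing_def outer_mono)
  show "countably_subadditive (Pow K) outer"
    unfolding countably_subadditive_def
  proof (intro allI impI)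
    fix S :: "nat \<Rightarrow> 'a set" assume S: "range S \<subseteq> Pow K"
    show "outer (\<Union>i. S i) \<le> (\<Sum>i. outer (S i))"
    proof (rule ennreal_le_epsilon)
      fix e :: real assume e: "0 < e"
      have "\<exists>U. openin (top_of_set K) U \<and> S n \<subseteq> U \<and> content U \<le> outer (S n) + ennreal (e * (1/2)^Suc n)" for n
      proof -
        have "S n \<subseteq> K" "0 < e * (1/2)^Suc n" using S e by auto
        then obtain U where "openin (top_of_set K) U" "S n \<subseteq> U" "content U \<le> outer (S n) + ennreal (e * (1/2)^Suc n)"
          by (rule outer_approx)
        then show ?thesis by blast
      qed
      then obtain U where U: "\<And>n. openin (top_of_set K) (U n)" "\<And>n. S n \<subseteq> U n"
          "\<And>n. content (U n) \<le> outer (S n) + ennreal (e * (1/2)^Suc n)" by metis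
      have "outer (\<Union>i. S i) \<le> content (\<Union>i. U i)"
        using U by (intro outer_le) auto
      also have "\<dots> \<le> (\<Sum>i. content (U i))" by (rule content_UN[OF U(1)])
      also have "\<dots> \<le> (\<Sum>i. outer (S i) + ennreal (e * (1/2)^Suc i))"
        by (intro suminf_le U(3) summableI)
      also have "\<dots> = (\<Sum>i. outer (S i)) + (\<Sum>i. ennreal (e * (1/2)^Suc i))"
        by (intro suminf_add[symmetric] summableI)
      also have "(\<Sum>i. ennreal (e * (1/2)^Suc i)) = ennreal (e * 1)"
        using e by (intro suminf_ennreal_eq sums_mult power_half_series) auto
      finally show "outer (\<Union>i. S i) \<le> (\<Sum>i. outer (S i)) + ennreal e" by simp
    qed
  qed
qed

text \<open>For a test function \<open>f\<close> of \<open>V \<inter> U\<close>, the part of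
  \<open>V\<close> where \<open>f < d\<close> is open and contains \<open>V - U\<close>. Its test
  functions can be added to \<open>f\<close> almost without exceeding 1, which gives Caratheodory's
  inequality for an open cutting set.\<close>

lemma content_split:
  assumes U: "openin (top_of_set K) U" and V: "openin (top_of_set K) V"
  shows "content (V \<inter> U) + outer (V - U) \<le> content V"
proof -
  have *: "ennreal (\<Lambda> f) + outer (V - U) \<le> content V" if f: "f \<in> minorants (V \<inter> U)" for f
  proof (rule ennreal_le_epsilon)
    fix d :: real assume d: "0 < d"
    have fc: "continuous_on K f" using f by (simp add: minorants_def)
    let ?W = "V \<inter> {x \<in> K. f x < d}"
    have W: "openin (top_of_set K) ?W" using V sublevel_openin[OF fc] by (rule openin_Int)
    have "V \<subseteq> K" using V by (rule openin_imp_subset)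
    then have "V - U \<subseteq> ?W" using f d by (auto simp: minorants_def)
    then have "outer (V - U) \<le> content ?W" by (rule outer_le[OF W])
    have "ennreal (\<Lambda> f) + ennreal (\<Lambda> g) \<le> content V + ennreal d" if g: "g \<in> minorants ?W" for g
    proof -
      \<comment> \<open>On \<open>?W\<close> one has \<open>f < d\<close>, and off \<open>?W\<close>
        the function \<open>g\<close> vanishes; so \<open>f + g \<le> 1 + d\<close>, and this
        multiple is a test function of \<open>V\<close>.\<close>
      define q where "q = (\<lambda>x. (1 / (1 + d)) * (f x + g x))"
      have gc: "continuous_on K g" using g by (simp add: minorants_def)
      have qV: "q \<in> minorants V"
        unfolding minorants_def
      proof (intro CollectI conjI ballI)
        show "continuous_on K q" unfolding q_def by (intro continuous_intros fc gc)
        fix x assume x: "x \<in> K"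
        have "0 \<le> f x" "f x \<le> 1" "0 \<le> g x" "g x \<le> 1" using f g x by (auto simp: minorants_def)
        moreover have "g x = 0" if "d \<le> f x" using g x that by (auto simp: minorants_def)
        ultimately have "0 \<le> f x + g x" "f x + g x \<le> 1 + d" using d by (auto simp: not_le[symmetric]) (smt (verit))
        then show "0 \<le> q x" "q x \<le> 1" using d by (auto simp: q_def)
      next
        fix x assume "x \<in> K - V"
        then show "q x = 0" using f g by (auto simp: minorants_def q_def)
      qed
      have "q x \<le> 1" if "x \<in> K" for x using qV that by (auto simp: minorants_def)
      then have "\<Lambda> q \<le> 1"
        using state_on_mono[OF state, of q "\<lambda>_. 1"] qV state_on_const[OF state, of 1] by (auto simp: minorants_def)
      have "\<Lambda> q = (1 / (1 + d)) * (\<Lambda> f + \<Lambda> g)"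
        unfolding q_def using state_on_scale[OF state, of "\<lambda>x. f x + g x" "1 / (1 + d)"] state_on_add[OF state fc gc]
        fc gc by (simp add: continuous_on_add)
      then have "\<Lambda> f + \<Lambda> g = \<Lambda> q + d * \<Lambda> q" using d by (simp add: field_simps)
      also have "\<dots> \<le> \<Lambda> q + d" using \<open>\<Lambda> q \<le> 1\<close> d by (simp add: mult_left_le)
      finally have "ennreal (\<Lambda> f + \<Lambda> g) \<le> ennreal (\<Lambda> q + d)" by (rule ennreal_leI)
      then have "ennreal (\<Lambda> f) + ennreal (\<Lambda> g) \<le> ennreal (\<Lambda> q) + ennreal d"
        using minorants_nonneg[OF f] minorants_nonneg[OF g] minorants_nonneg[OF qV] d by (simp add: ennreal_plus)
      also have "\<dots> \<le> content V + ennreal d" by (intro add_mono le_content qV order_refl)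
      finally show ?thesis .
    qed
    then have "ennreal (\<Lambda> f) + content ?W \<le> content V + ennreal d"
      unfolding content_def[of ?W] ennreal_SUP_add_right[OF minorants_ne] by (intro SUP_least)
    then show "ennreal (\<Lambda> f) + outer (V - U) \<le> content V + ennreal d"
      using \<open>outer (V - U) \<le> content ?W\<close> by (meson add_left_mono order_trans)
  qed
  then show ?thesis
    unfolding content_def[of "V \<inter> U"] ennreal_SUP_add_left[OF minorants_ne, symmetric] by (intro SUP_least)
qed

lemma open_measurable:
  assumes U: "openin (top_of_set K) U" shows "U \<in> lambda_system K (Pow K) outer"
proof -
  interpret sigma_algebra K "Pow K" by (rule sigma_algebra_Pow)
  have sub: "subadditive (Pow K) outer"
    using outer_measure by (intro countably_subadditive_subadditive) (auto simp: outer_measure_space_def)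
  have "outer (S \<inter> U) + outer (S - U) = outer S" if S: "S \<in> Pow K" for S
  proof (rule antisym)
    show "outer (S \<inter> U) + outer (S - U) \<le> outer S"
      unfolding outer_def[of S]
    proof (rule INF_greatest)
      fix V assume V: "V \<in> {U. openin (top_of_set K) U \<and> S \<subseteq> U}"
      have "outer (S \<inter> U) \<le> content (V \<inter> U)" using V U by (intro outer_le openin_Int) auto
      moreover have "outer (S - U) \<le> outer (V - U)" using V by (intro outer_mono) auto
      ultimately show "outer (S \<inter> U) + outer (S - U) \<le> content V"
        using order_trans[OF add_mono content_split[OF U]] V by blast
    qed
    have "outer ((S \<inter> U) \<union> (S - U)) \<le> outer (S \<inter> U) + outer (S - U)"
      by (rule subadditiveD[OF sub]) (use S in auto)
    then show "outer S \<le> outer (S \<inter> U) + outer (S - U)" by (simp add: Int_Diff_Un)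
  qed
  moreover have "U \<in> Pow K" using openin_imp_subset[OF U] by simp
  ultimately show ?thesis unfolding lambda_system_eq by blast
qed

lemma borel_measurable_outer: "sets (restrict_space borel K) \<subseteq> lambda_system K (Pow K) outer"
proof
  interpret P: sigma_algebra K "Pow K" by (rule sigma_algebra_Pow)
  have "measure_space K (lambda_system K (Pow K) outer) outer" by (rule P.caratheodory_lemma[OF outer_measure])
  then interpret L: sigma_algebra K "lambda_system K (Pow K) outer" by (simp add: measure_space_def)
  have "K \<inter> S \<in> lambda_system K (Pow K) outer" if "S \<in> sigma_sets UNIV {S. open S}" for S
    using that
  proof induction
    case (Basic S)
    then show ?case by (intro open_measurable) (auto simp: openin_open)
  next
    case (Compl S)
    have "K \<inter> (UNIV - S) = K - (K \<inter> S)" by auto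
    then show ?case using L.compl_sets[OF Compl.IH] by simp
  next
    case (Union S)
    have "K \<inter> (\<Union>i. S i) = (\<Union>i. K \<inter> S i)" by auto
    moreover have "(\<Union>i. K \<inter> S i) \<in> lambda_system K (Pow K) outer"
      by (intro L.countable_UN) (use Union.IH in auto)
    ultimately show ?case by simp
  qed auto
  moreover fix B assume "B \<in> sets (restrict_space borel K)"
  then obtain S where "S \<in> sets borel" "B = K \<inter> S" by (auto simp: sets_restrict_space)
  moreover have "sets (borel :: 'a measure) = sigma_sets UNIV {S. open S}" by (simp add: borel_def)
  ultimately show "B \<in> lambda_system K (Pow K) outer" by simp
qed

definition M where "M = measure_of K (sets (restrict_space borel K)) outer"

lemma sets_M: "sets M = sets (restrict_space borel K)"
  and space_M: "space M = K"
  and emeasure_M: "B \<in> sets (restrict_space borel K) \<Longrightarrow> emeasure M B = outer B"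
proof -
  have sp: "space (restrict_space borel K) = K" by (simp add: space_restrict_space)
  have sa: "sigma_algebra K (sets (restrict_space borel K))"
    using sets.sigma_algebra_axioms[of "restrict_space borel K"] unfolding sp .
  then interpret sigma_algebra K "sets (restrict_space borel K)" .
  show "sets M = sets (restrict_space borel K)" "space M = K" by (simp_all add: M_def)
  have ms: "measure_space K (lambda_system K (Pow K) outer) outer"
    by (rule sigma_algebra.caratheodory_lemma[OF sigma_algebra_Pow outer_measure])
  have "positive (sets (restrict_space borel K)) outer"
    using ms by (simp add: measure_space_def positive_def)
  moreover have "countably_additive (sets (restrict_space borel K)) outer"
    using ms borel_measurable_outer unfolding measure_space_def countably_additive_def by blast
  ultimately show "B \<in> sets (restrict_space borel K) \<Longrightarrow> emeasure M B = outer B"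
    unfolding M_def by (rule emeasure_measure_of_sigma[OF sa])
qed

lemma emeasure_M_open: "openin (top_of_set K) U \<Longrightarrow> emeasure M U = content U"
  using emeasure_M[OF openin_measurable] outer_open by simp

lemma prob_M: "prob_space M"
  by (rule prob_spaceI) (use emeasure_M_open[of K] content_K space_M in simp)

lemma radon_M: "radon_prob K M"
  unfolding radon_prob_def
proof (intro conjI ballI)
  interpret prob_space M by (rule prob_M)
  show "sets M = sets (restrict_space borel K)" by (rule sets_M)
  show "prob_space M" by (rule prob_M)
  fix B assume B: "B \<in> sets M"
  have BK: "B \<subseteq> K" using sets.sets_into_space[OF B] space_M by simp
  show "emeasure M B = (SUP C\<in>{C. compact C \<and> C \<subseteq> B}. emeasure M C)"
  proof (rule antisym)
    show "(SUP C\<in>{C. compact C \<and> C \<subseteq> B}. emeasure M C) \<le> emeasure M B"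
      by (rule SUP_least) (use B in \<open>auto intro: emeasure_mono\<close>)
    show "emeasure M B \<le> (SUP C\<in>{C. compact C \<and> C \<subseteq> B}. emeasure M C)"
    proof (rule ennreal_le_epsilon)
      fix e :: real assume e: "0 < e"
      have KB: "K - B \<in> sets M" using B space_M by (metis sets.compl_sets)
      \<comment> \<open>Inner regularity at \<open>B\<close> is outer regularity at its complement;
        the approximating compact set is \<open>K - U\<close>.\<close>
      obtain U where U: "openin (top_of_set K) U" "K - B \<subseteq> U" "content U \<le> outer (K - B) + ennreal e"
        using outer_approx[of "K - B" e] e by blast
      have UM: "U \<in> sets M" using openin_measurable[OF U(1)] sets_M by simp
      have UK: "U \<subseteq> K" by (rule openin_imp_subset[OF U(1)])
      have "emeasure M U \<le> emeasure M (K - B) + ennreal e"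
        using U(3) emeasure_M_open[OF U(1)] emeasure_M[of "K - B"] KB sets_M by simp
      then have "measure M U \<le> measure M (K - B) + e"
        using e by (simp add: emeasure_eq_measure flip: ennreal_plus)
      moreover have "measure M (K - B) = 1 - measure M B" "measure M (K - U) = 1 - measure M U"
        using prob_compl[OF B] prob_compl[OF UM] space_M by auto
      ultimately have "ennreal (measure M B) \<le> ennreal (measure M (K - U) + e)" by (intro ennreal_leI) simp
      then have "emeasure M B \<le> emeasure M (K - U) + ennreal e"
        using e by (simp add: emeasure_eq_measure ennreal_plus)
      also have "emeasure M (K - U) \<le> (SUP C\<in>{C. compact C \<and> C \<subseteq> B}. emeasure M C)"
      proof (rule SUP_upper)
        have "closedin (top_of_set K) (K - U)" using U(1) by (simp add: closedin_diff)
        then show "K - U \<in> {C. compact C \<and> C \<subseteq> B}" using closedin_compact[OF compact_K] U(2) by auto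
      qed
      finally show "emeasure M B \<le> (SUP C\<in>{C. compact C \<and> C \<subseteq> B}. emeasure M C) + ennreal e"
        by (simp add: add_right_mono)
    qed
  qed
qed

text \<open>Layer cake: \<open>f\<close> is cut into \<open>N\<close> slices \<open>l k\<close> of
  height \<open>1 / N\<close>. Scaled by \<open>N\<close>, a slice is a test function of the level
  set \<open>{k / N < f}\<close>, and it is full on \<open>{Suc k / N < f}\<close>. The two
  resulting sums differ by an index shift, which telescopes to at most \<open>1 / N\<close>.\<close>

lemma integral_M_ge:
  assumes f: "continuous_on K f" and f01: "\<And>x. x \<in> K \<Longrightarrow> 0 \<le> f x \<and> f x \<le> 1"
  shows "\<Lambda> f \<le> (\<integral>x. f x \<partial>M)"
proof -
  interpret prob_space M by (rule prob_M)
  have "\<Lambda> f \<le> (\<integral>x. f x \<partial>M) + 1 / Suc n" for n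
  proof -
    define N :: nat where "N = Suc n"
    have N: "real N > 0" by (simp add: N_def)
    define g where "g k x = min (f x) (k / N) " for k :: nat and x
    define l where "l k x = g (Suc k) x - g k x" for k :: nat and x
    define m where "m k = measure M {x \<in> K. k / N < f x}" for k :: nat
    have gc: "continuous_on K (g k)" for k unfolding g_def by (intro continuous_intros f)
    then have lc: "continuous_on K (l k)" for k unfolding l_def by (intro continuous_intros)
    have gle: "g k x \<le> g (Suc k) x" "g (Suc k) x \<le> g k x + 1 / N" for k x
      using N by (auto simp: g_def min_def field_simps)
    have f_eq: "f x = (\<Sum>k<N. 1 * l k x)" if "x \<in> K" for x
    proof -
      have "(\<Sum>k<N. 1 * l k x) = g N x - g 0 x"
        unfolding l_def using sum_lessThan_telescope[of "\<lambda>k. g k x" N] by simp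
      then show ?thesis using f01[OF that] N by (simp add: g_def)
    qed
    have lo: "\<Lambda> (l k) \<le> m k / N" for k
    proof -
      have op: "openin (top_of_set K) {x \<in> K. k / N < f x}" by (rule superlevel_openin[OF f])
      have "(\<lambda>x. N * l k x) \<in> minorants {x \<in> K. k / N < f x}"
        unfolding minorants_def
      proof (intro CollectI conjI ballI)
        show "continuous_on K (\<lambda>x. N * l k x)" by (intro continuous_intros lc)
        show "0 \<le> N * l k x" "N * l k x \<le> 1" for x
          using gle[of k x] N by (auto simp: l_def field_simps)
        show "N * l k x = 0" if "x \<in> K - {x \<in> K. k / N < f x}" for x
          using that N by (auto simp: l_def g_def min_def field_simps)
      qed
      from le_content[OF this] have "ennreal (\<Lambda> (\<lambda>x. N * l k x)) \<le> ennreal (m k)"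
        using emeasure_M_open[OF op] by (simp add: m_def emeasure_eq_measure)
      then have "\<Lambda> (\<lambda>x. N * l k x) \<le> m k" by (simp add: m_def)
      then show ?thesis using state_on_scale[OF state lc, of N k] N by (simp add: field_simps)
    qed
    have up: "m (Suc k) / N \<le> (\<integral>x. l k x \<partial>M)" for k
    proof -
      have S: "{x \<in> K. Suc k / N < f x} \<in> sets M"
        using openin_measurable[OF superlevel_openin[OF f]] sets_M by simp
      have "m (Suc k) / N = (\<integral>x. (1 / N) * indicator {x \<in> K. Suc k / N < f x} x \<partial>M)"
        using S by (simp add: m_def)
      also have "\<dots> \<le> (\<integral>x. l k x \<partial>M)"
      proof (rule integral_mono)
        show "integrable M (\<lambda>x. (1 / N) * indicator {x \<in> K. Suc k / N < f x} x)"
          using S by (intro integrable_mult_right integrable_real_indicator) (auto simp: emeasure_eq_measure)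
        show "integrable M (l k)" by (rule radon_integrable[OF compact_K radon_M lc])
        show "(1 / N) * indicator {x \<in> K. Suc k / N < f x} x \<le> l k x" for x
        proof (cases "x \<in> K \<and> Suc k / N < f x")
          case True
          then have "l k x = Suc k / N - k / N"
            using N by (simp add: l_def g_def min_def field_simps)
          then show ?thesis using True N by (simp add: diff_divide_distrib[symmetric])
        next
          case False
          then show ?thesis using gle[of k x] by (auto simp: l_def)
        qed
      qed
      finally show ?thesis .
    qed
    have "\<Lambda> f = \<Lambda> (\<lambda>x. \<Sum>k<N. 1 * l k x)" by (rule state_on_cong[OF state f f_eq])
    also have "\<dots> = (\<Sum>k<N. 1 * \<Lambda> (l k))"
      using state lc unfolding state_on_def
      by (intro linear_functional_on_sum[OF _ function_space_continuous]) auto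
    also have "\<dots> \<le> (\<Sum>k<N. m k / N)" using lo by (simp add: sum_mono)
    also have "\<dots> = (\<Sum>k<N. m (Suc k) / N) + (m 0 - m N) / N"
    proof -
      have "(\<Sum>k<N. m k) = (\<Sum>k<N. m (Suc k)) + (m 0 - m N)"
        using sum_lessThan_telescope'[of m N] by (simp add: sum_subtractf)
      then show ?thesis by (simp add: sum_divide_distrib[symmetric] add_divide_distrib)
    qed
    also have "(m 0 - m N) / N \<le> 1 / N"
    proof -
      have "m 0 \<le> 1" "0 \<le> m N" by (simp_all add: m_def)
      then have "m 0 - m N \<le> 1" by linarith
      then show ?thesis using N by (intro divide_right_mono) auto
    qed
    also have "(\<Sum>k<N. m (Suc k) / N) \<le> (\<Sum>k<N. (\<integral>x. l k x \<partial>M))" by (intro sum_mono up)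
    also have "\<dots> = (\<integral>x. (\<Sum>k<N. 1 * l k x) \<partial>M)"
      using radon_integrable[OF compact_K radon_M lc] by simp
    also have "\<dots> = (\<integral>x. f x \<partial>M)"
      by (intro Bochner_Integration.integral_cong refl) (use f_eq space_M in auto)
    finally show ?thesis by (simp add: N_def)
  qed
  then show ?thesis
    by (intro LIMSEQ_le_const[OF tendsto_eq_rhs[OF tendsto_add[OF tendsto_const LIMSEQ_inverse_real_of_nat]]])
      (auto simp: inverse_eq_divide)
qed

text \<open>The one-sided estimate for \<open>f\<close> and for \<open>1 - f\<close> gives equality
  when the values lie in the unit interval; a general \<open>f\<close> is an affine image of such a
  function.\<close>

lemma integral_M:
  assumes f: "continuous_on K f" shows "(\<integral>x. f x \<partial>M) = \<Lambda> f"
proof -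
  interpret prob_space M by (rule prob_M)
  have *: "(\<integral>x. f x \<partial>M) = \<Lambda> f" if f: "continuous_on K f" and f01: "\<And>x. x \<in> K \<Longrightarrow> 0 \<le> f x \<and> f x \<le> 1" for f
  proof (rule antisym)
    show "\<Lambda> f \<le> (\<integral>x. f x \<partial>M)" by (rule integral_M_ge[OF f f01])
    have "\<Lambda> (\<lambda>x. 1 - f x) \<le> (\<integral>x. 1 - f x \<partial>M)"
      by (rule integral_M_ge) (use f f01 in \<open>auto intro!: continuous_intros\<close>)
    also have "\<dots> = 1 - (\<integral>x. f x \<partial>M)"
      using radon_integrable[OF compact_K radon_M f] by (simp add: prob_space)
    finally show "(\<integral>x. f x \<partial>M) \<le> \<Lambda> f"
      using state_on_diff[OF state _ f, of "\<lambda>_. 1"] state_on_const[OF state, of 1] by simp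
  qed
  obtain m where m: "\<And>y. y \<in> K \<Longrightarrow> \<bar>f y\<bar> \<le> m" "m > 0"
    using compact_imp_bounded[OF compact_continuous_image[OF f compact_K]]
    unfolding bounded_pos by auto
  define v where "v y = (f y + m) / (2 * m)" for y
  have v: "continuous_on K v" unfolding v_def using m by (intro continuous_intros f) auto
  have v01: "0 \<le> v y \<and> v y \<le> 1" if "y \<in> K" for y
    using m(1)[OF that] m(2) by (auto simp: v_def abs_le_iff)
  have fv: "f = (\<lambda>y. 2 * m * v y - m)" using m by (simp add: v_def)
  have "(\<integral>x. f x \<partial>M) = 2 * m * (\<integral>x. v x \<partial>M) - m"
    unfolding fv using radon_integrable[OF compact_K radon_M v] by (simp add: prob_space)
  also have "\<dots> = 2 * m * \<Lambda> v - m" using *[OF v v01] by simp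
  also have "\<dots> = \<Lambda> f"
    unfolding fv using state_on_diff[OF state, of "\<lambda>y. 2 * m * v y" "\<lambda>y. m"] state_on_scale[OF state v, of "2 * m"]
      state_on_const[OF state, of m] v by (simp add: continuous_intros)
  finally show ?thesis .
qed

end

theorem riesz_representation:
  fixes K :: "'a::t2_space set"
  assumes "compact K" "state_on K \<Lambda>"
  shows "\<exists>\<mu>. radon_prob K \<mu> \<and> (\<forall>f. continuous_on K f \<longrightarrow> (\<integral>x. f x \<partial>\<mu>) = \<Lambda> f)"
proof -
  interpret riesz K \<Lambda> by standard fact+
  show ?thesis using radon_M integral_M by blast
qed

subsection \<open>Measures on the extreme boundary\<close>

lemma convex_on_power2_nonneg:
  fixes \<phi> :: "'a::real_vector \<Rightarrow> real"
  assumes "convex_on K \<phi>" "\<And>x. x \<in> K \<Longrightarrow> 0 \<le> \<phi> x"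
  shows "convex_on K (\<lambda>x. (\<phi> x)\<^sup>2)"
proof (rule convex_onI)
  show "convex K" using assms(1) by (simp add: convex_on_def)
  fix t x y assume t: "0 < t" "t < (1::real)" and xy: "x \<in> K" "y \<in> K"
  have "(1 - t) *\<^sub>R x + t *\<^sub>R y \<in> K" using \<open>convex K\<close> t xy by (auto simp: convex_def)
  then have "(\<phi> ((1 - t) *\<^sub>R x + t *\<^sub>R y))\<^sup>2 \<le> ((1 - t) * \<phi> x + t * \<phi> y)\<^sup>2"
    using convex_onD[OF assms(1), of t x y] t xy assms(2) by (intro power_mono) auto
  also have "\<dots> = (1 - t) * (\<phi> x)\<^sup>2 + t * (\<phi> y)\<^sup>2 - (1 - t) * t * (\<phi> x - \<phi> y)\<^sup>2"
    by (simp add: power2_eq_square algebra_simps)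
  also have "\<dots> \<le> (1 - t) * (\<phi> x)\<^sup>2 + t * (\<phi> y)\<^sup>2" using t by simp
  finally show "(\<phi> ((1 - t) *\<^sub>R x + t *\<^sub>R y))\<^sup>2 \<le> (1 - t) * (\<phi> x)\<^sup>2 + t * (\<phi> y)\<^sup>2" .
qed

lemma convex_on_max_fun:
  fixes \<phi> \<psi> :: "'a::real_vector \<Rightarrow> real"
  assumes "convex_on K \<phi>" "convex_on K \<psi>"
  shows "convex_on K (\<lambda>x. max (\<phi> x) (\<psi> x))"
proof (rule convex_onI)
  show "convex K" using assms(1) by (simp add: convex_on_def)
  fix t x y assume t: "0 < t" "t < (1::real)" and xy: "x \<in> K" "y \<in> K"
  let ?M = "(1 - t) * max (\<phi> x) (\<psi> x) + t * max (\<phi> y) (\<psi> y)"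
  have "\<phi> ((1 - t) *\<^sub>R x + t *\<^sub>R y) \<le> (1 - t) * \<phi> x + t * \<phi> y"
    using convex_onD[OF assms(1), of t x y] t xy by simp
  also have "\<dots> \<le> ?M" using t by (intro add_mono mult_left_mono) auto
  finally have 1: "\<phi> ((1 - t) *\<^sub>R x + t *\<^sub>R y) \<le> ?M" .
  have "\<psi> ((1 - t) *\<^sub>R x + t *\<^sub>R y) \<le> (1 - t) * \<psi> x + t * \<psi> y"
    using convex_onD[OF assms(2), of t x y] t xy by simp
  also have "\<dots> \<le> ?M" using t by (intro add_mono mult_left_mono) auto
  finally show "max (\<phi> ((1 - t) *\<^sub>R x + t *\<^sub>R y)) (\<psi> ((1 - t) *\<^sub>R x + t *\<^sub>R y)) \<le> ?M" using 1 by simp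
qed

context compact_convex
begin

text \<open>Nonnegativity is imposed because squares of nonnegative convex functions are convex;
  this makes the differences a ring.\<close>

definition convex_cone :: "('a \<Rightarrow> real) set" where
  "convex_cone = {\<phi>. continuous_on K \<phi> \<and> convex_on K \<phi> \<and> (\<forall>x\<in>K. 0 \<le> \<phi> x)}"

lemma convex_cone_add: "\<phi> \<in> convex_cone \<Longrightarrow> \<psi> \<in> convex_cone \<Longrightarrow> (\<lambda>x. \<phi> x + \<psi> x) \<in> convex_cone"
  by (simp add: convex_cone_def continuous_on_add convex_on_add)

lemma convex_cone_square: "\<phi> \<in> convex_cone \<Longrightarrow> (\<lambda>x. (1/2) * (\<phi> x)\<^sup>2) \<in> convex_cone"
  unfolding convex_cone_def
proof (intro CollectI conjI)
  assume \<phi>: "\<phi> \<in> {\<phi>. continuous_on K \<phi> \<and> convex_on K \<phi> \<and> (\<forall>x\<in>K. 0 \<le> \<phi> x)}"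
  then show "continuous_on K (\<lambda>x. (1/2) * (\<phi> x)\<^sup>2)" by (intro continuous_intros) simp
  show "convex_on K (\<lambda>x. (1/2) * (\<phi> x)\<^sup>2)"
    using \<phi> by (intro convex_on_cmul[of "1/2"] convex_on_power2_nonneg) simp_all
qed simp

lemma convex_cone_const: "0 \<le> c \<Longrightarrow> (\<lambda>_. c) \<in> convex_cone"
  using convex_K by (simp add: convex_cone_def convex_on_const)

definition convex_differences :: "('a \<Rightarrow> real) set" where
  "convex_differences = {g. \<exists>\<phi>\<in>convex_cone. \<exists>\<psi>\<in>convex_cone. \<forall>x\<in>K. g x = \<phi> x - \<psi> x}"

lemma convex_differencesI:
  "\<phi> \<in> convex_cone \<Longrightarrow> \<psi> \<in> convex_cone \<Longrightarrow> (\<And>x. x \<in> K \<Longrightarrow> g x = \<phi> x - \<psi> x) \<Longrightarrow> g \<in> convex_differences"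
  unfolding convex_differences_def by blast

lemma function_ring_convex_differences: "function_ring_on convex_differences K"
proof
  show "compact K" by (rule compact_K)
  show "continuous_on K f" if "f \<in> convex_differences" for f
  proof -
    obtain \<phi> \<psi> where "\<phi> \<in> convex_cone" "\<psi> \<in> convex_cone" "\<And>x. x \<in> K \<Longrightarrow> f x = \<phi> x - \<psi> x"
      using \<open>f \<in> convex_differences\<close> by (auto simp: convex_differences_def)
    then show ?thesis
      by (subst continuous_on_cong[OF refl, of _ _ "\<lambda>x. \<phi> x - \<psi> x"]) (auto simp: convex_cone_def intro!: continuous_intros)
  qed
  show "(\<lambda>x. f x + g x) \<in> convex_differences" "(\<lambda>x. f x * g x) \<in> convex_differences"
    if fg: "f \<in> convex_differences" "g \<in> convex_differences" for f g
  proof -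
    obtain \<phi> \<psi> where f: "\<phi> \<in> convex_cone" "\<psi> \<in> convex_cone" "\<And>x. x \<in> K \<Longrightarrow> f x = \<phi> x - \<psi> x"
      using fg(1) by (auto simp: convex_differences_def)
    obtain \<phi>' \<psi>' where g: "\<phi>' \<in> convex_cone" "\<psi>' \<in> convex_cone" "\<And>x. x \<in> K \<Longrightarrow> g x = \<phi>' x - \<psi>' x"
      using fg(2) by (auto simp: convex_differences_def)
    show "(\<lambda>x. f x + g x) \<in> convex_differences"
      by (rule convex_differencesI[OF convex_cone_add[OF f(1) g(1)] convex_cone_add[OF f(2) g(2)]])
        (simp add: f(3) g(3))
    \<comment> \<open>Half squares of sums: in the alternating combination below the pure squares
      cancel, and the four mixed products that make up \<open>f x * g x\<close> remain.\<close>
    let ?s = "\<lambda>a b x. (1/2) * (a x + b x)\<^sup>2 :: real"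
    have s: "?s a b \<in> convex_cone" if "a \<in> convex_cone" "b \<in> convex_cone" for a b
      by (rule convex_cone_square[OF convex_cone_add[OF that]])
    show "(\<lambda>x. f x * g x) \<in> convex_differences"
    proof (rule convex_differencesI)
      show "(\<lambda>x. ?s \<phi> \<phi>' x + ?s \<psi> \<psi>' x) \<in> convex_cone" "(\<lambda>x. ?s \<phi> \<psi>' x + ?s \<psi> \<phi>' x) \<in> convex_cone"
        by (rule convex_cone_add[OF s[OF f(1) g(1)] s[OF f(2) g(2)]],
          rule convex_cone_add[OF s[OF f(1) g(2)] s[OF f(2) g(1)]])
      show "f x * g x = (?s \<phi> \<phi>' x + ?s \<psi> \<psi>' x) - (?s \<phi> \<psi>' x + ?s \<psi> \<phi>' x)" if "x \<in> K" for x
        unfolding f(3)[OF that] g(3)[OF that] by (simp add: power2_eq_square algebra_simps)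
    qed
  qed
  show "(\<lambda>_. c) \<in> convex_differences" for c
    by (rule convex_differencesI[OF convex_cone_const[of "max c 0"] convex_cone_const[of "max (- c) 0"]]) auto
  show "\<exists>f\<in>convex_differences. f x \<noteq> f y" if xy: "x \<in> K" "y \<in> K" "x \<noteq> y" for x y
  proof -
    obtain f where f: "f \<in> A" "f x \<noteq> f y" using A_separates[OF xy] by blast
    let ?c = "A_norm K f"
    have "(\<lambda>x. f x + ?c * unit x) \<in> A" by (intro A_add A_scale f unit_A)
    then have "(\<lambda>x. f x + ?c * unit x) \<in> convex_cone"
      unfolding convex_cone_def
    proof (intro CollectI conjI ballI)
      show "0 \<le> f y + ?c * unit y" if "y \<in> K" for y using A_norm_ge[OF f(1) that] that by simp
    qed (erule A_continuous A_convex_on)+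
    moreover have "0 \<le> ?c" using A_norm_ge[OF f(1) xy(1)] by linarith
    ultimately have "f \<in> convex_differences"
      by (intro convex_differencesI[of "\<lambda>x. f x + ?c * unit x" "\<lambda>_. ?c"] convex_cone_const) auto
    then show ?thesis using f(2) by blast
  qed
qed

text \<open>Differences of convex functions are uniformly dense by Stone--Weierstrass. The result
  makes the Choquet order antisymmetric on Radon measures.\<close>

lemma radon_eq_if_convex_integrals_eq:
  assumes \<mu>: "radon_prob K \<mu>" and \<nu>: "radon_prob K \<nu>"
    and eq: "\<And>\<phi>. continuous_on K \<phi> \<Longrightarrow> convex_on K \<phi> \<Longrightarrow> (\<integral>x. \<phi> x \<partial>\<mu>) = (\<integral>x. \<phi> x \<partial>\<nu>)"
  shows "\<mu> = \<nu>"
proof (rule radon_prob_eqI[OF compact_K \<mu> \<nu>])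
  fix f :: "'a \<Rightarrow> real" assume f: "continuous_on K f"
  interpret R: function_ring_on convex_differences K by (rule function_ring_convex_differences)
  have approx: "\<bar>(\<integral>x. f x \<partial>\<mu>) - (\<integral>x. g x \<partial>\<mu>)\<bar> \<le> e"
    if \<mu>: "radon_prob K \<mu>" and g: "continuous_on K g" "\<And>x. x \<in> K \<Longrightarrow> \<bar>f x - g x\<bar> < e" for \<mu> g e
  proof -
    interpret prob_space \<mu> by (rule radon_prob_space[OF \<mu>])
    have i: "integrable \<mu> f" "integrable \<mu> g" using radon_integrable[OF compact_K \<mu>] f g(1) by auto
    have "(\<integral>x. f x \<partial>\<mu>) \<le> (\<integral>x. g x + e \<partial>\<mu>)"
      by (rule integral_mono) (use i g(2) radon_space[OF \<mu>] in \<open>fastforce simp: abs_less_iff\<close>)+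
    moreover have "(\<integral>x. g x \<partial>\<mu>) \<le> (\<integral>x. f x + e \<partial>\<mu>)"
      by (rule integral_mono) (use i g(2) radon_space[OF \<mu>] in \<open>fastforce simp: abs_less_iff\<close>)+
    ultimately show ?thesis using i by (simp add: prob_space abs_le_iff)
  qed
  have "\<bar>(\<integral>x. f x \<partial>\<mu>) - (\<integral>x. f x \<partial>\<nu>)\<bar> \<le> 0 + e" if e: "e > 0" for e
  proof -
    obtain g where g: "g \<in> convex_differences" "\<And>x. x \<in> K \<Longrightarrow> \<bar>f x - g x\<bar> < e / 2"
      using R.Stone_Weierstrass_basic[OF f, of "e / 2"] half_gt_zero[OF e] by blast
    have gc: "continuous_on K g" by (rule R.continuous[OF g(1)])
    obtain \<phi> \<psi> where d: "\<phi> \<in> convex_cone" "\<psi> \<in> convex_cone" "\<And>x. x \<in> K \<Longrightarrow> g x = \<phi> x - \<psi> x"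
      using g(1) by (auto simp: convex_differences_def)
    have int: "(\<integral>x. g x \<partial>\<mu>) = (\<integral>x. \<phi> x \<partial>\<mu>) - (\<integral>x. \<psi> x \<partial>\<mu>)" if \<mu>: "radon_prob K \<mu>" for \<mu>
    proof -
      have "(\<integral>x. g x \<partial>\<mu>) = (\<integral>x. \<phi> x - \<psi> x \<partial>\<mu>)"
        by (rule Bochner_Integration.integral_cong) (use d(3) radon_space[OF \<mu>] in auto)
      also have "\<dots> = (\<integral>x. \<phi> x \<partial>\<mu>) - (\<integral>x. \<psi> x \<partial>\<mu>)"
        using d radon_integrable[OF compact_K \<mu>]
        by (intro Bochner_Integration.integral_diff) (auto simp: convex_cone_def)
      finally show ?thesis .
    qed
    have "(\<integral>x. g x \<partial>\<mu>) = (\<integral>x. g x \<partial>\<nu>)"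
      unfolding int[OF \<mu>] int[OF \<nu>] using d eq by (auto simp: convex_cone_def)
    then show ?thesis using approx[OF \<mu> gc g(2)] approx[OF \<nu> gc g(2)] by linarith
  qed
  then have "\<bar>(\<integral>x. f x \<partial>\<mu>) - (\<integral>x. f x \<partial>\<nu>)\<bar> \<le> 0" by (rule field_le_epsilon)
  then show "(\<integral>x. f x \<partial>\<mu>) = (\<integral>x. f x \<partial>\<nu>)" by simp
qed

lemma concave_minimum:
  assumes "finite H" "H \<subseteq> A" "continuous_on K \<phi>" "\<And>h y. h \<in> H \<Longrightarrow> y \<in> K \<Longrightarrow> \<phi> y \<le> h y"
  shows "\<exists>m. continuous_on K m \<and> convex_on K (\<lambda>y. - m y) \<and> (\<forall>y\<in>K. \<phi> y \<le> m y) \<and> (\<forall>y\<in>K. \<forall>h\<in>H. m y \<le> h y)"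
  using assms(1,2,4)
proof (induction H rule: finite_induct)
  case empty
  \<comment> \<open>With no majorant given, the constant function at the maximum of
    \<open>\<phi>\<close> serves.\<close>
  obtain x where "x \<in> K" "\<And>y. y \<in> K \<Longrightarrow> \<phi> y \<le> \<phi> x"
    using continuous_attains_sup[OF compact_K K_ne assms(3)] by blast
  then show ?case
    using convex_K by (intro exI[of _ "\<lambda>_. \<phi> x"]) (auto simp: convex_on_const)
next
  case (insert h H)
  then obtain m where m: "continuous_on K m" "convex_on K (\<lambda>y. - m y)" "\<And>y. y \<in> K \<Longrightarrow> \<phi> y \<le> m y"
      "\<And>y h. y \<in> K \<Longrightarrow> h \<in> H \<Longrightarrow> m y \<le> h y" by auto
  have h: "h \<in> A" using insert by simp
  have "(\<lambda>y. (-1) * h y) \<in> A" by (rule A_scale[OF h])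
  then have "convex_on K (\<lambda>y. max (- m y) (- h y))"
    using A_convex_on[of "\<lambda>y. (-1) * h y"] by (intro convex_on_max_fun m) simp
  moreover have "(\<lambda>y. max (- m y) (- h y)) = (\<lambda>y. - min (m y) (h y))" by (auto simp: min_def max_def)
  ultimately have "convex_on K (\<lambda>y. - min (m y) (h y))" by simp
  moreover have "continuous_on K (\<lambda>y. min (m y) (h y))" by (intro continuous_intros m A_continuous h)
  ultimately show ?case
    using m insert.prems by (intro exI[of _ "\<lambda>y. min (m y) (h y)"]) (auto simp: min.coboundedI1)
qed

text \<open>At each extreme point some affine majorant is within \<open>e\<close> of
  \<open>\<phi>\<close>, and by continuity it stays so nearby. Compactness of \<open>X\<close>
  leaves finitely many of them, and their minimum is concave.\<close>

lemma concave_majorant_close_on_extreme: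
  assumes X: "compact X" and \<phi>: "continuous_on K \<phi>" and e: "e > 0"
  shows "\<exists>m. continuous_on K m \<and> convex_on K (\<lambda>y. - m y) \<and> (\<forall>y\<in>K. \<phi> y \<le> m y) \<and> (\<forall>y\<in>X. m y \<le> \<phi> y + e)"
proof -
  define G where "G = {h\<in>A. \<forall>y\<in>K. \<phi> y \<le> h y}"
  have "\<exists>V. open V \<and> V \<inter> K = {y \<in> K. h y < \<phi> y + e}" if "h \<in> G" for h
  proof -
    have "continuous_on K (\<lambda>y. h y - \<phi> y)" using that by (intro continuous_intros \<phi> A_continuous) (simp add: G_def)
    from continuous_openin_preimage_gen[OF this, of "{..<e}"]
    have "openin (top_of_set K) {y \<in> K. h y < \<phi> y + e}"
      by (simp add: vimage_def Int_def diff_less_eq add.commute)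
    then show ?thesis by (auto simp: openin_open)
  qed
  then obtain V where V: "\<And>h. h \<in> G \<Longrightarrow> open (V h)" "\<And>h. h \<in> G \<Longrightarrow> V h \<inter> K = {y \<in> K. h y < \<phi> y + e}" by metis
  have cover: "X \<subseteq> (\<Union>h\<in>G. V h)"
  proof
    fix x assume x: "x \<in> X"
    obtain h where "h \<in> G" "h x < \<phi> x + e"
      using affine_majorant_at_extreme[OF x \<phi> e] by (auto simp: G_def)
    then show "x \<in> (\<Union>h\<in>G. V h)" using V(2) x X_subset by blast
  qed
  obtain H where H: "H \<subseteq> G" "finite H" "X \<subseteq> (\<Union>h\<in>H. V h)"
    by (rule compactE_image[OF X _ cover]) (use V(1) in auto)
  obtain m where m: "continuous_on K m" "convex_on K (\<lambda>y. - m y)" "\<And>y. y \<in> K \<Longrightarrow> \<phi> y \<le> m y"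
      "\<And>y h. y \<in> K \<Longrightarrow> h \<in> H \<Longrightarrow> m y \<le> h y"
    using concave_minimum[OF H(2) _ \<phi>] H(1) by (auto simp: G_def subset_iff)
  have "m y \<le> \<phi> y + e" if y: "y \<in> X" for y
  proof -
    obtain h where h: "h \<in> H" "y \<in> V h" using H(3) y by blast
    then have "h y < \<phi> y + e" using V(2)[of h] H(1) y X_subset by blast
    moreover have "m y \<le> h y" using m(4) h y X_subset by blast
    ultimately show ?thesis by simp
  qed
  then show ?thesis using m by blast
qed

text \<open>The Choquet order reverses on concave functions. For concave \<open>m\<close> above
  \<open>\<phi>\<close> on K and within \<open>e\<close> of it on \<open>X\<close>, the integral of
  \<open>\<phi>\<close> over \<open>\<nu>\<close> is at most that of \<open>m\<close> over
  \<open>\<nu>\<close>, hence of \<open>m\<close> over \<open>\<mu>\<close>, and there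
  \<open>m\<close> may be replaced by \<open>\<phi> + e\<close> because \<open>\<mu>\<close> is
  carried by \<open>X\<close>.\<close>

lemma boundary_measure_if_on_extreme:
  assumes X: "compact X" and \<mu>: "radon_prob K \<mu>" and supp: "AE x in \<mu>. x \<in> X"
  shows "boundary_measure K \<mu>"
  unfolding boundary_measure_def
proof (intro conjI allI impI \<mu>)
  fix \<nu> assume "radon_prob K \<nu> \<and> choquet_le K \<mu> \<nu>"
  then have \<nu>: "radon_prob K \<nu>" and le: "choquet_le K \<mu> \<nu>" by auto
  interpret M: prob_space \<mu> by (rule radon_prob_space[OF \<mu>])
  show "\<nu> = \<mu>"
  proof (rule radon_eq_if_convex_integrals_eq[OF \<nu> \<mu>])
    fix \<phi> :: "'a \<Rightarrow> real" assume \<phi>: "continuous_on K \<phi>" "convex_on K \<phi>"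
    show "(\<integral>x. \<phi> x \<partial>\<nu>) = (\<integral>x. \<phi> x \<partial>\<mu>)"
    proof (rule antisym)
      show "(\<integral>x. \<phi> x \<partial>\<mu>) \<le> (\<integral>x. \<phi> x \<partial>\<nu>)" using le \<phi> by (simp add: choquet_le_def)
      show "(\<integral>x. \<phi> x \<partial>\<nu>) \<le> (\<integral>x. \<phi> x \<partial>\<mu>)"
      proof (rule field_le_epsilon)
        fix e :: real assume "0 < e"
        then obtain m where m: "continuous_on K m" "convex_on K (\<lambda>y. - m y)" "\<And>y. y \<in> K \<Longrightarrow> \<phi> y \<le> m y"
            "\<And>y. y \<in> X \<Longrightarrow> m y \<le> \<phi> y + e"
          using concave_majorant_close_on_extreme[OF X \<phi>(1)] by metis
        have "(\<integral>x. \<phi> x \<partial>\<nu>) \<le> (\<integral>x. m x \<partial>\<nu>)"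
          by (intro integral_mono radon_integrable[OF compact_K \<nu>] \<phi> m) (use m radon_space[OF \<nu>] in auto)
        also have "\<dots> \<le> (\<integral>x. m x \<partial>\<mu>)"
        proof -
          have "continuous_on K (\<lambda>y. - m y)" by (intro continuous_intros m)
          then have "(\<integral>x. - m x \<partial>\<mu>) \<le> (\<integral>x. - m x \<partial>\<nu>)" using le m(2) unfolding choquet_le_def by blast
          then show ?thesis by simp
        qed
        also have "\<dots> \<le> (\<integral>x. \<phi> x + e \<partial>\<mu>)"
        proof (rule integral_mono_AE)
          show "integrable \<mu> m" "integrable \<mu> (\<lambda>x. \<phi> x + e)"
            using radon_integrable[OF compact_K \<mu>] m \<phi> by auto
          show "AE x in \<mu>. m x \<le> \<phi> x + e" using supp by (rule eventually_mono) (rule m(4))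
        qed
        also have "\<dots> = (\<integral>x. \<phi> x \<partial>\<mu>) + e"
          using radon_integrable[OF compact_K \<mu> \<phi>(1)] by (simp add: M.prob_space)
        finally show "(\<integral>x. \<phi> x \<partial>\<nu>) \<le> (\<integral>x. \<phi> x \<partial>\<mu>) + e" .
      qed
    qed
  qed
qed

text \<open>Composing with restriction turns \<open>\<Lambda>\<close> into a state on K. Its measure
  vanishes on compact sets off \<open>Y\<close>, since an Urysohn function that is 0 on
  \<open>Y\<close> dominates their indicators; inner regularity does the rest.\<close>

lemma radon_measure_on_subset:
  assumes Y: "compact Y" "Y \<subseteq> K" and L: "state_on Y \<Lambda>"
  shows "\<exists>\<mu>. radon_prob K \<mu> \<and> (AE x in \<mu>. x \<in> Y) \<and> (\<forall>f. continuous_on K f \<longrightarrow> (\<integral>x. f x \<partial>\<mu>) = \<Lambda> f)"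
proof -
  define \<Lambda>' where "\<Lambda>' f = (if continuous_on K f then \<Lambda> f else 0)" for f
  have sub: "continuous_on Y f" if "continuous_on K f" for f :: "'a \<Rightarrow> real"
    using continuous_on_subset[OF that Y(2)] .
  have "state_on K \<Lambda>'"
    unfolding state_on_def linear_functional_on_def
  proof (intro conjI ballI allI impI)
    show "\<Lambda>' (\<lambda>x. f x + g x) = \<Lambda>' f + \<Lambda>' g" if "f \<in> {f. continuous_on K f}" "g \<in> {f. continuous_on K f}" for f g
      using that state_on_add[OF L sub sub, of f g] by (simp add: \<Lambda>'_def continuous_on_add)
    show "\<Lambda>' (\<lambda>x. c * f x) = c * \<Lambda>' f" if "f \<in> {f. continuous_on K f}" for f c
      using that state_on_scale[OF L sub, of f c] by (simp add: \<Lambda>'_def continuous_on_mult_left)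
    show "\<Lambda>' f = 0" if "\<not> continuous_on K f" for f using that by (simp add: \<Lambda>'_def)
    show "0 \<le> \<Lambda>' f" if "continuous_on K f" "\<forall>y\<in>K. 0 \<le> f y" for f
    proof -
      have "\<forall>y\<in>Y. 0 \<le> f y" using that(2) Y(2) by blast
      then show ?thesis using that(1) L sub[OF that(1)] by (simp add: \<Lambda>'_def state_on_def)
    qed
    show "\<Lambda>' (\<lambda>_. 1) = 1" using state_on_const[OF L, of 1] by (simp add: \<Lambda>'_def)
  qed
  from riesz_representation[OF compact_K this]
  obtain \<mu> where \<mu>: "radon_prob K \<mu>" and int: "\<And>f. continuous_on K f \<Longrightarrow> (\<integral>x. f x \<partial>\<mu>) = \<Lambda> f"
    by (auto simp: \<Lambda>'_def)
  interpret prob_space \<mu> by (rule radon_prob_space[OF \<mu>])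
  have clY: "closedin (top_of_set K) Y" by (rule compact_closedin[OF Y])
  have YM: "Y \<in> sets \<mu>" using closedin_measurable[OF clY] radon_sets[OF \<mu>] by simp
  have KY: "K - Y \<in> sets \<mu>" using YM radon_space[OF \<mu>] by (metis sets.compl_sets)
  have zero: "measure \<mu> C \<le> 0" if C: "compact C" "C \<subseteq> K - Y" for C
  proof -
    have clC: "closedin (top_of_set K) C" using C by (intro compact_closedin) auto
    have CM: "C \<in> sets \<mu>" using closedin_measurable[OF clC] radon_sets[OF \<mu>] by simp
    obtain w where w: "continuous_on K w" "\<And>x. x \<in> K \<Longrightarrow> 0 \<le> w x \<and> w x \<le> 1"
        "\<And>x. x \<in> Y \<Longrightarrow> w x = (0::real)" "\<And>x. x \<in> C \<Longrightarrow> w x = 1"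
      using urysohn_compact[OF compact_K clY clC] C(2) by blast
    have "measure \<mu> C = (\<integral>x. indicator C x \<partial>\<mu>)" using CM by simp
    also have "\<dots> \<le> (\<integral>x. w x \<partial>\<mu>)"
      by (intro integral_mono radon_integrable[OF compact_K \<mu> w(1)] integrable_real_indicator CM)
        (use w radon_space[OF \<mu>] in \<open>auto simp: indicator_def emeasure_eq_measure\<close>)
    also have "\<dots> = \<Lambda> w" by (rule int[OF w(1)])
    also have "\<dots> = 0"
      using state_on_cong[OF L sub[OF w(1)], of "\<lambda>_. 0"] w(3) state_on_const[OF L, of 0] by simp
    finally show ?thesis .
  qed
  have "measure \<mu> (K - Y) \<le> 0"
  proof (rule field_le_epsilon)
    fix e :: real assume "0 < e"
    then obtain C where "compact C" "C \<subseteq> K - Y" "measure \<mu> (K - Y) \<le> measure \<mu> C + e"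
      using radon_measure_inner[OF \<mu> KY] by metis
    then show "measure \<mu> (K - Y) \<le> 0 + e" using zero[of C] by linarith
  qed
  then have "K - Y \<in> null_sets \<mu>" using KY by (auto simp: null_sets_def emeasure_eq_measure measure_le_0_iff)
  then have "AE x in \<mu>. x \<in> Y"
    using radon_space[OF \<mu>] by (intro AE_I'[of "K - Y"]) auto
  then show ?thesis using \<mu> int by blast
qed

lemma boundary_measure_of_state:
  assumes X: "compact X" and L: "state_on X \<Lambda>" and x: "x \<in> K" and ev: "\<And>f. f \<in> A \<Longrightarrow> \<Lambda> f = f x"
  obtains \<mu> where "boundary_measure K \<mu>" "is_barycenter K x \<mu>" "AE y in \<mu>. y \<in> X" "radon_prob K \<mu>"
    "\<And>f. continuous_on K f \<Longrightarrow> (\<integral>y. f y \<partial>\<mu>) = \<Lambda> f"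
proof -
  obtain \<mu> where \<mu>: "radon_prob K \<mu>" "AE y in \<mu>. y \<in> X" "\<And>f. continuous_on K f \<Longrightarrow> (\<integral>y. f y \<partial>\<mu>) = \<Lambda> f"
    using radon_measure_on_subset[OF X X_subset L] by blast
  have "is_barycenter K x \<mu>" using x ev \<mu>(3) A_continuous by (auto simp: is_barycenter_def)
  then show ?thesis using that \<mu> boundary_measure_if_on_extreme[OF X \<mu>(1,2)] by blast
qed

end

subsection \<open>Compatibility of binary measurements\<close>

context compact_convex
begin

definition effects :: "('a \<Rightarrow> real) set" where
  "effects = {f\<in>A. \<forall>x\<in>K. 0 \<le> f x \<and> f x \<le> 1}"

text \<open>Here \<open>h\<close> is the corner entry of the two-by-two table with margins
  \<open>f\<close>, \<open>1 - f\<close> and \<open>g\<close>, \<open>1 - g\<close>; the four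
  inequalities say that all entries of the table are nonnegative.\<close>

definition effects_interpolate :: bool where
  "effects_interpolate \<longleftrightarrow> (\<forall>f\<in>effects. \<forall>g\<in>effects. \<exists>h\<in>A. \<forall>x\<in>K. 0 \<le> h x \<and> f x + g x - 1 \<le> h x \<and> h x \<le> f x \<and> h x \<le> g x)"

lemma A_posI: "f \<in> A \<Longrightarrow> (\<And>x. x \<in> K \<Longrightarrow> 0 \<le> f x) \<Longrightarrow> f \<in> A_pos K"
  by (simp add: A_pos_def)

lemma binary_sum: "(\<Sum>k=1..2. F k) = F 1 + F (2::nat)" for F :: "nat \<Rightarrow> real"
proof -
  have "{1..2::nat} = {1, 2}" by auto
  then show ?thesis by simp
qed

lemma compatible_if_interpolate:
  assumes "effects_interpolate" and F: "measurement K 2 F" and G: "measurement K 2 G"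
  shows "compatible K 2 F 2 G"
proof -
  have FA: "F k \<in> A" "\<And>x. x \<in> K \<Longrightarrow> 0 \<le> F k x" if "k \<in> {1..2}" for k
    using F that by (auto simp: measurement_def A_pos_def)
  have GA: "G k \<in> A" "\<And>x. x \<in> K \<Longrightarrow> 0 \<le> G k x" if "k \<in> {1..2}" for k
    using G that by (auto simp: measurement_def A_pos_def)
  have F1: "F 1 x + F 2 x = 1" and G1: "G 1 x + G 2 x = 1" if "x \<in> K" for x
    using F G that unfolding measurement_def binary_sum by auto
  have "F 1 \<in> effects" "G 1 \<in> effects"
    unfolding effects_def using FA[of 1] GA[of 1] FA(2)[of 2] GA(2)[of 2] F1 G1 by fastforce+
  then obtain h where h: "h \<in> A"
      and h': "\<And>x. x \<in> K \<Longrightarrow> 0 \<le> h x \<and> F 1 x + G 1 x - 1 \<le> h x \<and> h x \<le> F 1 x \<and> h x \<le> G 1 x"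
    using assms(1) unfolding effects_interpolate_def by blast
  define H where "H k j = (if k = (1::nat) then (if j = (1::nat) then h else (\<lambda>x. F 1 x - h x))
      else (if j = 1 then (\<lambda>x. G 1 x - h x) else (\<lambda>x. (F 2 x - G 1 x) + h x)))" for k j
  have "H k j \<in> A" for k j
    using h FA(1)[of 1] FA(1)[of 2] GA(1)[of 1] by (simp add: H_def A_diff A_add[OF A_diff])
  moreover have "0 \<le> H k j x" if "x \<in> K" for k j x
    using h'[OF that] F1[OF that] by (auto simp: H_def)
  ultimately have "H k j \<in> A_pos K" for k j by (intro A_posI)
  moreover have "F k = (\<lambda>x. \<Sum>j=1..2. H k j x)" if "k \<in> {1..2}" for k
  proof -
    have "k = 1 \<or> k = 2" using that by auto
    then show ?thesis unfolding binary_sum by (auto simp: H_def)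
  qed
  moreover have "G j = (\<lambda>x. \<Sum>k=1..2. H k j x)" if j: "j \<in> {1..2}" for j
  proof -
    have "G 2 x = F 1 x - h x + (F 2 x - G 1 x + h x)" for x
      using F1[of x] G1[of x] A_outside[OF FA(1), of 1 x] A_outside[OF FA(1), of 2 x]
        A_outside[OF GA(1), of 1 x] A_outside[OF GA(1), of 2 x] by (cases "x \<in> K") auto
    moreover have "j = 1 \<or> j = 2" using j by auto
    ultimately show ?thesis unfolding binary_sum by (auto simp: H_def)
  qed
  ultimately show ?thesis unfolding compatible_def by blast
qed

lemma interpolate_if_compatible:
  assumes comp: "\<And>F G. measurement K 2 F \<Longrightarrow> measurement K 2 G \<Longrightarrow> compatible K 2 F 2 G"
  shows "effects_interpolate"
  unfolding effects_interpolate_def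
proof (intro ballI)
  fix f g assume f: "f \<in> effects" and g: "g \<in> effects"
  define M where "M f k = (if k = (1::nat) then f else (\<lambda>x. unit x - f x))" for f :: "'a \<Rightarrow> real" and k
  have M: "measurement K 2 (M f)" if "f \<in> effects" for f
    using that A_diff[OF unit_A, of f] unfolding measurement_def binary_sum
    by (auto simp: M_def effects_def A_pos_def)
  obtain H where H: "\<And>k j. k \<in> {1..2} \<Longrightarrow> j \<in> {1..2} \<Longrightarrow> H k j \<in> A_pos K"
      and Hf: "\<And>k. k \<in> {1..2} \<Longrightarrow> M f k = (\<lambda>x. \<Sum>j=1..2. H k j x)"
      and Hg: "\<And>j. j \<in> {1..2} \<Longrightarrow> M g j = (\<lambda>x. \<Sum>k=1..2. H k j x)"
    using comp[OF M[OF f] M[OF g]] unfolding compatible_def by metis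
  have pos: "0 \<le> H 1 1 x" "0 \<le> H 1 2 x" "0 \<le> H 2 1 x" "0 \<le> H 2 2 x" if "x \<in> K" for x
    using H that by (auto simp: A_pos_def)
  have e: "f x = H 1 1 x + H 1 2 x" "1 - f x = H 2 1 x + H 2 2 x" "g x = H 1 1 x + H 2 1 x" if "x \<in> K" for x
    using fun_cong[OF Hf[of 1], of x] fun_cong[OF Hf[of 2], of x] fun_cong[OF Hg[of 1], of x] that
    unfolding binary_sum by (auto simp: M_def)
  show "\<exists>h\<in>A. \<forall>x\<in>K. 0 \<le> h x \<and> f x + g x - 1 \<le> h x \<and> h x \<le> f x \<and> h x \<le> g x"
  proof (intro bexI[of _ "H 1 1"] ballI)
    show "H 1 1 \<in> A" using H[of 1 1] by (simp add: A_pos_def)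
    show "0 \<le> H 1 1 x \<and> f x + g x - 1 \<le> H 1 1 x \<and> H 1 1 x \<le> f x \<and> H 1 1 x \<le> g x" if "x \<in> K" for x
      using pos[OF that] e[OF that] by linarith
  qed
qed

lemma compatible_iff_interpolate:
  "(\<forall>F G. measurement K 2 F \<and> measurement K 2 G \<longrightarrow> compatible K 2 F 2 G) \<longleftrightarrow> effects_interpolate"
proof
  assume "\<forall>F G. measurement K 2 F \<and> measurement K 2 G \<longrightarrow> compatible K 2 F 2 G"
  then show effects_interpolate by (intro interpolate_if_compatible) simp
next
  assume effects_interpolate
  then show "\<forall>F G. measurement K 2 F \<and> measurement K 2 G \<longrightarrow> compatible K 2 F 2 G"
    by (simp add: compatible_if_interpolate)
qed

text \<open>
  If the upper and the lower affine envelope of \<open>\<psi>\<close> differed at \<open>x\<close>, then \<open>x\<close> would be represented by two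
  measures on \<open>X\<close>, both of them maximal. So they agree, and an envelope that is both is affine and continuous.
\<close>

lemma Bauer_affine_extension:
  assumes B: "Bauer_simplex K" and \<psi>: "continuous_on K \<psi>"
  shows "\<exists>q\<in>A. (\<forall>h\<in>A. (\<forall>y\<in>X. \<psi> y \<le> h y) \<longrightarrow> (\<forall>x\<in>K. q x \<le> h x)) \<and>
    (\<forall>h\<in>A. (\<forall>y\<in>X. h y \<le> \<psi> y) \<longrightarrow> (\<forall>x\<in>K. h x \<le> q x))"
proof -
  have X: "compact X" using B by (simp add: Bauer_simplex_def)
  have \<psi>X: "continuous_on X \<psi>" by (rule continuous_on_subset[OF \<psi> X_subset])
  define Up where "Up = {h\<in>A. \<forall>y\<in>X. \<psi> y \<le> h y}"
  define Lo where "Lo = {h\<in>A. \<forall>y\<in>X. h y \<le> \<psi> y}"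
  obtain m where m: "\<And>y. y \<in> K \<Longrightarrow> \<bar>\<psi> y\<bar> \<le> m"
    using compact_imp_bounded[OF compact_continuous_image[OF \<psi> compact_K]] by (auto simp: bounded_real)
  have "\<psi> y \<le> m * unit y" "(- m) * unit y \<le> \<psi> y" if "y \<in> X" for y
  proof -
    have "y \<in> K" using X_subset that by blast
    then show "\<psi> y \<le> m * unit y" "(- m) * unit y \<le> \<psi> y" using m[of y] by auto
  qed
  then have "(\<lambda>y. m * unit y) \<in> Up" "(\<lambda>y. (- m) * unit y) \<in> Lo"
    unfolding Up_def Lo_def using A_scale[OF unit_A] by blast+
  then have ne: "Up \<noteq> {}" "Lo \<noteq> {}" by auto
  have LU: "l x \<le> h x" if "l \<in> Lo" "h \<in> Up" "x \<in> K" for l h x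
    using that by (intro A_le_on_extreme[of l h x]) (fastforce simp: Up_def Lo_def)+
  define U where "U x = (INF h\<in>Up. h x)" for x
  define L where "L x = (SUP h\<in>Lo. h x)" for x
  have bU: "bdd_below ((\<lambda>h. h x) ` Up)" and bL: "bdd_above ((\<lambda>h. h x) ` Lo)" if "x \<in> K" for x
  proof -
    obtain l h where "l \<in> Lo" "h \<in> Up" using ne by blast
    then show "bdd_below ((\<lambda>h. h x) ` Up)" "bdd_above ((\<lambda>h. h x) ` Lo)"
      using LU[OF _ _ that] by (meson bdd_belowI2 bdd_aboveI2)+
  qed
  have U_le: "U x \<le> h x" if "h \<in> Up" "x \<in> K" for h x unfolding U_def using that bU by (intro cINF_lower)
  have le_L: "h x \<le> L x" if "h \<in> Lo" "x \<in> K" for h x unfolding L_def using that bL by (intro cSUP_upper)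
  have L_le_U: "L x \<le> U x" if "x \<in> K" for x
    unfolding L_def U_def using ne LU[OF _ _ that] by (intro cINF_greatest cSUP_least)
  have state: "\<exists>\<Lambda>. state_on X \<Lambda> \<and> (\<forall>f\<in>A. \<Lambda> f = f x) \<and> \<Lambda> \<psi> = s" if "x \<in> K" "L x \<le> s" "s \<le> U x" for x s
  proof (rule evaluation_extends[OF X order_refl X_subset that(1) \<psi>X])
    show "s \<le> h x" if "h \<in> A" "\<And>y. y \<in> X \<Longrightarrow> \<psi> y \<le> h y" for h
      using that U_le[of h x] \<open>x \<in> K\<close> \<open>s \<le> U x\<close> by (auto simp: Up_def)
    show "h x \<le> s" if "h \<in> A" "\<And>y. y \<in> X \<Longrightarrow> h y \<le> \<psi> y" for h
      using that le_L[of h x] \<open>x \<in> K\<close> \<open>L x \<le> s\<close> by (auto simp: Lo_def)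
  qed
  have eq: "L x = U x" if x: "x \<in> K" for x
  proof -
    obtain \<Lambda> where 1: "state_on X \<Lambda>" "\<And>f. f \<in> A \<Longrightarrow> \<Lambda> f = f x" "\<Lambda> \<psi> = L x"
      using state[OF x order_refl L_le_U[OF x]] by blast
    obtain \<Lambda>' where 2: "state_on X \<Lambda>'" "\<And>f. f \<in> A \<Longrightarrow> \<Lambda>' f = f x" "\<Lambda>' \<psi> = U x"
      using state[OF x L_le_U[OF x] order_refl] by blast
    obtain \<mu> where m1: "boundary_measure K \<mu>" "is_barycenter K x \<mu>" "(\<integral>y. \<psi> y \<partial>\<mu>) = \<Lambda> \<psi>"
      using boundary_measure_of_state[OF X 1(1) x 1(2)] \<psi> by metis
    obtain \<mu>' where m2: "boundary_measure K \<mu>'" "is_barycenter K x \<mu>'" "(\<integral>y. \<psi> y \<partial>\<mu>') = \<Lambda>' \<psi>"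
      using boundary_measure_of_state[OF X 2(1) x 2(2)] \<psi> by metis
    have "\<mu> = \<mu>'" using B x m1(1,2) m2(1,2) unfolding Bauer_simplex_def by blast
    then show ?thesis using m1(3) m2(3) 1(3) 2(3) by simp
  qed
  \<comment> \<open>As an infimum of affine functions \<open>U\<close> is concave, and as a supremum
    \<open>L\<close> is convex; since they agree, both are affine.\<close>
  have "affine_fun_on K U"
    unfolding affine_fun_on_def
  proof (intro ballI allI impI)
    fix x y and u v :: real assume xy: "x \<in> K" "y \<in> K" and uv: "u \<ge> 0" "v \<ge> 0" "u + v = 1"
    let ?z = "u *\<^sub>R x + v *\<^sub>R y"
    have z: "?z \<in> K" by (rule convex_combination_mem[OF xy uv])
    have "u * U x + v * U y \<le> U ?z"
      unfolding U_def[of ?z]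
    proof (rule cINF_greatest[OF ne(1)])
      fix h assume h: "h \<in> Up"
      have "u * U x + v * U y \<le> u * h x + v * h y"
        using U_le[OF h] xy uv by (intro add_mono mult_left_mono) auto
      also have "\<dots> = h ?z" using A_affine[OF _ xy uv, of h] h by (simp add: Up_def)
      finally show "u * U x + v * U y \<le> h ?z" .
    qed
    moreover have "L ?z \<le> u * L x + v * L y"
      unfolding L_def[of ?z]
    proof (rule cSUP_least[OF ne(2)])
      fix h assume h: "h \<in> Lo"
      have "h ?z = u * h x + v * h y" using A_affine[OF _ xy uv, of h] h by (simp add: Lo_def)
      also have "\<dots> \<le> u * L x + v * L y"
        using le_L[OF h] xy uv by (intro add_mono mult_left_mono) auto
      finally show "h ?z \<le> u * L x + v * L y" .
    qed
    ultimately show "U ?z = u * U x + v * U y" using eq xy z by simp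
  qed
  \<comment> \<open>Lower semicontinuity is read off from \<open>L\<close>, upper semicontinuity
    from \<open>U\<close>.\<close>
  moreover have "continuous_on K U"
    unfolding continuous_on_def
  proof (intro ballI order_tendstoI)
    fix x a assume x: "x \<in> K"
    have ev: "eventually (\<lambda>y. y \<in> K) (at x within K)" by (simp add: eventually_at_filter)
    have lim: "(h \<longlongrightarrow> h x) (at x within K)" if "h \<in> A" for h
      using A_continuous[OF that] x by (simp add: continuous_on_def)
    show "eventually (\<lambda>y. a < U y) (at x within K)" if "a < U x"
    proof -
      have "a < (SUP h\<in>Lo. h x)" using that eq[OF x] by (simp add: L_def)
      then obtain h where h: "h \<in> Lo" "a < h x" using less_cSUP_iff[OF ne(2) bL[OF x]] by blast
      have "eventually (\<lambda>y. a < h y) (at x within K)"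
        using h by (intro order_tendstoD(1)[OF lim[of h]]) (simp_all add: Lo_def)
      with ev show ?thesis
      proof eventually_elim
        case (elim y)
        then show ?case using le_L[OF h(1), of y] eq[of y] by simp
      qed
    qed
    show "eventually (\<lambda>y. U y < a) (at x within K)" if "U x < a"
    proof -
      have "(INF h\<in>Up. h x) < a" using that by (simp add: U_def)
      then obtain h where h: "h \<in> Up" "h x < a" using cINF_less_iff[OF ne(1) bU[OF x]] by blast
      have "eventually (\<lambda>y. h y < a) (at x within K)"
        using h by (intro order_tendstoD(2)[OF lim[of h]]) (simp_all add: Up_def)
      with ev show ?thesis
      proof eventually_elim
        case (elim y)
        then show ?case using U_le[OF h(1), of y] by simp
      qed
    qed
  qed
  ultimately have q: "(\<lambda>x. if x \<in> K then U x else 0) \<in> A" by (intro A_restrictI)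
  show ?thesis
    using U_le le_L eq by (intro bexI[OF _ q]) (auto simp: Up_def Lo_def)
qed

text \<open>The affine envelope of the minimum of \<open>f\<close> and \<open>g\<close>
  interpolates: on \<open>X\<close>, the functions 0 and \<open>f + g - 1\<close> lie below this
  minimum, while \<open>f\<close> and \<open>g\<close> lie above it.\<close>

lemma Bauer_imp_interpolate:
  assumes "Bauer_simplex K" shows effects_interpolate
  unfolding effects_interpolate_def
proof (intro ballI)
  fix f g assume "f \<in> effects" "g \<in> effects"
  then have f: "f \<in> A" "\<And>x. x \<in> K \<Longrightarrow> 0 \<le> f x \<and> f x \<le> 1" and g: "g \<in> A" "\<And>x. x \<in> K \<Longrightarrow> 0 \<le> g x \<and> g x \<le> 1"
    by (auto simp: effects_def)
  have "continuous_on K (\<lambda>x. min (f x) (g x))" by (intro continuous_intros A_continuous f g)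
  from Bauer_affine_extension[OF assms this]
  obtain q where q1: "q \<in> A"
    and q2: "\<forall>h\<in>A. (\<forall>y\<in>X. min (f y) (g y) \<le> h y) \<longrightarrow> (\<forall>x\<in>K. q x \<le> h x)"
    and q3: "\<forall>h\<in>A. (\<forall>y\<in>X. h y \<le> min (f y) (g y)) \<longrightarrow> (\<forall>x\<in>K. h x \<le> q x)" by auto
  have fg: "0 \<le> f y \<and> f y \<le> 1 \<and> 0 \<le> g y \<and> g y \<le> 1 \<and> y \<in> K" if "y \<in> X" for y
    using f(2)[of y] g(2)[of y] that X_subset by auto
  have "0 \<le> q x" if "x \<in> K" for x
    using bspec[OF q3 function_space_zero[OF function_space_A]] that fg by simp
  moreover have "f x + g x - 1 \<le> q x" if "x \<in> K" for x
  proof -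
    have "(\<lambda>x. (f x + g x) - unit x) \<in> A" by (intro A_diff A_add f g unit_A)
    from bspec[OF q3 this] that fg show ?thesis by simp
  qed
  moreover have "q x \<le> f x" "q x \<le> g x" if "x \<in> K" for x
    using bspec[OF q2 f(1)] bspec[OF q2 g(1)] that by auto
  ultimately show "\<exists>h\<in>A. \<forall>x\<in>K. 0 \<le> h x \<and> f x + g x - 1 \<le> h x \<and> h x \<le> f x \<and> h x \<le> g x"
    using q1 by (intro bexI[of _ q]) auto
qed

end

subsection \<open>Central operators\<close>

lemma blinfun_of_linear:
  fixes w :: "'p::real_normed_vector \<Rightarrow> real"
  assumes "\<And>p q. w (p + q) = w p + w q" "\<And>c p. w (c *\<^sub>R p) = c * w p" "\<And>p. \<bar>w p\<bar> \<le> C * norm p"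
  shows "\<exists>e :: 'p \<Rightarrow>\<^sub>L real. blinfun_apply e = w"
proof -
  have "bounded_linear w"
    by (rule bounded_linear_intro[of w C]) (use assms in \<open>auto simp: mult.commute\<close>)
  then show ?thesis using bounded_linear_Blinfun_apply by blast
qed

lemma norm_blinfun_le_iff:
  fixes e :: "'p::real_normed_vector \<Rightarrow>\<^sub>L real"
  assumes "0 \<le> c"
  shows "norm e \<le> c \<longleftrightarrow> (\<forall>p. \<bar>blinfun_apply e p\<bar> \<le> c * norm p)"
proof
  assume "norm e \<le> c"
  show "\<forall>p. \<bar>blinfun_apply e p\<bar> \<le> c * norm p"
  proof
    fix p
    have "\<bar>blinfun_apply e p\<bar> \<le> norm e * norm p" using norm_blinfun[of e p] by simp
    also have "\<dots> \<le> c * norm p" using \<open>norm e \<le> c\<close> by (simp add: mult_right_mono)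
    finally show "\<bar>blinfun_apply e p\<bar> \<le> c * norm p" .
  qed
next
  assume "\<forall>p. \<bar>blinfun_apply e p\<bar> \<le> c * norm p"
  then show "norm e \<le> c" using assms by (intro norm_blinfun_bound) auto
qed

locale predual_state_space = compact_convex K for K :: "'a::locally_convex_space set" +
  fixes \<Phi> :: "('p::banach \<Rightarrow>\<^sub>L real) \<Rightarrow> 'a \<Rightarrow> real"
  assumes iso: "predual_iso K \<Phi>"
begin

lemma Phi_add [simp]: "\<Phi> (e + f) x = \<Phi> e x + \<Phi> f x"
  and Phi_scale [simp]: "\<Phi> (c *\<^sub>R e) x = c * \<Phi> e x"
  using iso by (simp_all add: predual_iso_def)

lemma Phi_zero [simp]: "\<Phi> 0 x = 0" using Phi_scale[of 0 0 x] by simp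

lemma Phi_minus [simp]: "\<Phi> (- e) x = - \<Phi> e x" using Phi_scale[of "-1" e x] by simp

lemma Phi_diff [simp]: "\<Phi> (e - f) x = \<Phi> e x - \<Phi> f x" using Phi_add[of e "- f" x] by simp

lemma Phi_A: "\<Phi> e \<in> A"
  using iso by (auto simp: predual_iso_def bij_betw_def)

lemma Phi_surj: "f \<in> A \<Longrightarrow> \<exists>e. \<Phi> e = f"
  using iso unfolding predual_iso_def bij_betw_def by (metis imageE)

lemma Phi_eqI:
  assumes "\<And>x. x \<in> K \<Longrightarrow> \<Phi> e x = \<Phi> f x" shows "e = f"
proof -
  have "\<Phi> e = \<Phi> f" by (rule A_eqI[OF Phi_A Phi_A assms])
  then show ?thesis using iso by (auto simp: predual_iso_def bij_betw_def inj_on_def)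
qed

lemma norm_Phi: "norm e = A_norm K (\<Phi> e)"
  using iso by (simp add: predual_iso_def)

lemma Phi_le_norm: "x \<in> K \<Longrightarrow> \<bar>\<Phi> e x\<bar> \<le> norm e"
  unfolding norm_Phi by (rule A_norm_ge[OF Phi_A])

lemma norm_le_iff: "norm e \<le> c \<longleftrightarrow> (\<forall>x\<in>K. \<bar>\<Phi> e x\<bar> \<le> c)"
proof
  assume "norm e \<le> c" then show "\<forall>x\<in>K. \<bar>\<Phi> e x\<bar> \<le> c" using Phi_le_norm order_trans by blast
next
  assume "\<forall>x\<in>K. \<bar>\<Phi> e x\<bar> \<le> c"
  moreover obtain x where "x \<in> K" "A_norm K (\<Phi> e) = \<bar>\<Phi> e x\<bar>" using A_norm_attained[OF Phi_A] by metis
  ultimately show "norm e \<le> c" by (simp add: norm_Phi)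
qed

definition u :: "'p \<Rightarrow>\<^sub>L real" where "u = (SOME e. \<Phi> e = unit)"

lemma Phi_u: "\<Phi> u = unit"
  unfolding u_def using Phi_surj[OF unit_A] by (rule someI_ex)

lemma Phi_u_eq [simp]: "x \<in> K \<Longrightarrow> \<Phi> u x = 1" by (simp add: Phi_u)

text \<open>The order interval from \<open>0\<close> to \<open>c u\<close> is a ball, hence described by weak-* closed conditions.\<close>

lemma interval_iff:
  assumes "0 \<le> c"
  shows "(\<forall>x\<in>K. 0 \<le> \<Phi> e x \<and> \<Phi> e x \<le> c) \<longleftrightarrow> (\<forall>p. \<bar>2 * blinfun_apply e p - c * blinfun_apply u p\<bar> \<le> c * norm p)"
proof -
  have "(\<forall>x\<in>K. 0 \<le> \<Phi> e x \<and> \<Phi> e x \<le> c) \<longleftrightarrow> (\<forall>x\<in>K. \<bar>\<Phi> (2 *\<^sub>R e - c *\<^sub>R u) x\<bar> \<le> c)"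
    by (intro ball_cong refl) (auto simp: abs_le_iff)
  also have "\<dots> \<longleftrightarrow> norm (2 *\<^sub>R e - c *\<^sub>R u) \<le> c" by (simp only: norm_le_iff)
  also have "\<dots> \<longleftrightarrow> (\<forall>p. \<bar>2 * blinfun_apply e p - c * blinfun_apply u p\<bar> \<le> c * norm p)"
    unfolding norm_blinfun_le_iff[OF assms] by (simp add: blinfun.diff_left blinfun.scaleR_left)
  finally show ?thesis .
qed

definition unit_interval :: "('p \<Rightarrow>\<^sub>L real) set" where
  "unit_interval = {e. \<forall>x\<in>K. 0 \<le> \<Phi> e x \<and> \<Phi> e x \<le> 1}"

lemma normalize:
  assumes "norm a \<le> n" "n > 0"
  shows "(1 / (2 * n)) *\<^sub>R (a + n *\<^sub>R u) \<in> unit_interval"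
  unfolding unit_interval_def
proof (intro CollectI ballI)
  fix x assume x: "x \<in> K"
  have "\<bar>\<Phi> a x\<bar> \<le> n" using Phi_le_norm[OF x, of a] assms by linarith
  then show "0 \<le> \<Phi> ((1 / (2 * n)) *\<^sub>R (a + n *\<^sub>R u)) x \<and> \<Phi> ((1 / (2 * n)) *\<^sub>R (a + n *\<^sub>R u)) x \<le> 1"
    using assms x by (auto simp: abs_le_iff field_simps)
qed

text \<open>Banach--Alaoglu for the unit interval; the box \<open>B\<close> is
  \<open>interval_iff\<close> with \<open>c = 1\<close>, solved for the coordinate at
  \<open>p\<close>.\<close>

lemma compact_unit_interval: "compact (blinfun_apply ` unit_interval)"
proof -
  define B where "B p = {(blinfun_apply u p - norm p) / 2 .. (blinfun_apply u p + norm p) / 2}" for p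
  let ?L = "(\<Inter>p. \<Inter>q. {w. w (p + q) = w p + w q}) \<inter> (\<Inter>c. \<Inter>p. {w. w (c *\<^sub>R p) = c * w p}) :: ('p \<Rightarrow> real) set"
  have "blinfun_apply ` unit_interval = {w. \<forall>p. w p \<in> B p} \<inter> ?L"
  proof (intro equalityI subsetI)
    fix w assume "w \<in> blinfun_apply ` unit_interval"
    then obtain e where e: "e \<in> unit_interval" "w = blinfun_apply e" by blast
    have b: "\<bar>2 * blinfun_apply e p - blinfun_apply u p\<bar> \<le> norm p" for p
      using e(1) interval_iff[of 1 e] by (simp add: unit_interval_def)
    have "w p \<in> B p" for p using b[of p] by (auto simp: B_def e abs_le_iff)
    then show "w \<in> {w. \<forall>p. w p \<in> B p} \<inter> ?L"
      using e by (auto simp: blinfun.add_right blinfun.scaleR_right)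
  next
    fix w assume w: "w \<in> {w. \<forall>p. w p \<in> B p} \<inter> ?L"
    then have wB: "\<bar>2 * w p - blinfun_apply u p\<bar> \<le> norm p" for p
      by (auto simp: B_def abs_le_iff field_simps)
    have "\<bar>w p\<bar> \<le> (1 + norm u) * norm p" for p
    proof -
      have "\<bar>blinfun_apply u p\<bar> \<le> norm u * norm p" using norm_blinfun[of u p] by simp
      moreover have "(1 + norm u) * norm p = norm p + norm u * norm p" by (simp add: distrib_right)
      ultimately show ?thesis using wB[of p] norm_ge_zero[of p] by linarith
    qed
    then obtain e where e: "blinfun_apply e = w" using w blinfun_of_linear[of w "1 + norm u"] by auto
    have "e \<in> unit_interval" using wB interval_iff[of 1 e] by (simp add: unit_interval_def e)
    then show "w \<in> blinfun_apply ` unit_interval" using e by blast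
  qed
  moreover have "compact ({w. \<forall>p. w p \<in> B p} \<inter> ?L)"
    by (intro compact_Int_closed compact_fun_product closed_Int closed_INT ballI closed_Collect_eq continuous_intros)
      (simp add: B_def)
  ultimately show ?thesis by simp
qed

text \<open>The order interval from 0 to the identity among the linear operators, that is, the unit
  interval of the ideal center. Boundedness follows from the order bounds in
  \<open>central_norm\<close>.\<close>

definition central :: "(('p \<Rightarrow>\<^sub>L real) \<Rightarrow> ('p \<Rightarrow>\<^sub>L real)) \<Rightarrow> bool" where
  "central T \<longleftrightarrow> (\<forall>e f. T (e + f) = T e + T f) \<and> (\<forall>c e. T (c *\<^sub>R e) = c *\<^sub>R T e) \<and>
    (\<forall>e. (\<forall>x\<in>K. 0 \<le> \<Phi> e x) \<longrightarrow> (\<forall>x\<in>K. 0 \<le> \<Phi> (T e) x \<and> \<Phi> (T e) x \<le> \<Phi> e x))"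

lemma central_add: "central T \<Longrightarrow> T (e + f) = T e + T f"
  and central_scale: "central T \<Longrightarrow> T (c *\<^sub>R e) = c *\<^sub>R T e"
  and central_pos: "central T \<Longrightarrow> (\<And>x. x \<in> K \<Longrightarrow> 0 \<le> \<Phi> e x) \<Longrightarrow> x \<in> K \<Longrightarrow> 0 \<le> \<Phi> (T e) x \<and> \<Phi> (T e) x \<le> \<Phi> e x"
  by (auto simp: central_def)

lemma central_norm:
  assumes T: "central T" shows "norm (T e) \<le> norm e"
  unfolding norm_le_iff[of "T e"]
proof
  fix x assume x: "x \<in> K"
  let ?n = "norm e"
  have u: "0 \<le> \<Phi> (T u) x \<and> \<Phi> (T u) x \<le> 1" using central_pos[OF T, of u x] x by simp
  have m: "T (- e) = - T e" using central_scale[OF T, of "-1" e] by simp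
  have "0 \<le> \<Phi> (T (?n *\<^sub>R u + e)) x" "0 \<le> \<Phi> (T (?n *\<^sub>R u + - e)) x"
    using Phi_le_norm[of _ e] by (intro central_pos[OF T, THEN conjunct1] x; force simp: abs_le_iff)+
  then have "- (?n * \<Phi> (T u) x) \<le> \<Phi> (T e) x" "\<Phi> (T e) x \<le> ?n * \<Phi> (T u) x"
    unfolding central_add[OF T] central_scale[OF T] m by simp_all
  moreover have "?n * \<Phi> (T u) x \<le> ?n" using u by (simp add: mult_left_le)
  ultimately show "\<bar>\<Phi> (T e) x\<bar> \<le> ?n" by linarith
qed

text \<open>Operators are recorded by all their matrix entries, so that the product topology becomes
  the weak-* operator topology.\<close>

definition central_graphs :: "(('p \<Rightarrow>\<^sub>L real) \<times> 'p \<Rightarrow> real) set" where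
  "central_graphs = {\<tau>. \<exists>T. central T \<and> (\<forall>e p. \<tau> (e, p) = blinfun_apply (T e) p)}"

text \<open>For positive \<open>e\<close>, both \<open>T e\<close> and \<open>e - T e\<close> lie
  between 0 and \<open>norm e\<close> times the unit. In this bounded form
  \<open>interval_iff\<close> turns positivity into closed conditions on single entries.\<close>

lemma compact_central_graphs: "compact central_graphs"
proof -
  define B where "B = (\<lambda>(e :: 'p \<Rightarrow>\<^sub>L real, p :: 'p). {- (norm e * norm p) .. norm e * norm p})"
  define Pos where "Pos = {e. \<forall>x\<in>K. 0 \<le> \<Phi> e x}"
  let ?L = "(\<Inter>e. \<Inter>f. \<Inter>p. {\<tau>. \<tau> (e + f, p) = \<tau> (e, p) + \<tau> (f, p)}) \<inter> (\<Inter>c. \<Inter>e. \<Inter>p. {\<tau>. \<tau> (c *\<^sub>R e, p) = c * \<tau> (e, p)}) \<inter>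
    (\<Inter>e. \<Inter>p. \<Inter>q. {\<tau>. \<tau> (e, p + q) = \<tau> (e, p) + \<tau> (e, q)}) \<inter> (\<Inter>c. \<Inter>e. \<Inter>p. {\<tau>. \<tau> (e, c *\<^sub>R p) = c * \<tau> (e, p)})"
  let ?P = "(\<Inter>e\<in>Pos. \<Inter>p. {\<tau>. \<bar>2 * \<tau> (e, p) - norm e * blinfun_apply u p\<bar> \<le> norm e * norm p}) \<inter>
    (\<Inter>e\<in>Pos. \<Inter>p. {\<tau>. \<bar>2 * (blinfun_apply e p - \<tau> (e, p)) - norm e * blinfun_apply u p\<bar> \<le> norm e * norm p})"
  have "central_graphs = {\<tau>. \<forall>i. \<tau> i \<in> B i} \<inter> (?L \<inter> ?P)"
  proof (intro equalityI subsetI)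
    fix \<tau> assume "\<tau> \<in> central_graphs"
    then obtain T where T: "central T" and \<tau>: "\<And>e p. \<tau> (e, p) = blinfun_apply (T e) p"
      by (auto simp: central_graphs_def)
    have bd: "\<bar>blinfun_apply (T e) p\<bar> \<le> norm e * norm p" for e p
      using central_norm[OF T, of e] norm_blinfun_le_iff[of "norm e" "T e"] by simp
    have "\<tau> i \<in> B i" for i
    proof (cases i)
      case (Pair e p)
      then show ?thesis using bd[of e p] by (auto simp: B_def \<tau>)
    qed
    moreover have "\<tau> \<in> ?L"
      by (simp add: \<tau> central_add[OF T] central_scale[OF T] blinfun.add_left blinfun.scaleR_left
          blinfun.add_right blinfun.scaleR_right)
    moreover have "\<tau> \<in> ?P"
    proof -
      have "\<bar>2 * \<tau> (e, p) - norm e * blinfun_apply u p\<bar> \<le> norm e * norm p"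
        "\<bar>2 * (blinfun_apply e p - \<tau> (e, p)) - norm e * blinfun_apply u p\<bar> \<le> norm e * norm p" if e: "e \<in> Pos" for e p
      proof -
        have p: "0 \<le> \<Phi> (T e) x \<and> \<Phi> (T e) x \<le> \<Phi> e x" "\<Phi> e x \<le> norm e" if "x \<in> K" for x
          using central_pos[OF T _ that, of e] e Phi_le_norm[OF that, of e] by (auto simp: Pos_def)
        have 1: "\<forall>x\<in>K. 0 \<le> \<Phi> (T e) x \<and> \<Phi> (T e) x \<le> norm e" using p by fastforce
        have 2: "\<forall>x\<in>K. 0 \<le> \<Phi> (e - T e) x \<and> \<Phi> (e - T e) x \<le> norm e" using p by fastforce
        show "\<bar>2 * \<tau> (e, p) - norm e * blinfun_apply u p\<bar> \<le> norm e * norm p"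
          using 1 interval_iff[of "norm e" "T e"] by (simp add: \<tau>)
        show "\<bar>2 * (blinfun_apply e p - \<tau> (e, p)) - norm e * blinfun_apply u p\<bar> \<le> norm e * norm p"
          using 2 interval_iff[of "norm e" "e - T e"] by (simp add: \<tau> blinfun.diff_left)
      qed
      then show ?thesis by blast
    qed
    ultimately show "\<tau> \<in> {\<tau>. \<forall>i. \<tau> i \<in> B i} \<inter> (?L \<inter> ?P)" by blast
  next
    fix \<tau> assume \<tau>: "\<tau> \<in> {\<tau>. \<forall>i. \<tau> i \<in> B i} \<inter> (?L \<inter> ?P)"
    have \<tau>B: "\<tau> i \<in> B i" for i using IntD1[OF \<tau>] unfolding mem_Collect_eq by (rule spec)
    have \<tau>L: "\<tau> \<in> ?L" by (rule IntD1[OF IntD2[OF \<tau>]])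
    have \<tau>P: "\<tau> \<in> ?P" by (rule IntD2[OF IntD2[OF \<tau>]])
    have bd: "\<bar>\<tau> (e, p)\<bar> \<le> norm e * norm p" for e p using \<tau>B[of "(e, p)"] by (auto simp: B_def abs_le_iff)
    have lin: "\<tau> (e + f, p) = \<tau> (e, p) + \<tau> (f, p)" "\<tau> (c *\<^sub>R e, p) = c * \<tau> (e, p)"
        "\<tau> (e, p + q) = \<tau> (e, p) + \<tau> (e, q)" "\<tau> (e, c *\<^sub>R p) = c * \<tau> (e, p)" for e f p q c
      using \<tau>L by simp_all
    have "\<exists>f :: 'p \<Rightarrow>\<^sub>L real. blinfun_apply f = (\<lambda>p. \<tau> (e, p))" for e
      by (rule blinfun_of_linear[of _ "norm e"]) (simp_all add: lin bd)
    then obtain T :: "('p \<Rightarrow>\<^sub>L real) \<Rightarrow> ('p \<Rightarrow>\<^sub>L real)" where T: "\<And>e. blinfun_apply (T e) = (\<lambda>p. \<tau> (e, p))" by metis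
    have "central T"
      unfolding central_def
    proof (intro conjI allI impI)
      show "T (e + f) = T e + T f" for e f by (rule blinfun_eqI) (simp add: T lin blinfun.add_left)
      show "T (c *\<^sub>R e) = c *\<^sub>R T e" for c e by (rule blinfun_eqI) (simp add: T lin blinfun.scaleR_left)
      fix e assume e: "\<forall>x\<in>K. 0 \<le> \<Phi> e x"
      have "\<bar>2 * \<tau> (e, p) - norm e * blinfun_apply u p\<bar> \<le> norm e * norm p"
        "\<bar>2 * (blinfun_apply e p - \<tau> (e, p)) - norm e * blinfun_apply u p\<bar> \<le> norm e * norm p" for p
        using \<tau>P e unfolding Pos_def by simp_all
      then have "\<forall>x\<in>K. 0 \<le> \<Phi> (T e) x \<and> \<Phi> (T e) x \<le> norm e" "\<forall>x\<in>K. 0 \<le> \<Phi> (e - T e) x \<and> \<Phi> (e - T e) x \<le> norm e"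
        using interval_iff[of "norm e" "T e"] interval_iff[of "norm e" "e - T e"] by (simp_all add: T blinfun.diff_left)
      then show "\<forall>x\<in>K. 0 \<le> \<Phi> (T e) x \<and> \<Phi> (T e) x \<le> \<Phi> e x" by simp
    qed
    then show "\<tau> \<in> central_graphs" by (auto simp: central_graphs_def T)
  qed
  moreover have "compact ({\<tau>. \<forall>i. \<tau> i \<in> B i} \<inter> (?L \<inter> ?P))"
  proof (rule compact_Int_closed)
    show "compact {\<tau>. \<forall>i. \<tau> i \<in> B i}"
      by (rule compact_fun_product) (auto simp: B_def split: prod.splits)
    show "closed (?L \<inter> ?P)"
      by (intro closed_Int closed_INT ballI closed_Collect_eq closed_Collect_le continuous_intros)
  qed
  ultimately show ?thesis by simp
qed

text \<open>
  An extreme point \<open>e\<close> of the unit interval splits every element uniquely into a part dominated by a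
  multiple of \<open>e\<close> and a part dominated by a multiple of \<open>u - e\<close>.
\<close>

lemma central_projection:
  assumes interp: effects_interpolate and e: "e \<in> unit_interval"
    and ext: "\<And>d. e + d \<in> unit_interval \<Longrightarrow> e - d \<in> unit_interval \<Longrightarrow> d = 0"
  shows "\<exists>T. central T \<and> T u = e"
proof -
  have e01: "0 \<le> \<Phi> e x" "\<Phi> e x \<le> 1" if "x \<in> K" for x using e that by (auto simp: unit_interval_def)
  \<comment> \<open>The relation says that \<open>h\<close> is the part of \<open>g\<close> along
    \<open>e\<close>: it is dominated by a multiple of \<open>e\<close>, and the rest by a multiple
    of \<open>u - e\<close>. The factor \<open>c\<close> is left free to make the relation
    linear.\<close>
  define R where "R g h \<longleftrightarrow> (\<exists>c\<ge>0. \<forall>x\<in>K. \<bar>\<Phi> h x\<bar> \<le> c * \<Phi> e x \<and> \<bar>\<Phi> g x - \<Phi> h x\<bar> \<le> c * (1 - \<Phi> e x))" for g h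
  have R_add: "R (g + g') (h + h')" if hh: "R g h" "R g' h'" for g g' h h'
  proof -
    obtain c where c: "c \<ge> 0" "\<And>x. x \<in> K \<Longrightarrow> \<bar>\<Phi> h x\<bar> \<le> c * \<Phi> e x \<and> \<bar>\<Phi> g x - \<Phi> h x\<bar> \<le> c * (1 - \<Phi> e x)"
      using hh(1) unfolding R_def by blast
    obtain c' where c': "c' \<ge> 0" "\<And>x. x \<in> K \<Longrightarrow> \<bar>\<Phi> h' x\<bar> \<le> c' * \<Phi> e x \<and> \<bar>\<Phi> g' x - \<Phi> h' x\<bar> \<le> c' * (1 - \<Phi> e x)"
      using hh(2) unfolding R_def by blast
    show ?thesis unfolding R_def
    proof (intro exI[of _ "c + c'"] conjI ballI)
      fix x assume x: "x \<in> K"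
      have "(c + c') * \<Phi> e x = c * \<Phi> e x + c' * \<Phi> e x" by (simp add: distrib_right)
      then show "\<bar>\<Phi> (h + h') x\<bar> \<le> (c + c') * \<Phi> e x"
        unfolding Phi_add using c(2)[OF x] c'(2)[OF x] by linarith
      have "(c + c') * (1 - \<Phi> e x) = c * (1 - \<Phi> e x) + c' * (1 - \<Phi> e x)" by (simp add: distrib_right)
      then show "\<bar>\<Phi> (g + g') x - \<Phi> (h + h') x\<bar> \<le> (c + c') * (1 - \<Phi> e x)"
        unfolding Phi_add using c(2)[OF x] c'(2)[OF x] by linarith
    qed (use c c' in auto)
  qed
  have R_scale: "R (k *\<^sub>R g) (k *\<^sub>R h)" if hh: "R g h" for g h k
  proof -
    obtain c where c: "c \<ge> 0" "\<And>x. x \<in> K \<Longrightarrow> \<bar>\<Phi> h x\<bar> \<le> c * \<Phi> e x \<and> \<bar>\<Phi> g x - \<Phi> h x\<bar> \<le> c * (1 - \<Phi> e x)"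
      using hh unfolding R_def by blast
    show ?thesis unfolding R_def
    proof (intro exI[of _ "\<bar>k\<bar> * c"] conjI ballI)
      fix x assume x: "x \<in> K"
      show "\<bar>\<Phi> (k *\<^sub>R h) x\<bar> \<le> \<bar>k\<bar> * c * \<Phi> e x"
        using c(2)[OF x] by (simp add: abs_mult mult.assoc mult_left_mono)
      have "\<bar>k * (\<Phi> g x - \<Phi> h x)\<bar> \<le> \<bar>k\<bar> * (c * (1 - \<Phi> e x))"
        unfolding abs_mult using c(2)[OF x] by (intro mult_left_mono) auto
      then show "\<bar>\<Phi> (k *\<^sub>R g) x - \<Phi> (k *\<^sub>R h) x\<bar> \<le> \<bar>k\<bar> * c * (1 - \<Phi> e x)"
        by (simp add: right_diff_distrib mult.assoc)
    qed (use c in auto)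
  qed
  \<comment> \<open>Such a \<open>d\<close> is dominated by multiples of both \<open>e\<close> and
    \<open>u - e\<close>, so a small multiple of it can be added to and subtracted from
    \<open>e\<close> within the unit interval.\<close>
  have R_zero: "d = 0" if dd: "R 0 d" for d
  proof -
    obtain c where c: "c \<ge> 0" "\<And>x. x \<in> K \<Longrightarrow> \<bar>\<Phi> d x\<bar> \<le> c * \<Phi> e x \<and> \<bar>\<Phi> d x\<bar> \<le> c * (1 - \<Phi> e x)"
      using dd unfolding R_def by auto
    show ?thesis
    proof (cases "c = 0")
      case True
      then show ?thesis using c(2) by (intro Phi_eqI) simp
    next
      case False
      then have c0: "c > 0" using c by simp
      define d' where "d' = (1 / c) *\<^sub>R d"
      have d': "\<bar>\<Phi> d' x\<bar> \<le> \<Phi> e x" "\<bar>\<Phi> d' x\<bar> \<le> 1 - \<Phi> e x" if "x \<in> K" for x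
        using c(2)[OF that] c0 by (auto simp: d'_def abs_mult field_simps)
      have "e + d' \<in> unit_interval" "e - d' \<in> unit_interval"
        using d' by (fastforce simp: unit_interval_def abs_le_iff)+
      then have "d' = 0" by (rule ext)
      then show ?thesis using c0 by (simp add: d'_def)
    qed
  qed
  have R_unique: "h = h'" if hh: "R g h" "R g h'" for g h h'
  proof -
    have "R (g + (-1) *\<^sub>R g) (h + (-1) *\<^sub>R h')" by (rule R_add[OF hh(1) R_scale[OF hh(2)]])
    then have "h + (-1) *\<^sub>R h' = 0" by (intro R_zero) simp
    then show ?thesis by simp
  qed
  \<comment> \<open>Here compatibility enters: the interpolant of \<open>e\<close> and
    \<open>g\<close> is the wanted part, with \<open>c = 1\<close>.\<close>
  have R_effect: "\<exists>h. R g h \<and> (\<forall>x\<in>K. 0 \<le> \<Phi> h x \<and> \<Phi> h x \<le> \<Phi> g x)" if g: "g \<in> unit_interval" for g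
  proof -
    have "\<Phi> e \<in> effects" "\<Phi> g \<in> effects" using e g Phi_A by (auto simp: effects_def unit_interval_def)
    then obtain f where f: "f \<in> A"
        "\<And>x. x \<in> K \<Longrightarrow> 0 \<le> f x \<and> \<Phi> e x + \<Phi> g x - 1 \<le> f x \<and> f x \<le> \<Phi> e x \<and> f x \<le> \<Phi> g x"
      using interp unfolding effects_interpolate_def by blast
    obtain h where h: "\<Phi> h = f" using Phi_surj[OF f(1)] by blast
    have "R g h" unfolding R_def
    proof (intro exI[of _ 1] conjI ballI)
      fix x assume "x \<in> K"
      from f(2)[OF this] show "\<bar>\<Phi> h x\<bar> \<le> 1 * \<Phi> e x" "\<bar>\<Phi> g x - \<Phi> h x\<bar> \<le> 1 * (1 - \<Phi> e x)" by (auto simp: h)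
    qed simp
    then show ?thesis using f(2) h by auto
  qed
  have R_u: "R u e" unfolding R_def using e01 by (intro exI[of _ 1]) simp
  have R_total: "\<exists>h. R g h" for g
  proof -
    \<comment> \<open>Shifting and scaling carries \<open>g\<close> into the unit interval, and
      linearity of \<open>R\<close> undoes both; the \<open>+ 1\<close> keeps the scale positive for
      \<open>g = 0\<close>.\<close>
    define n where "n = norm g + 1"
    have n: "n > 0" "norm g \<le> n" by (simp_all add: n_def add_nonneg_pos)
    define g' where "g' = (1 / (2 * n)) *\<^sub>R (g + n *\<^sub>R u)"
    obtain h where "R g' h" using R_effect normalize[OF n(2,1)] unfolding g'_def by blast
    then have "R ((2 * n) *\<^sub>R g' + (- n) *\<^sub>R u) ((2 * n) *\<^sub>R h + (- n) *\<^sub>R e)"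
      by (intro R_add R_scale R_u)
    moreover have "(2 * n) *\<^sub>R g' + (- n) *\<^sub>R u = g" using n by (simp add: g'_def)
    ultimately show ?thesis by auto
  qed
  then obtain T where T: "\<And>g. R g (T g)" by metis
  have T_eq: "T g = h" if "R g h" for g h using R_unique[OF T that] .
  have "central T"
    unfolding central_def
  proof (intro conjI allI impI)
    show "T (g + h) = T g + T h" for g h by (intro T_eq R_add T)
    show sc: "T (c *\<^sub>R g) = c *\<^sub>R T g" for c g by (intro T_eq R_scale T)
    fix g assume g: "\<forall>x\<in>K. 0 \<le> \<Phi> g x"
    define n where "n = norm g + 1"
    have n: "n > 0" by (simp add: n_def add_nonneg_pos)
    have gn: "\<Phi> g x \<le> n" if "x \<in> K" for x using Phi_le_norm[OF that, of g] by (simp add: n_def)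
    have "(1 / n) *\<^sub>R g \<in> unit_interval" using g gn n by (simp add: unit_interval_def)
    then obtain h where h: "R ((1 / n) *\<^sub>R g) h" "\<forall>x\<in>K. 0 \<le> \<Phi> h x \<and> \<Phi> h x \<le> \<Phi> ((1 / n) *\<^sub>R g) x"
      using R_effect by blast
    have "T g = n *\<^sub>R h" using R_scale[OF h(1), of n] n by (intro T_eq) simp
    then show "\<forall>x\<in>K. 0 \<le> \<Phi> (T g) x \<and> \<Phi> (T g) x \<le> \<Phi> g x" using h(2) n by (simp add: field_simps)
  qed
  moreover have "T u = e" by (rule T_eq[OF R_u])
  ultimately show ?thesis by blast
qed

text \<open>The effects that maximise the coordinate \<open>q\<close> form a closed face, and an
  extremal point of that face is extremal in the whole interval. Maximality at \<open>q\<close> is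
  what makes extreme effects sufficient for separation.\<close>

lemma extreme_effect_exists:
  shows "\<exists>e\<in>unit_interval. (\<forall>g\<in>unit_interval. blinfun_apply g q \<le> blinfun_apply e q) \<and>
    (\<forall>d. e + d \<in> unit_interval \<longrightarrow> e - d \<in> unit_interval \<longrightarrow> d = 0)"
proof -
  let ?W = "blinfun_apply ` unit_interval"
  have "0 \<in> unit_interval" by (simp add: unit_interval_def)
  then have "?W \<noteq> {}" by blast
  have cont: "continuous_on ?W (\<lambda>w. w q)" for q by (intro continuous_intros)
  obtain m where m: "m \<in> ?W" "\<And>w. w \<in> ?W \<Longrightarrow> w q \<le> m q"
    using continuous_attains_sup[OF compact_unit_interval \<open>?W \<noteq> {}\<close> cont[of q]] by blast
  let ?C = "{w \<in> ?W. w q = m q}"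
  \<comment> \<open>Midpoints suffice, since extremality is only tested on \<open>e + d\<close> and
    \<open>e - d\<close>.\<close>
  define btw where "btw w v v' \<longleftrightarrow> (\<forall>p. w p = (v p + v' p) / (2::real))" for w v v' :: "'p \<Rightarrow> real"
  have "\<exists>w\<in>?C. \<forall>v\<in>?W. \<forall>v'\<in>?W. btw w v v' \<longrightarrow> v = w \<and> v' = w"
  proof (rule extremal_point_exists[where F = "range (\<lambda>p w. w p)", OF compact_unit_interval])
    show "continuous_on ?W f" if "f \<in> range (\<lambda>p w. w p)" for f using that cont by auto
    show "\<exists>t>0. t < 1 \<and> f w = (1 - t) * f v + t * f v'"
      if "f \<in> range (\<lambda>p w. w p)" "btw w v v'" for f w v v'
      using that by (intro exI[of _ "1/2"]) (auto simp: btw_def field_simps)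
    show "\<exists>f\<in>range (\<lambda>p w. w p). f v \<noteq> f w" if "v \<noteq> w" for v w :: "'p \<Rightarrow> real"
      using that by (auto simp: fun_eq_iff)
    show "closedin (top_of_set ?W) ?C"
      by (rule continuous_closedin_preimage_constant[OF cont])
    show "?C \<noteq> {}" using m(1) by blast
    show "v \<in> ?C \<and> v' \<in> ?C" if "w \<in> ?C" "v \<in> ?W" "v' \<in> ?W" "btw w v v'" for w v v'
    proof -
      have "v q \<le> m q" "v' q \<le> m q" using m(2) that by auto
      moreover have "w q = m q" using that(1) by blast
      moreover have "w q = (v q + v' q) / 2" using that(4) unfolding btw_def by blast
      ultimately have "v q = m q" "v' q = m q" by (auto simp: field_simps)
      then show ?thesis using that by simp
    qed
  qed
  then obtain w where w: "w \<in> ?C" and wext: "\<And>v v'. v \<in> ?W \<Longrightarrow> v' \<in> ?W \<Longrightarrow> btw w v v' \<Longrightarrow> v = w \<and> v' = w"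
    by blast
  obtain e where e: "e \<in> unit_interval" "w = blinfun_apply e" using w by blast
  have "blinfun_apply g q \<le> blinfun_apply e q" if "g \<in> unit_interval" for g
    using m(2)[of "blinfun_apply g"] that w e by auto
  moreover have "d = 0" if "e + d \<in> unit_interval" "e - d \<in> unit_interval" for d
  proof -
    have "btw w (blinfun_apply (e + d)) (blinfun_apply (e - d))"
      by (simp add: btw_def e blinfun.add_left blinfun.diff_left)
    then have "blinfun_apply (e + d) = blinfun_apply e" using wext that e by blast
    then show ?thesis by (simp add: blinfun_apply_inject)
  qed
  ultimately show ?thesis using e(1) by blast
qed

text \<open>The values at \<open>u\<close> of the central operators form a compact convex set. By
  \<open>central_projection\<close> it contains, for each \<open>q\<close> in the predual, an
  extreme effect that maximises \<open>q\<close>, so no effect can be separated from it.\<close>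

lemma central_with_value:
  assumes interp: effects_interpolate and g: "g \<in> unit_interval"
  shows "\<exists>T. central T \<and> T u = g"
proof -
  define M where "M = (\<lambda>\<tau> p. \<tau> (u, p)) ` central_graphs"
  have MI: "blinfun_apply (T u) \<in> M" if "central T" for T
    unfolding M_def central_graphs_def using that
    by (intro image_eqI[of _ _ "\<lambda>(e, p). blinfun_apply (T e) p"]) auto
  have ME: "\<exists>T. central T \<and> s = blinfun_apply (T u)" if "s \<in> M" for s
    using that by (auto simp: M_def central_graphs_def)
  have "\<exists>s\<in>M. \<forall>p\<in>UNIV. s p = blinfun_apply g p"
  proof (rule compact_convex_product_mem)
    show "compact M"
      unfolding M_def
      by (intro compact_continuous_image compact_central_graphs continuous_on_coordinatewise_then_product continuous_intros)
    have "central (\<lambda>e. 0)" by (simp add: central_def)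
    then show "M \<noteq> {}" using MI by blast
    show "(\<lambda>p. (1 - c) * s p + c * t p) \<in> M" if st: "s \<in> M" "t \<in> M" and c: "0 \<le> c" "c \<le> 1" for s t c
    proof -
      obtain T where T: "central T" "s = blinfun_apply (T u)" using ME[OF st(1)] by blast
      obtain T' where T': "central T'" "t = blinfun_apply (T' u)" using ME[OF st(2)] by blast
      define S where "S e = (1 - c) *\<^sub>R T e + c *\<^sub>R T' e" for e
      have "central S"
        unfolding central_def
      proof (intro conjI allI impI ballI)
        show "S (e + f) = S e + S f" for e f
          by (simp add: S_def central_add[OF T(1)] central_add[OF T'(1)] scaleR_add_right)
        show "S (k *\<^sub>R e) = k *\<^sub>R S e" for k e
          by (simp add: S_def central_scale[OF T(1)] central_scale[OF T'(1)] scaleR_add_right mult.commute)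
        fix e x assume e: "\<forall>x\<in>K. 0 \<le> \<Phi> e x" and x: "x \<in> K"
        have p: "0 \<le> \<Phi> (T e) x \<and> \<Phi> (T e) x \<le> \<Phi> e x" "0 \<le> \<Phi> (T' e) x \<and> \<Phi> (T' e) x \<le> \<Phi> e x"
          using central_pos[OF T(1) _ x, of e] central_pos[OF T'(1) _ x, of e] e by auto
        show "0 \<le> \<Phi> (S e) x" using p c by (simp add: S_def)
        have "\<Phi> (S e) x \<le> (1 - c) * \<Phi> e x + c * \<Phi> e x"
          unfolding S_def Phi_add Phi_scale using p c by (intro add_mono mult_left_mono) auto
        then show "\<Phi> (S e) x \<le> \<Phi> e x" by (simp add: algebra_simps)
      qed
      moreover have "blinfun_apply (S u) = (\<lambda>p. (1 - c) * s p + c * t p)"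
        by (auto simp: S_def T T' blinfun.add_left blinfun.scaleR_left)
      ultimately show ?thesis using MI[of S] by simp
    qed
    show "\<exists>s\<in>M. (\<Sum>p\<in>F. c p * blinfun_apply g p) \<le> (\<Sum>p\<in>F. c p * s p)" if "finite F" "F \<subseteq> UNIV" for F c
    proof -
      \<comment> \<open>A finite combination of coordinates is itself one coordinate, at this
        element of the predual.\<close>
      define q where "q = (\<Sum>p\<in>F. c p *\<^sub>R p)"
      have q: "(\<Sum>p\<in>F. c p * blinfun_apply f p) = blinfun_apply f q" for f :: "'p \<Rightarrow>\<^sub>L real"
        by (simp add: q_def blinfun.sum_right blinfun.scaleR_right)
      obtain e where e: "e \<in> unit_interval" "\<And>g. g \<in> unit_interval \<Longrightarrow> blinfun_apply g q \<le> blinfun_apply e q"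
          "\<And>d. e + d \<in> unit_interval \<Longrightarrow> e - d \<in> unit_interval \<Longrightarrow> d = 0"
        using extreme_effect_exists[of q] by auto
      obtain T where T: "central T" "T u = e" using central_projection[OF interp e(1) e(3)] by blast
      have "blinfun_apply e \<in> M" using MI[OF T(1)] T(2) by simp
      then show ?thesis using e(2)[OF g] by (intro bexI[of _ "blinfun_apply e"]) (simp_all add: q)
    qed
  qed
  then obtain s where s: "s \<in> M" "\<And>p. s p = blinfun_apply g p" by auto
  then obtain T where "central T" "blinfun_apply (T u) = blinfun_apply g" using ME[OF s(1)] by force
  then show ?thesis by (auto simp: blinfun_apply_inject)
qed

text \<open>Applying \<open>T\<close> and evaluating at \<open>x\<close> gives a functional between
  0 and evaluation at \<open>x\<close> on the positive cone, so
  \<open>functional_below_extreme\<close> applies; inverting \<open>\<Phi>\<close> transports it to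
  \<open>A\<close>.\<close>

lemma central_on_extreme:
  assumes T: "central T" and x: "x \<in> X"
  shows "\<Phi> (T a) x = \<Phi> (T u) x * \<Phi> a x"
proof -
  define J where "J f = (SOME e. \<Phi> e = f)" for f
  have J: "\<Phi> (J f) = f" if "f \<in> A" for f unfolding J_def using Phi_surj[OF that] by (rule someI_ex)
  have Jeq: "J (\<Phi> e) = e" for e using J[OF Phi_A[of e]] by (intro Phi_eqI) simp
  have xK: "x \<in> K" using x X_subset by blast
  have "\<Phi> (T (J (\<Phi> a))) x = \<Phi> (T (J unit)) x * \<Phi> a x"
  proof (rule functional_below_extreme[OF x _ _ _ Phi_A])
    show "linear_functional_on A (\<lambda>f. \<Phi> (T (J f)) x)"
      unfolding linear_functional_on_def
    proof (intro conjI ballI allI)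
      show "\<Phi> (T (J (\<lambda>x. f x + g x))) x = \<Phi> (T (J f)) x + \<Phi> (T (J g)) x" if "f \<in> A" "g \<in> A" for f g
      proof -
        have "J (\<lambda>x. f x + g x) = J f + J g"
          by (rule Phi_eqI) (simp add: J[OF A_add[OF that]] J[OF that(1)] J[OF that(2)])
        then show ?thesis by (simp add: central_add[OF T])
      qed
      show "\<Phi> (T (J (\<lambda>x. c * f x))) x = c * \<Phi> (T (J f)) x" if "f \<in> A" for c f
      proof -
        have "J (\<lambda>x. c * f x) = c *\<^sub>R J f"
          by (rule Phi_eqI) (simp add: J[OF A_scale[OF that]] J[OF that])
        then show ?thesis by (simp add: central_scale[OF T])
      qed
    qed
    fix f assume "f \<in> A_pos K"
    then have f: "f \<in> A" "\<And>x. x \<in> K \<Longrightarrow> 0 \<le> f x" by (auto simp: A_pos_def)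
    have "0 \<le> \<Phi> (T (J f)) x \<and> \<Phi> (T (J f)) x \<le> \<Phi> (J f) x"
      by (rule central_pos[OF T _ xK]) (simp add: J[OF f(1)] f(2))
    then show "0 \<le> \<Phi> (T (J f)) x" "\<Phi> (T (J f)) x \<le> f x" by (auto simp: J[OF f(1)])
  qed
  moreover have "J unit = u" using Jeq[of u] by (simp add: Phi_u)
  ultimately show ?thesis by (simp add: Jeq)
qed

text \<open>The element behind \<open>g\<close> is moved into the unit interval and realised as the
  value at \<open>u\<close> of a central \<open>T\<close>. Undoing the shift and scaling,
  \<open>2 n T - n\<close> multiplies by \<open>g\<close> on \<open>X\<close>.\<close>

lemma product_on_extreme:
  assumes interp: effects_interpolate and f: "f \<in> A" and g: "g \<in> A"
  shows "\<exists>m\<in>A. \<forall>x\<in>X. m x = f x * g x"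
proof -
  obtain a b where a: "\<Phi> a = f" and b: "\<Phi> b = g" using Phi_surj f g by blast
  define n where "n = norm b + 1"
  have n: "n > 0" "norm b \<le> n" by (simp_all add: n_def add_nonneg_pos)
  define b' where "b' = (1 / (2 * n)) *\<^sub>R (b + n *\<^sub>R u)"
  obtain T where T: "central T" "T u = b'"
    using central_with_value[OF interp normalize[OF n(2,1)]] unfolding b'_def by blast
  have "\<Phi> ((2 * n) *\<^sub>R T a - n *\<^sub>R a) x = f x * g x" if x: "x \<in> X" for x
  proof -
    have xK: "x \<in> K" using x X_subset by blast
    have "\<Phi> (T a) x = \<Phi> b' x * f x" using central_on_extreme[OF T(1) x, of a] T(2) a by simp
    moreover have "\<Phi> b' x = (g x + n) / (2 * n)" using xK by (simp add: b'_def b)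
    ultimately show ?thesis using n by (simp add: a field_simps)
  qed
  then show ?thesis using Phi_A by blast
qed

end

subsection \<open>Continuous functions on the extreme boundary\<close>

context predual_state_space
begin

text \<open>Let \<open>m\<close> be affine with \<open>m = f * f\<close> on \<open>X\<close>.
  Continuity extends the equality to the closure, while \<open>f * f \<le> m\<close> on all of K. A
  point of the closure inside a segment whose ends \<open>f\<close> separates would contradict
  strict convexity of the square.\<close>

lemma compact_extreme_points:
  assumes interp: effects_interpolate
  shows "compact X"
proof -
  have "closed K" by (rule compact_imp_closed[OF compact_K])
  then have clK: "closure X \<subseteq> K" using X_subset by (rule closure_minimal[rotated])
  have "x \<in> X" if x: "x \<in> closure X" for x
  proof -
    have xK: "x \<in> K" using x clK by blast
    have "x \<notin> open_segment y z" if yz: "y \<in> K" "z \<in> K" for y z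
    proof
      assume "x \<in> open_segment y z"
      then obtain t where t: "y \<noteq> z" "0 < t" "t < 1" "x = (1 - t) *\<^sub>R y + t *\<^sub>R z"
        by (auto simp: in_segment)
      obtain f where f: "f \<in> A" "f y \<noteq> f z" using A_separates[OF yz t(1)] by blast
      obtain m where m: "m \<in> A" "\<And>x. x \<in> X \<Longrightarrow> m x = f x * f x"
        using product_on_extreme[OF interp f(1) f(1)] by blast
      have "continuous_on (closure X) (\<lambda>x. m x - f x * f x)"
        by (intro continuous_intros A_continuous_subset[OF _ clK] m f)
      from continuous_constant_on_closure[OF this _ x, of 0] m(2)
      have mx: "m x = f x * f x" by simp
      \<comment> \<open>The affine function \<open>2 f(w) f - f(w) f(w)\<close> is tangent to the
        square at \<open>w\<close>. It lies below \<open>f * f = m\<close> on \<open>X\<close>,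
        hence below \<open>m\<close> on K.\<close>
      have mge: "f w * f w \<le> m w" if w: "w \<in> K" for w
      proof -
        have "2 * f w * f w - (f w * f w) * unit w \<le> m w"
        proof (rule A_le_on_extreme[of "\<lambda>y. 2 * f w * f y - (f w * f w) * unit y", OF _ m(1) _ w])
          show "(\<lambda>y. 2 * f w * f y - (f w * f w) * unit y) \<in> A" by (intro A_diff A_scale f unit_A)
          show "2 * f w * f v - (f w * f w) * unit v \<le> m v" if "v \<in> X" for v
          proof -
            have "v \<in> K" using that X_subset by blast
            moreover have "0 \<le> (f w - f v)\<^sup>2" by simp
            ultimately show ?thesis using m(2)[OF that] by (simp add: power2_eq_square algebra_simps)
          qed
        qed
        then show ?thesis using w by simp
      qed
      have fx: "f x = (1 - t) * f y + t * f z" and mx': "m x = (1 - t) * m y + t * m z"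
        using A_affine[OF f(1) yz, of "1 - t" t] A_affine[OF m(1) yz, of "1 - t" t] t by auto
      have "(1 - t) * (f y * f y) + t * (f z * f z) \<le> (1 - t) * m y + t * m z"
        using mge yz t by (intro add_mono mult_left_mono) auto
      also have "\<dots> = f x * f x" using mx mx' by simp
      finally have "(1 - t) * t * (f y - f z)\<^sup>2 \<le> 0"
        by (simp add: fx power2_eq_square algebra_simps)
      moreover have "0 < (1 - t) * t * (f y - f z)\<^sup>2" using t f by simp
      ultimately show False by simp
    qed
    then show ?thesis using xK by (simp add: extreme_point_of_def)
  qed
  then have "closed X" using closure_subset[of X] by (metis closed_closure subsetI subset_antisym)
  moreover have "X = K \<inter> X" using X_subset by blast
  ultimately show ?thesis using compact_Int_closed[OF compact_K] by metis
qed

lemma bound_on_extreme: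
  assumes "\<And>x. x \<in> X \<Longrightarrow> \<bar>\<Phi> e x\<bar> \<le> c"
  shows "norm e \<le> c"
  unfolding norm_le_iff
proof
  fix x assume x: "x \<in> K"
  have c: "(\<lambda>y. c * unit y) \<in> A" "(\<lambda>y. (- c) * unit y) \<in> A" by (rule A_scale[OF unit_A])+
  have XK: "y \<in> K" if "y \<in> X" for y using that X_subset by blast
  have "\<Phi> e x \<le> c * unit x"
    by (rule A_le_on_extreme[OF Phi_A c(1) _ x]) (use assms XK in \<open>auto simp: abs_le_iff\<close>)
  moreover have "(- c) * unit x \<le> \<Phi> e x"
    by (rule A_le_on_extreme[OF c(2) Phi_A _ x]) (use assms XK in \<open>force simp: abs_le_iff\<close>)
  ultimately show "\<bar>\<Phi> e x\<bar> \<le> c" using x by (simp add: abs_le_iff)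
qed

text \<open>Boundary values of \<open>A\<close> form a ring by \<open>product_on_extreme\<close>,
  hence are dense. The norm of an affine function is controlled by its values on \<open>X\<close>,
  so uniform approximants on \<open>X\<close> form a Cauchy sequence in the dual of the predual,
  whose completeness yields the extension.\<close>

lemma extension_from_extreme:
  assumes interp: effects_interpolate and \<psi>: "continuous_on X \<psi>"
  shows "\<exists>h\<in>A. \<forall>x\<in>X. h x = \<psi> x"
proof -
  define R where "R = {f :: 'a \<Rightarrow> real. \<exists>g\<in>A. \<forall>x\<in>X. f x = g x}"
  have XK: "y \<in> K" if "y \<in> X" for y using that X_subset by blast
  interpret function_ring_on R X
  proof
    show "compact X" by (rule compact_extreme_points[OF interp])
    show "continuous_on X f" if "f \<in> R" for f
    proof -
      obtain g where g: "g \<in> A" "\<And>x. x \<in> X \<Longrightarrow> f x = g x" using \<open>f \<in> R\<close> unfolding R_def by blast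
      have "continuous_on X g" by (rule A_continuous_subset[OF g(1) X_subset])
      then show ?thesis by (rule continuous_on_eq) (simp add: g(2))
    qed
    show "(\<lambda>x. f x + g x) \<in> R" "(\<lambda>x. f x * g x) \<in> R" if fg: "f \<in> R" "g \<in> R" for f g
    proof -
      obtain f' where f': "f' \<in> A" "\<And>x. x \<in> X \<Longrightarrow> f x = f' x" using fg(1) unfolding R_def by blast
      obtain g' where g': "g' \<in> A" "\<And>x. x \<in> X \<Longrightarrow> g x = g' x" using fg(2) unfolding R_def by blast
      show "(\<lambda>x. f x + g x) \<in> R" unfolding R_def using A_add[OF f'(1) g'(1)] f'(2) g'(2) by force
      obtain m where "m \<in> A" "\<forall>x\<in>X. m x = f' x * g' x" using product_on_extreme[OF interp f'(1) g'(1)] by blast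
      then show "(\<lambda>x. f x * g x) \<in> R" unfolding R_def using f'(2) g'(2) by (intro CollectI bexI[of _ m]) auto
    qed
    show "(\<lambda>_. c) \<in> R" for c
      unfolding R_def using A_scale[OF unit_A, of c] XK by (intro CollectI bexI[of _ "\<lambda>x. c * unit x"]) auto
    show "\<exists>f\<in>R. f x \<noteq> f y" if xy: "x \<in> X" "y \<in> X" "x \<noteq> y" for x y
    proof -
      obtain f where "f \<in> A" "f x \<noteq> f y" using A_separates[OF XK[OF xy(1)] XK[OF xy(2)] xy(3)] by blast
      then show ?thesis unfolding R_def by blast
    qed
  qed
  have "\<exists>e. \<forall>x\<in>X. \<bar>\<psi> x - \<Phi> e x\<bar> < 1 / Suc n" for n
  proof -
    obtain f where f: "f \<in> R" "\<forall>x\<in>X. \<bar>\<psi> x - f x\<bar> < 1 / Suc n"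
      using Stone_Weierstrass_basic[OF \<psi>, of "1 / Suc n"] by auto
    then obtain g where g: "g \<in> A" "\<And>x. x \<in> X \<Longrightarrow> f x = g x" unfolding R_def by blast
    obtain e where "\<Phi> e = g" using Phi_surj[OF g(1)] by blast
    then show ?thesis using f(2) g(2) by (intro exI[of _ e]) auto
  qed
  then obtain e where e: "\<And>n x. x \<in> X \<Longrightarrow> \<bar>\<psi> x - \<Phi> (e n) x\<bar> < 1 / Suc n" by metis
  have "Cauchy e"
  proof (rule CauchyI)
    fix r :: real assume r: "0 < r"
    obtain M :: nat where M: "1 / Suc M < r / 2" using nat_approx_posE[of "r / 2"] r by auto
    show "\<exists>M. \<forall>m\<ge>M. \<forall>n\<ge>M. norm (e m - e n) < r"
    proof (intro exI[of _ M] allI impI)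
      fix m n assume mn: "M \<le> m" "M \<le> n"
      have le: "1 / real (Suc k) \<le> 1 / Suc M" if "M \<le> k" for k using that by (intro divide_left_mono) auto
      have "norm (e m - e n) \<le> 1 / Suc M + 1 / Suc M"
      proof (rule bound_on_extreme)
        fix x assume x: "x \<in> X"
        show "\<bar>\<Phi> (e m - e n) x\<bar> \<le> 1 / Suc M + 1 / Suc M"
          unfolding Phi_diff using e[OF x, of m] e[OF x, of n] le[OF mn(1)] le[OF mn(2)] by linarith
      qed
      also have "\<dots> < r" using M by simp
      finally show "norm (e m - e n) < r" .
    qed
  qed
  then obtain l where l: "e \<longlonglongrightarrow> l" using Cauchy_convergent convergent_def by blast
  have "\<Phi> l x = \<psi> x" if x: "x \<in> X" for x
  proof (rule LIMSEQ_unique)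
    have "(\<lambda>n. norm (e n - l)) \<longlonglongrightarrow> 0" using l by (simp add: tendsto_norm_zero_iff LIM_zero)
    then have "(\<lambda>n. \<Phi> (e n) x - \<Phi> l x) \<longlonglongrightarrow> 0"
      by (rule Lim_null_comparison[rotated]) (use Phi_le_norm[OF XK[OF x], of "e _ - l"] in auto)
    then show "(\<lambda>n. \<Phi> (e n) x) \<longlonglongrightarrow> \<Phi> l x" by (simp add: LIM_zero_iff)
    have "(\<lambda>n. \<Phi> (e n) x - \<psi> x) \<longlonglongrightarrow> 0"
      by (rule Lim_null_comparison[OF _ LIMSEQ_inverse_real_of_nat])
        (use e[OF x] in \<open>auto simp: abs_minus_commute inverse_eq_divide intro!: always_eventually less_imp_le\<close>)
    then show "(\<lambda>n. \<Phi> (e n) x) \<longlonglongrightarrow> \<psi> x" by (simp add: LIM_zero_iff)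
  qed
  then show ?thesis using Phi_A by blast
qed

text \<open>Each convex \<open>\<phi>\<close> lies below the affine \<open>h\<close> with the same
  values on \<open>X\<close>. A boundary measure with barycenter \<open>x\<close> therefore
  integrates \<open>\<phi>\<close> to at most \<open>h x\<close>, which is its integral over a
  measure \<open>\<nu>\<close> carried by \<open>X\<close>; maximality makes the two measures
  equal.\<close>

lemma interpolate_imp_Bauer:
  assumes interp: effects_interpolate
  shows "Bauer_simplex K"
  unfolding Bauer_simplex_def
proof (intro conjI ballI)
  show X: "compact X" by (rule compact_extreme_points[OF interp])
  fix x assume x: "x \<in> K"
  have z: "(\<lambda>_. 0) \<in> A" by (rule function_space_zero[OF function_space_A])
  \<comment> \<open>Prescribing the value 0 at the zero function is only a way to obtain some state
    on \<open>X\<close> that represents \<open>x\<close>.\<close>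
  have "\<exists>\<Lambda>. state_on X \<Lambda> \<and> (\<forall>f\<in>A. \<Lambda> f = f x) \<and> \<Lambda> (\<lambda>_. 0) = 0"
    by (rule evaluation_extends[OF X order_refl X_subset x])
      (use A_le_on_extreme[OF z _ _ x] A_le_on_extreme[OF _ z _ x] in auto)
  then obtain \<Lambda> where L: "state_on X \<Lambda>" "\<And>f. f \<in> A \<Longrightarrow> \<Lambda> f = f x" by blast
  obtain \<nu> where \<nu>: "boundary_measure K \<nu>" "is_barycenter K x \<nu>" "AE y in \<nu>. y \<in> X" "radon_prob K \<nu>"
    using boundary_measure_of_state[OF X L(1) x L(2)] by metis
  show "\<exists>!\<mu>. boundary_measure K \<mu> \<and> is_barycenter K x \<mu>"
  proof (rule ex1I[of _ \<nu>])
    show "boundary_measure K \<nu> \<and> is_barycenter K x \<nu>" using \<nu> by blast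
    fix \<mu> assume \<mu>: "boundary_measure K \<mu> \<and> is_barycenter K x \<mu>"
    then have r: "radon_prob K \<mu>" by (simp add: boundary_measure_def)
    have "choquet_le K \<mu> \<nu>"
      unfolding choquet_le_def
    proof (intro allI impI)
      fix \<phi> :: "'a \<Rightarrow> real" assume "continuous_on K \<phi> \<and> convex_on K \<phi>"
      then have \<phi>: "continuous_on K \<phi>" "convex_on K \<phi>" by auto
      obtain h where h: "h \<in> A" "\<And>x. x \<in> X \<Longrightarrow> h x = \<phi> x"
        using extension_from_extreme[OF interp continuous_on_subset[OF \<phi>(1) X_subset]] by blast
      have hc: "continuous_on K h" by (rule A_continuous[OF h(1)])
      have m: "(\<lambda>y. (-1) * h y) \<in> A" by (rule A_scale[OF h(1)])
      have "\<phi> y + (-1) * h y \<le> 0" if "y \<in> K" for y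
      proof (rule convex_le_on_extreme[of "\<lambda>y. \<phi> y + (-1) * h y", OF _ _ _ that])
        show "continuous_on K (\<lambda>y. \<phi> y + (-1) * h y)" by (intro continuous_intros \<phi> hc)
        show "convex_on K (\<lambda>y. \<phi> y + (-1) * h y)" by (rule convex_on_add[OF \<phi>(2) A_convex_on[OF m]])
        show "\<phi> y + (-1) * h y \<le> 0" if "y \<in> X" for y using h(2)[OF that] by simp
      qed
      then have le: "\<phi> y \<le> h y" if "y \<in> K" for y using that by force
      have "(\<integral>y. \<phi> y \<partial>\<mu>) \<le> (\<integral>y. h y \<partial>\<mu>)"
        by (intro integral_mono radon_integrable[OF compact_K r] \<phi> hc) (use le radon_space[OF r] in auto)
      also have "\<dots> = h x" using \<mu> h(1) by (simp add: is_barycenter_def)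
      also have "\<dots> = (\<integral>y. h y \<partial>\<nu>)" using \<nu>(2) h(1) by (simp add: is_barycenter_def)
      also have "\<dots> = (\<integral>y. \<phi> y \<partial>\<nu>)"
      proof (rule integral_cong_AE)
        show "h \<in> borel_measurable \<nu>" "\<phi> \<in> borel_measurable \<nu>"
          using radon_integrable[OF compact_K \<nu>(4)] hc \<phi>(1) by (auto intro: borel_measurable_integrable)
        show "AE y in \<nu>. h y = \<phi> y" using \<nu>(3) by (rule eventually_mono) (rule h(2))
      qed
      finally show "(\<integral>y. \<phi> y \<partial>\<mu>) \<le> (\<integral>y. \<phi> y \<partial>\<nu>)" .
    qed
    then have "\<nu> = \<mu>" using \<mu> \<nu>(4) unfolding boundary_measure_def by blast
    then show "\<mu> = \<nu>" by simp
  qed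
qed

text \<open>The part \<open>h\<close> extends the boundary values of the minimum of \<open>g\<close>
  and \<open>f\<close>; all inequalities are then checked on \<open>X\<close>.\<close>

lemma riesz_decomposition:
  assumes interp: effects_interpolate
    and f: "f \<in> A_pos K" "f' \<in> A_pos K" and g: "g \<in> A_pos K" and le: "\<And>x. x \<in> K \<Longrightarrow> g x \<le> f x + f' x"
  shows "\<exists>h\<in>A_pos K. \<exists>h'\<in>A_pos K. (\<forall>x\<in>K. h x \<le> f x) \<and> (\<forall>x\<in>K. h' x \<le> f' x) \<and> g = (\<lambda>x. h x + h' x)"
proof -
  have A: "f \<in> A" "f' \<in> A" "g \<in> A" and pos: "\<And>x. x \<in> K \<Longrightarrow> 0 \<le> f x" "\<And>x. x \<in> K \<Longrightarrow> 0 \<le> f' x" "\<And>x. x \<in> K \<Longrightarrow> 0 \<le> g x"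
    using f g by (auto simp: A_pos_def)
  have XK: "y \<in> K" if "y \<in> X" for y using that X_subset by blast
  have "continuous_on X (\<lambda>x. min (g x) (f x))"
    by (intro continuous_intros A_continuous_subset[OF _ X_subset] A)
  from extension_from_extreme[OF interp this]
  obtain h where h: "h \<in> A" "\<And>x. x \<in> X \<Longrightarrow> h x = min (g x) (f x)" by blast
  have z: "(\<lambda>_. 0) \<in> A" by (rule function_space_zero[OF function_space_A])
  have d: "(\<lambda>x. g x - h x) \<in> A" by (rule A_diff[OF A(3) h(1)])
  have "0 \<le> h x" if "x \<in> K" for x
    by (rule A_le_on_extreme[OF z h(1) _ that]) (use h(2) pos XK in auto)
  moreover have "0 \<le> g x - h x" if "x \<in> K" for x
    by (rule A_le_on_extreme[OF z d _ that]) (use h(2) in auto)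
  moreover have "h x \<le> f x" if "x \<in> K" for x
    by (rule A_le_on_extreme[OF h(1) A(1) _ that]) (use h(2) in auto)
  moreover have "g x - h x \<le> f' x" if "x \<in> K" for x
  proof (rule A_le_on_extreme[OF d A(2) _ that])
    fix y assume y: "y \<in> X"
    show "g y - h y \<le> f' y" using h(2)[OF y] le[OF XK[OF y]] pos(2)[OF XK[OF y]] by (simp add: min_def)
  qed
  ultimately have "h \<in> A_pos K" "(\<lambda>x. g x - h x) \<in> A_pos K" "\<forall>x\<in>K. h x \<le> f x" "\<forall>x\<in>K. g x - h x \<le> f' x"
    using h(1) d by (auto intro!: A_posI)
  then show ?thesis
    by (intro bexI[of _ h] bexI[of "\<lambda>h'. (\<forall>x\<in>K. h x \<le> f x) \<and> (\<forall>x\<in>K. h' x \<le> f' x) \<and> g = (\<lambda>x. h x + h' x)"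
          "\<lambda>x. g x - h x"]) auto
qed

end

subsection \<open>The order of the dual space\<close>

text \<open>Formulated for an arbitrary cone because it serves twice: for \<open>A_pos K\<close>,
  and for \<open>D_pos\<close>, whose differences contain the image of the predual.\<close>

lemma cone_functional_extension:
  fixes P :: "('x \<Rightarrow> real) set"
  assumes add: "\<And>a b. a \<in> P \<Longrightarrow> b \<in> P \<Longrightarrow> (\<lambda>x. a x + b x) \<in> P"
    and scale: "\<And>a c. a \<in> P \<Longrightarrow> 0 \<le> c \<Longrightarrow> (\<lambda>x. c * a x) \<in> P"
    and s_add: "\<And>a b. a \<in> P \<Longrightarrow> b \<in> P \<Longrightarrow> s (\<lambda>x. a x + b x) = s a + s b"
    and s_scale: "\<And>a c. a \<in> P \<Longrightarrow> 0 \<le> c \<Longrightarrow> s (\<lambda>x. c * a x) = c * s a"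
  shows "\<exists>S. linear_functional_on {f. \<exists>a\<in>P. \<exists>b\<in>P. f = (\<lambda>x. a x - b x)} S \<and>
    (\<forall>a\<in>P. \<forall>b\<in>P. S (\<lambda>x. a x - b x) = s a - (s b :: real))"
proof -
  define V where "V = {f. \<exists>a\<in>P. \<exists>b\<in>P. f = (\<lambda>x. a x - b x)}"
  have "\<exists>r. \<forall>a\<in>P. \<forall>b\<in>P. f = (\<lambda>x. a x - b x) \<longrightarrow> r = s a - s b" for f
  proof (cases "f \<in> V")
    case True
    then obtain a b where ab: "a \<in> P" "b \<in> P" "f = (\<lambda>x. a x - b x)" unfolding V_def by blast
    have "s a - s b = s a' - s b'" if p': "a' \<in> P" "b' \<in> P" "f = (\<lambda>x. a' x - b' x)" for a' b'
    proof -
      have "(\<lambda>x. a x + b' x) = (\<lambda>x. a' x + b x)"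
      proof
        fix x
        have "a x - b x = a' x - b' x" using fun_cong[OF ab(3), of x] fun_cong[OF p'(3), of x] by simp
        then show "a x + b' x = a' x + b x" by simp
      qed
      then have "s a + s b' = s a' + s b" using s_add[OF ab(1) p'(2)] s_add[OF p'(1) ab(2)] by simp
      then show ?thesis by simp
    qed
    then show ?thesis by blast
  next
    case False
    then show ?thesis unfolding V_def by blast
  qed
  then obtain S where S: "\<And>f a b. a \<in> P \<Longrightarrow> b \<in> P \<Longrightarrow> f = (\<lambda>x. a x - b x) \<Longrightarrow> S f = s a - s b" by metis
  have "linear_functional_on V S"
    unfolding linear_functional_on_def
  proof (intro conjI ballI allI)
    fix f g assume "f \<in> V" "g \<in> V"
    then obtain a b a' b' where ab: "a \<in> P" "b \<in> P" "f = (\<lambda>x. a x - b x)" and ab': "a' \<in> P" "b' \<in> P" "g = (\<lambda>x. a' x - b' x)"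
      unfolding V_def by blast
    have "S (\<lambda>x. f x + g x) = s (\<lambda>x. a x + a' x) - s (\<lambda>x. b x + b' x)"
      by (rule S[OF add[OF ab(1) ab'(1)] add[OF ab(2) ab'(2)]]) (simp add: ab ab' fun_eq_iff)
    then show "S (\<lambda>x. f x + g x) = S f + S g"
      using S[OF ab] S[OF ab'] s_add[OF ab(1) ab'(1)] s_add[OF ab(2) ab'(2)] by simp
  next
    fix c f assume "f \<in> V"
    then obtain a b where ab: "a \<in> P" "b \<in> P" "f = (\<lambda>x. a x - b x)" unfolding V_def by blast
    show "S (\<lambda>x. c * f x) = c * S f"
    proof (cases "0 \<le> c")
      case True
      have "S (\<lambda>x. c * f x) = s (\<lambda>x. c * a x) - s (\<lambda>x. c * b x)"
        by (rule S[OF scale[OF ab(1) True] scale[OF ab(2) True]]) (simp add: ab right_diff_distrib fun_eq_iff)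
      then show ?thesis using S[OF ab] s_scale[OF ab(1) True] s_scale[OF ab(2) True] by (simp add: right_diff_distrib)
    next
      case False
      then have c: "0 \<le> - c" by simp
      have "S (\<lambda>x. c * f x) = s (\<lambda>x. (- c) * b x) - s (\<lambda>x. (- c) * a x)"
        by (rule S[OF scale[OF ab(2) c] scale[OF ab(1) c]]) (simp add: ab right_diff_distrib fun_eq_iff)
      then show ?thesis using S[OF ab] s_scale[OF ab(1) c] s_scale[OF ab(2) c] by (simp add: right_diff_distrib)
    qed
  qed
  then show ?thesis using S unfolding V_def by blast
qed

lemma linear_functional_on_subset:
  "linear_functional_on V S \<Longrightarrow> W \<subseteq> V \<Longrightarrow> linear_functional_on W S"
  unfolding linear_functional_on_def by blast

context compact_convex
begin

lemma A_pos_add: "f \<in> A_pos K \<Longrightarrow> g \<in> A_pos K \<Longrightarrow> (\<lambda>x. f x + g x) \<in> A_pos K"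
  by (simp add: A_pos_def A_add)

lemma A_pos_scale: "f \<in> A_pos K \<Longrightarrow> 0 \<le> c \<Longrightarrow> (\<lambda>x. c * f x) \<in> A_pos K"
  by (simp add: A_pos_def A_scale)

lemma A_pos_A: "f \<in> A_pos K \<Longrightarrow> f \<in> A"
  and A_pos_nonneg: "f \<in> A_pos K \<Longrightarrow> x \<in> K \<Longrightarrow> 0 \<le> f x"
  by (simp_all add: A_pos_def)

lemma unit_pos: "unit \<in> A_pos K"
  by (rule A_posI[OF unit_A]) simp

lemma A_norm_nonneg: "f \<in> A \<Longrightarrow> 0 \<le> A_norm K f"
  using A_norm_attained by (metis abs_ge_zero)

lemma A_pos_diff:
  assumes "f \<in> A" shows "\<exists>a\<in>A_pos K. \<exists>b\<in>A_pos K. f = (\<lambda>x. a x - b x)"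
proof -
  let ?c = "A_norm K f"
  have a: "(\<lambda>x. f x + ?c * unit x) \<in> A_pos K"
  proof (rule A_posI)
    show "(\<lambda>x. f x + ?c * unit x) \<in> A" by (intro A_add A_scale assms unit_A)
    show "0 \<le> f x + ?c * unit x" if "x \<in> K" for x using A_norm_ge[OF assms that] that by simp
  qed
  have b: "(\<lambda>x. ?c * unit x) \<in> A_pos K" by (rule A_pos_scale[OF unit_pos A_norm_nonneg[OF assms]])
  have "f = (\<lambda>x. (f x + ?c * unit x) - ?c * unit x)" by simp
  then show ?thesis by (rule bexI[OF bexI[OF _ b] a])
qed

abbreviation "D \<equiv> A_dual K"
abbreviation "D_pos \<equiv> A_dual_pos K"

lemma D_linear: "\<psi> \<in> D \<Longrightarrow> linear_functional_on A \<psi>"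
  and D_outside: "\<psi> \<in> D \<Longrightarrow> f \<notin> A \<Longrightarrow> \<psi> f = 0"
  by (simp_all add: A_dual_def linear_functional_on_def)

lemma D_bounded:
  assumes "\<psi> \<in> D" obtains C where "0 \<le> C" "\<And>f. f \<in> A \<Longrightarrow> \<bar>\<psi> f\<bar> \<le> C * A_norm K f"
proof -
  obtain C where C: "\<And>f. f \<in> A \<Longrightarrow> \<bar>\<psi> f\<bar> \<le> C * A_norm K f" using assms unfolding A_dual_def by blast
  have "\<bar>\<psi> f\<bar> \<le> \<bar>C\<bar> * A_norm K f" if "f \<in> A" for f
    using C[OF that] mult_right_mono[OF abs_ge_self[of C] A_norm_nonneg[OF that]] by linarith
  then show ?thesis using that[of "\<bar>C\<bar>"] by simp
qed

lemma D_I: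
  assumes "linear_functional_on A \<psi>" "\<And>f. f \<in> A \<Longrightarrow> \<bar>\<psi> f\<bar> \<le> C * A_norm K f" "\<And>f. f \<notin> A \<Longrightarrow> \<psi> f = 0"
  shows "\<psi> \<in> D"
  using assms unfolding A_dual_def linear_functional_on_def by blast

lemma D_add:
  assumes "\<phi> \<in> D" "\<psi> \<in> D" shows "(\<lambda>f. \<phi> f + \<psi> f) \<in> D"
proof -
  obtain C where C: "\<And>f. f \<in> A \<Longrightarrow> \<bar>\<phi> f\<bar> \<le> C * A_norm K f" using D_bounded[OF assms(1)] by metis
  obtain C' where C': "\<And>f. f \<in> A \<Longrightarrow> \<bar>\<psi> f\<bar> \<le> C' * A_norm K f" using D_bounded[OF assms(2)] by metis
  show ?thesis
  proof (rule D_I)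
    show "linear_functional_on A (\<lambda>f. \<phi> f + \<psi> f)"
      using D_linear[OF assms(1)] D_linear[OF assms(2)] by (simp add: linear_functional_on_def distrib_left)
    show "\<bar>\<phi> f + \<psi> f\<bar> \<le> (C + C') * A_norm K f" if "f \<in> A" for f
      unfolding distrib_right using C[OF that] C'[OF that] by linarith
  qed (simp add: D_outside assms)
qed

lemma D_scale:
  assumes "\<phi> \<in> D" shows "(\<lambda>f. c * \<phi> f) \<in> D"
proof -
  obtain C where C: "\<And>f. f \<in> A \<Longrightarrow> \<bar>\<phi> f\<bar> \<le> C * A_norm K f" using D_bounded[OF assms(1)] by metis
  show ?thesis
  proof (rule D_I)
    show "linear_functional_on A (\<lambda>f. c * \<phi> f)"
      using D_linear[OF assms(1)] by (simp add: linear_functional_on_def distrib_left)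
    show "\<bar>c * \<phi> f\<bar> \<le> (\<bar>c\<bar> * C) * A_norm K f" if "f \<in> A" for f
      unfolding abs_mult mult.assoc using C[OF that] by (rule mult_left_mono) simp
  qed (simp add: D_outside assms)
qed

lemma D_diff: "\<phi> \<in> D \<Longrightarrow> \<psi> \<in> D \<Longrightarrow> (\<lambda>f. \<phi> f - \<psi> f) \<in> D"
  using D_add[of \<phi> "\<lambda>f. (-1) * \<psi> f"] D_scale[of \<psi> "-1"] by simp

lemma D_pos_D: "\<psi> \<in> D_pos \<Longrightarrow> \<psi> \<in> D"
  and D_pos_nonneg: "\<psi> \<in> D_pos \<Longrightarrow> f \<in> A_pos K \<Longrightarrow> 0 \<le> \<psi> f"
  and D_posI: "\<psi> \<in> D \<Longrightarrow> (\<And>f. f \<in> A_pos K \<Longrightarrow> 0 \<le> \<psi> f) \<Longrightarrow> \<psi> \<in> D_pos"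
  by (simp_all add: A_dual_pos_def)

lemma D_pos_add: "\<phi> \<in> D_pos \<Longrightarrow> \<psi> \<in> D_pos \<Longrightarrow> (\<lambda>f. \<phi> f + \<psi> f) \<in> D_pos"
  unfolding A_dual_pos_def using D_add[of \<phi> \<psi>] by simp

lemma D_pos_scale: "\<phi> \<in> D_pos \<Longrightarrow> 0 \<le> c \<Longrightarrow> (\<lambda>f. c * \<phi> f) \<in> D_pos"
  unfolding A_dual_pos_def using D_scale[of \<phi> c] by simp

text \<open>Positivity gives boundedness, since \<open>f\<close> lies between plus and minus
  \<open>A_norm K f\<close> times the unit.\<close>

lemma D_pos_functional:
  assumes lin: "linear_functional_on A \<psi>" and pos: "\<And>f. f \<in> A_pos K \<Longrightarrow> 0 \<le> \<psi> f" and out: "\<And>f. f \<notin> A \<Longrightarrow> \<psi> f = 0"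
  shows "\<psi> \<in> D_pos"
proof (rule D_posI[OF _ pos])
  show "\<psi> \<in> D"
  proof (rule D_I[OF lin _ out])
    fix f assume f: "f \<in> A"
    let ?c = "A_norm K f"
    have b: "f x \<le> ?c" "- f x \<le> ?c" if "x \<in> K" for x using A_norm_ge[OF f that] by auto
    have cu: "(\<lambda>x. ?c * unit x) \<in> A" by (rule A_scale[OF unit_A])
    have "0 \<le> \<psi> (\<lambda>x. ?c * unit x - f x)"
      by (rule pos, rule A_posI[OF A_diff[OF cu f]]) (use b in simp)
    moreover have "0 \<le> \<psi> (\<lambda>x. ?c * unit x + f x)"
      by (rule pos, rule A_posI[OF A_add[OF cu f]]) (use b in force)
    ultimately show "\<bar>\<psi> f\<bar> \<le> \<psi> unit * ?c"
      using linear_functional_on_diff[OF lin function_space_A cu f] linear_functional_on_add[OF lin cu f]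
        linear_functional_on_scale[OF lin unit_A, of ?c] by (simp add: abs_le_iff mult.commute)
  qed
qed

lemma D_pos_zero: "(\<lambda>_. 0) \<in> D_pos"
  by (rule D_pos_functional) (simp_all add: linear_functional_on_def)

lemma D_eqI:
  assumes "\<phi> \<in> D" "\<psi> \<in> D" "\<And>f. f \<in> A_pos K \<Longrightarrow> \<phi> f = \<psi> f"
  shows "\<phi> = \<psi>"
proof
  fix f
  show "\<phi> f = \<psi> f"
  proof (cases "f \<in> A")
    case True
    then obtain a b where ab: "a \<in> A_pos K" "b \<in> A_pos K" "f = (\<lambda>x. a x - b x)" using A_pos_diff by blast
    show ?thesis
      unfolding ab(3) using linear_functional_on_diff[OF D_linear[OF assms(1)] function_space_A A_pos_A[OF ab(1)] A_pos_A[OF ab(2)]]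
        linear_functional_on_diff[OF D_linear[OF assms(2)] function_space_A A_pos_A[OF ab(1)] A_pos_A[OF ab(2)]]
        assms(3)[OF ab(1)] assms(3)[OF ab(2)] by simp
  qed (simp add: D_outside assms)
qed

lemma D_pos_mono:
  assumes "\<psi> \<in> D_pos" "f \<in> A" "g \<in> A" "\<And>x. x \<in> K \<Longrightarrow> f x \<le> g x"
  shows "\<psi> f \<le> \<psi> g"
proof -
  have "0 \<le> \<psi> (\<lambda>x. g x - f x)"
    by (rule D_pos_nonneg[OF assms(1)], rule A_posI[OF A_diff[OF assms(3,2)]]) (simp add: assms(4))
  then show ?thesis
    using linear_functional_on_diff[OF D_linear[OF D_pos_D[OF assms(1)]] function_space_A assms(3,2)] by simp
qed

lemma evaluation_D_pos: "x \<in> K \<Longrightarrow> 0 \<le> a \<Longrightarrow> (\<lambda>f. if f \<in> A then a * f x else 0) \<in> D_pos"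
  by (rule D_pos_functional) (simp_all add: linear_functional_on_def A_add A_scale A_pos_def distrib_left)

lemma A_dual_order_simps:
  "carrier (A_dual_order K) = D" "(.=\<^bsub>A_dual_order K\<^esub>) = (=)"
  "\<phi> \<sqsubseteq>\<^bsub>A_dual_order K\<^esub> \<psi> \<longleftrightarrow> (\<lambda>f. \<psi> f - \<phi> f) \<in> D_pos"
  by (simp_all add: A_dual_order_def)

lemma partial_order_dual: "partial_order (A_dual_order K)"
proof (unfold_locales, unfold A_dual_order_simps)
  show "(\<lambda>f. \<phi> f - \<phi> f) \<in> D_pos" for \<phi> using D_pos_zero by simp
  show "\<phi> = \<psi>" if "(\<lambda>f. \<psi> f - \<phi> f) \<in> D_pos" "(\<lambda>f. \<phi> f - \<psi> f) \<in> D_pos" "\<phi> \<in> D" "\<psi> \<in> D" for \<phi> \<psi>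
    using D_pos_nonneg[OF that(1)] D_pos_nonneg[OF that(2)] by (intro D_eqI[OF that(3,4)] antisym) force+
  show "(\<lambda>f. \<theta> f - \<phi> f) \<in> D_pos" if "(\<lambda>f. \<psi> f - \<phi> f) \<in> D_pos" "(\<lambda>f. \<theta> f - \<psi> f) \<in> D_pos" for \<phi> \<psi> \<theta>
    using D_pos_add[OF that] by simp
qed auto

text \<open>Translation reduces two elements to one: the supremum is \<open>\<phi>\<close> plus the
  positive part of \<open>\<psi> - \<phi>\<close>, and the infimum is \<open>\<phi>\<close> minus
  the positive part of \<open>\<phi> - \<psi>\<close>.\<close>

lemma lattice_if_positive_parts:
  assumes pp: "\<And>\<psi>. \<psi> \<in> D \<Longrightarrow> \<exists>P\<in>D_pos. (\<lambda>f. P f - \<psi> f) \<in> D_pos \<and>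
      (\<forall>\<theta>\<in>D_pos. (\<lambda>f. \<theta> f - \<psi> f) \<in> D_pos \<longrightarrow> (\<lambda>f. \<theta> f - P f) \<in> D_pos)"
  shows "Choquet_simplex K"
proof -
  interpret partial_order "A_dual_order K" by (rule partial_order_dual)
  show ?thesis
    unfolding Choquet_simplex_def
  proof (unfold_locales, unfold least_def greatest_def Upper_def Lower_def A_dual_order_simps)
    fix \<phi> \<psi> assume d: "\<phi> \<in> D" "\<psi> \<in> D"
    obtain P where P: "P \<in> D_pos" "(\<lambda>f. P f - (\<psi> f - \<phi> f)) \<in> D_pos"
        "\<And>\<theta>. \<theta> \<in> D_pos \<Longrightarrow> (\<lambda>f. \<theta> f - (\<psi> f - \<phi> f)) \<in> D_pos \<Longrightarrow> (\<lambda>f. \<theta> f - P f) \<in> D_pos"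
      using pp[OF D_diff[OF d(2,1)]] by auto
    have sup: "(\<lambda>f. \<theta> f - (\<phi> f + P f)) \<in> D_pos"
      if "(\<lambda>f. \<theta> f - \<phi> f) \<in> D_pos" "(\<lambda>f. \<theta> f - \<psi> f) \<in> D_pos" for \<theta>
      using P(3)[OF that(1)] that(2) by (simp add: diff_diff_eq)
    show "\<exists>s. {u. \<forall>x. x \<in> {\<phi>, \<psi>} \<inter> D \<longrightarrow> (\<lambda>f. u f - x f) \<in> D_pos} \<inter> D \<subseteq> D \<and>
        s \<in> {u. \<forall>x. x \<in> {\<phi>, \<psi>} \<inter> D \<longrightarrow> (\<lambda>f. u f - x f) \<in> D_pos} \<inter> D \<and>
        (\<forall>x\<in>{u. \<forall>x. x \<in> {\<phi>, \<psi>} \<inter> D \<longrightarrow> (\<lambda>f. u f - x f) \<in> D_pos} \<inter> D. (\<lambda>f. x f - s f) \<in> D_pos)"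
    proof (intro exI[of _ "\<lambda>f. \<phi> f + P f"] conjI)
      show "(\<lambda>f. \<phi> f + P f) \<in> {u. \<forall>x. x \<in> {\<phi>, \<psi>} \<inter> D \<longrightarrow> (\<lambda>f. u f - x f) \<in> D_pos} \<inter> D"
        using D_add[OF d(1) D_pos_D[OF P(1)]] P(1,2) by (auto simp: algebra_simps)
      show "\<forall>x\<in>{u. \<forall>x. x \<in> {\<phi>, \<psi>} \<inter> D \<longrightarrow> (\<lambda>f. u f - x f) \<in> D_pos} \<inter> D. (\<lambda>f. x f - (\<phi> f + P f)) \<in> D_pos"
        using sup d by blast
    qed blast
  next
    fix \<phi> \<psi> assume d: "\<phi> \<in> D" "\<psi> \<in> D"
    obtain P where P: "P \<in> D_pos" "(\<lambda>f. P f - (\<phi> f - \<psi> f)) \<in> D_pos"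
        "\<And>\<theta>. \<theta> \<in> D_pos \<Longrightarrow> (\<lambda>f. \<theta> f - (\<phi> f - \<psi> f)) \<in> D_pos \<Longrightarrow> (\<lambda>f. \<theta> f - P f) \<in> D_pos"
      using pp[OF D_diff[OF d]] by auto
    have inf: "(\<lambda>f. (\<phi> f - P f) - \<theta> f) \<in> D_pos"
      if "(\<lambda>f. \<phi> f - \<theta> f) \<in> D_pos" "(\<lambda>f. \<psi> f - \<theta> f) \<in> D_pos" for \<theta>
      using P(3)[OF that(1)] that(2) by (simp add: algebra_simps)
    show "\<exists>s. {l. \<forall>x. x \<in> {\<phi>, \<psi>} \<inter> D \<longrightarrow> (\<lambda>f. x f - l f) \<in> D_pos} \<inter> D \<subseteq> D \<and>
        s \<in> {l. \<forall>x. x \<in> {\<phi>, \<psi>} \<inter> D \<longrightarrow> (\<lambda>f. x f - l f) \<in> D_pos} \<inter> D \<and>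
        (\<forall>x\<in>{l. \<forall>x. x \<in> {\<phi>, \<psi>} \<inter> D \<longrightarrow> (\<lambda>f. x f - l f) \<in> D_pos} \<inter> D. (\<lambda>f. s f - x f) \<in> D_pos)"
    proof (intro exI[of _ "\<lambda>f. \<phi> f - P f"] conjI)
      show "(\<lambda>f. \<phi> f - P f) \<in> {l. \<forall>x. x \<in> {\<phi>, \<psi>} \<inter> D \<longrightarrow> (\<lambda>f. x f - l f) \<in> D_pos} \<inter> D"
        using D_diff[OF d(1) D_pos_D[OF P(1)]] P(1,2) by (auto simp: algebra_simps)
      show "\<forall>x\<in>{l. \<forall>x. x \<in> {\<phi>, \<psi>} \<inter> D \<longrightarrow> (\<lambda>f. x f - l f) \<in> D_pos} \<inter> D. (\<lambda>f. (\<phi> f - P f) - x f) \<in> D_pos"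
        using inf d by blast
    qed blast
  qed
qed

text \<open>The infimum of \<open>\<psi>\<close> and \<open>\<theta>\<close> serves as
  \<open>\<rho>\<close>. Both 0 and \<open>\<psi> - \<theta>'\<close> are lower bounds, the latter
  because \<open>\<theta> - (\<psi> - \<theta>') = \<psi>'\<close>, so both lie below
  \<open>\<rho>\<close>.\<close>

lemma dual_refinement:
  assumes simplex: "Choquet_simplex K"
    and d: "\<psi> \<in> D_pos" "\<psi>' \<in> D_pos" "\<theta> \<in> D_pos" "\<theta>' \<in> D_pos"
    and eq: "\<And>f. \<psi> f + \<psi>' f = \<theta> f + \<theta>' f"
  shows "\<exists>\<rho>\<in>D_pos. (\<lambda>f. \<psi> f - \<rho> f) \<in> D_pos \<and> (\<lambda>f. \<theta> f - \<rho> f) \<in> D_pos \<and> (\<lambda>f. \<theta>' f - (\<psi> f - \<rho> f)) \<in> D_pos"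
proof -
  interpret lattice "A_dual_order K" using simplex by (simp add: Choquet_simplex_def)
  obtain \<rho> where "greatest (A_dual_order K) \<rho> (Lower (A_dual_order K) {\<psi>, \<theta>})"
    using inf_of_two_exists[of \<psi> \<theta>] D_pos_D[OF d(1)] D_pos_D[OF d(3)] by (auto simp: A_dual_order_simps(1))
  then have \<rho>: "\<rho> \<in> Lower (A_dual_order K) {\<psi>, \<theta>}"
      and g: "\<And>\<sigma>. \<sigma> \<in> Lower (A_dual_order K) {\<psi>, \<theta>} \<Longrightarrow> (\<lambda>f. \<rho> f - \<sigma> f) \<in> D_pos"
    by (auto simp: greatest_def A_dual_order_simps)
  have low: "\<sigma> \<in> Lower (A_dual_order K) {\<psi>, \<theta>} \<longleftrightarrow> \<sigma> \<in> D \<and> (\<lambda>f. \<psi> f - \<sigma> f) \<in> D_pos \<and> (\<lambda>f. \<theta> f - \<sigma> f) \<in> D_pos" for \<sigma>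
    using D_pos_D[OF d(1)] D_pos_D[OF d(3)] unfolding Lower_def A_dual_order_simps by auto
  have "(\<lambda>f. \<rho> f - 0) \<in> D_pos" using D_pos_D[OF D_pos_zero] d by (intro g) (simp add: low)
  moreover have "(\<lambda>f. \<rho> f - (\<psi> f - \<theta>' f)) \<in> D_pos"
  proof (intro g low[THEN iffD2] conjI)
    show "(\<lambda>f. \<psi> f - \<theta>' f) \<in> D" by (intro D_diff D_pos_D d)
    show "(\<lambda>f. \<psi> f - (\<psi> f - \<theta>' f)) \<in> D_pos" using d(4) by simp
    have "\<theta> f - (\<psi> f - \<theta>' f) = \<psi>' f" for f using eq[of f] by simp
    then show "(\<lambda>f. \<theta> f - (\<psi> f - \<theta>' f)) \<in> D_pos" using d(2) by simp
  qed
  then have "(\<lambda>f. \<theta>' f - (\<psi> f - \<rho> f)) \<in> D_pos" by (simp add: algebra_simps)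
  ultimately show ?thesis using \<rho> unfolding low by auto
qed

end

section \<open>Lattice operations in the dual, and their restriction to the predual\<close>

context predual_state_space
begin

text \<open>Riesz--Kantorovich formula: at positive \<open>f\<close> the positive part is the
  supremum of \<open>\<psi>\<close> over the order interval from 0 to \<open>f\<close>.
  Subadditivity of this supremum is where \<open>riesz_decomposition\<close> enters; differences
  then extend it to \<open>A\<close>.\<close>

lemma positive_part_exists:
  assumes interp: effects_interpolate and \<psi>: "\<psi> \<in> D"
  shows "\<exists>P\<in>D_pos. (\<lambda>f. P f - \<psi> f) \<in> D_pos \<and>
      (\<forall>\<theta>\<in>D_pos. (\<lambda>f. \<theta> f - \<psi> f) \<in> D_pos \<longrightarrow> (\<lambda>f. \<theta> f - P f) \<in> D_pos)"
proof -
  note lin = D_linear[OF \<psi>]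
  have z: "(\<lambda>_. 0) \<in> A_pos K" by (rule A_posI[OF function_space_zero[OF function_space_A]]) simp
  have \<psi>z: "\<psi> (\<lambda>_. 0) = 0" by (rule linear_functional_on_zero[OF lin function_space_A])
  obtain C where C: "0 \<le> C" "\<And>f. f \<in> A \<Longrightarrow> \<bar>\<psi> f\<bar> \<le> C * A_norm K f" using D_bounded[OF \<psi>] by metis
  define G where "G f = {g \<in> A_pos K. \<forall>x\<in>K. g x \<le> f x}" for f
  define p where "p f = (SUP g\<in>G f. \<psi> g)" for f
  have zG: "(\<lambda>_. 0) \<in> G f" if "f \<in> A_pos K" for f
    using z A_pos_nonneg[OF that] by (simp add: G_def)
  have bdd: "bdd_above (\<psi> ` G f)" if f: "f \<in> A_pos K" for f
  proof (rule bdd_aboveI2)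
    fix g assume g: "g \<in> G f"
    then have gA: "g \<in> A" "\<And>x. x \<in> K \<Longrightarrow> 0 \<le> g x \<and> g x \<le> f x" by (auto simp: G_def A_pos_def)
    obtain x where x: "x \<in> K" "A_norm K g = \<bar>g x\<bar>" using A_norm_attained[OF gA(1)] by metis
    have "A_norm K g \<le> A_norm K f" using gA(2)[OF x(1)] A_norm_ge[OF A_pos_A[OF f] x(1)] x(2) by linarith
    then have "C * A_norm K g \<le> C * A_norm K f" using C(1) by (rule mult_left_mono)
    then show "\<psi> g \<le> C * A_norm K f" using C(2)[OF gA(1)] by linarith
  qed
  have p_upper: "\<psi> g \<le> p f" if "f \<in> A_pos K" "g \<in> G f" for f g
    unfolding p_def by (rule cSUP_upper[OF that(2) bdd[OF that(1)]])
  have p_least: "p f \<le> b" if "f \<in> A_pos K" "\<And>g. g \<in> G f \<Longrightarrow> \<psi> g \<le> b" for f b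
    unfolding p_def using zG[OF that(1)] that(2) by (intro cSUP_least) auto
  have p_add: "p (\<lambda>x. f x + f' x) = p f + p f'" if f: "f \<in> A_pos K" "f' \<in> A_pos K" for f f'
  proof (rule antisym)
    have ff: "(\<lambda>x. f x + f' x) \<in> A_pos K" by (rule A_pos_add[OF f])
    show "p (\<lambda>x. f x + f' x) \<le> p f + p f'"
    proof (rule p_least[OF ff])
      fix g assume g: "g \<in> G (\<lambda>x. f x + f' x)"
      then have g': "g \<in> A_pos K" "\<And>x. x \<in> K \<Longrightarrow> g x \<le> f x + f' x" by (auto simp: G_def)
      obtain h h' where h: "h \<in> A_pos K" "h' \<in> A_pos K" "\<forall>x\<in>K. h x \<le> f x" "\<forall>x\<in>K. h' x \<le> f' x" "g = (\<lambda>x. h x + h' x)"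
        using riesz_decomposition[OF interp f g'] by blast
      have "\<psi> g = \<psi> h + \<psi> h'"
        unfolding h(5) by (rule linear_functional_on_add[OF lin A_pos_A[OF h(1)] A_pos_A[OF h(2)]])
      also have "\<dots> \<le> p f + p f'"
        using h by (intro add_mono p_upper f) (simp_all add: G_def)
      finally show "\<psi> g \<le> p f + p f'" .
    qed
    have *: "\<psi> g + \<psi> g' \<le> p (\<lambda>x. f x + f' x)" if g: "g \<in> G f" "g' \<in> G f'" for g g'
    proof -
      have A: "g \<in> A_pos K" "g' \<in> A_pos K" using g by (auto simp: G_def)
      have "(\<lambda>x. g x + g' x) \<in> G (\<lambda>x. f x + f' x)"
        using g A_pos_add[OF A] by (auto simp: G_def intro: add_mono)
      from p_upper[OF ff this] show ?thesis
        using linear_functional_on_add[OF lin A_pos_A[OF A(1)] A_pos_A[OF A(2)]] by simp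
    qed
    have "p f \<le> p (\<lambda>x. f x + f' x) - \<psi> g'" if "g' \<in> G f'" for g'
      by (rule p_least[OF f(1)]) (use *[OF _ that] in force)
    then have "p f' \<le> p (\<lambda>x. f x + f' x) - p f"
      by (intro p_least[OF f(2)]) force
    then show "p f + p f' \<le> p (\<lambda>x. f x + f' x)" by simp
  qed
  have p_scale_le: "p (\<lambda>x. c * f x) \<le> c * p f" if f: "f \<in> A_pos K" and c: "0 < c" for f c
  proof (rule p_least[OF A_pos_scale[OF f]])
    fix g assume g: "g \<in> G (\<lambda>x. c * f x)"
    then have gA: "g \<in> A_pos K" by (simp add: G_def)
    have "(\<lambda>x. (1 / c) * g x) \<in> G f"
      using g A_pos_scale[OF gA, of "1 / c"] c by (simp add: G_def field_simps)
    from p_upper[OF f this] have "(1 / c) * \<psi> g \<le> p f"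
      using linear_functional_on_scale[OF lin A_pos_A[OF gA], of "1 / c"] by simp
    then show "\<psi> g \<le> c * p f" using c by (simp add: field_simps)
  qed (use c in simp)
  have p_scale: "p (\<lambda>x. c * f x) = c * p f" if f: "f \<in> A_pos K" and c: "0 \<le> c" for f c
  proof (cases "c = 0")
    case True
    have "p (\<lambda>_. 0) \<le> 0"
    proof (rule p_least[OF z])
      fix g assume g: "g \<in> G (\<lambda>_. 0)"
      have "g = (\<lambda>_. 0)"
        by (rule A_eqI[OF _ A_pos_A[OF z]]) (use g in \<open>auto simp: G_def A_pos_def intro: antisym\<close>)
      then show "\<psi> g \<le> 0" using \<psi>z by simp
    qed
    moreover have "0 \<le> p (\<lambda>_. 0)" using p_upper[OF z zG[OF z]] \<psi>z by simp
    ultimately show ?thesis using True by simp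
  next
    case False
    then have c: "0 < c" using c by simp
    have "p (\<lambda>x. (1 / c) * (c * f x)) \<le> (1 / c) * p (\<lambda>x. c * f x)"
      by (rule p_scale_le[OF A_pos_scale[OF f]]) (use c in auto)
    then have "c * p f \<le> p (\<lambda>x. c * f x)" using c by (simp add: field_simps)
    then show ?thesis using p_scale_le[OF f c] by simp
  qed
  obtain S where S: "linear_functional_on {f. \<exists>a\<in>A_pos K. \<exists>b\<in>A_pos K. f = (\<lambda>x. a x - b x)} S"
      and S_eq: "\<forall>a\<in>A_pos K. \<forall>b\<in>A_pos K. S (\<lambda>x. a x - b x) = p a - p b"
    using cone_functional_extension[of "A_pos K" p, OF A_pos_add A_pos_scale p_add p_scale] by blast
  have "A \<subseteq> {f. \<exists>a\<in>A_pos K. \<exists>b\<in>A_pos K. f = (\<lambda>x. a x - b x)}" using A_pos_diff by blast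
  then have SA: "linear_functional_on A S" by (rule linear_functional_on_subset[OF S])
  have Sp: "S f = p f" if f: "f \<in> A_pos K" for f
    using bspec[OF bspec[OF S_eq f] z] p_scale[OF z, of 0] by simp
  define P where "P f = (if f \<in> A then S f else 0)" for f
  have Pp: "P f = p f" if "f \<in> A_pos K" for f using Sp[OF that] A_pos_A[OF that] by (simp add: P_def)
  have P: "P \<in> D_pos"
  proof (rule D_pos_functional)
    show "linear_functional_on A P"
      using SA by (simp add: linear_functional_on_def P_def A_add A_scale)
    show "0 \<le> P f" if "f \<in> A_pos K" for f
      using Pp[OF that] p_upper[OF that zG[OF that]] \<psi>z by simp
  qed (simp add: P_def)
  have "(\<lambda>f. P f - \<psi> f) \<in> D_pos"
  proof (rule D_posI[OF D_diff[OF D_pos_D[OF P] \<psi>]])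
    show "0 \<le> P f - \<psi> f" if f: "f \<in> A_pos K" for f
      using Pp[OF f] p_upper[OF f, of f] f by (simp add: G_def)
  qed
  moreover have "(\<lambda>f. \<theta> f - P f) \<in> D_pos" if \<theta>: "\<theta> \<in> D_pos" "(\<lambda>f. \<theta> f - \<psi> f) \<in> D_pos" for \<theta>
  proof (rule D_posI[OF D_diff[OF D_pos_D[OF \<theta>(1)] D_pos_D[OF P]]])
    fix f assume f: "f \<in> A_pos K"
    have "p f \<le> \<theta> f"
    proof (rule p_least[OF f])
      fix g assume g: "g \<in> G f"
      then have gA: "g \<in> A_pos K" "\<And>x. x \<in> K \<Longrightarrow> g x \<le> f x" by (auto simp: G_def)
      have "0 \<le> \<theta> g - \<psi> g" by (rule D_pos_nonneg[OF \<theta>(2) gA(1)])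
      moreover have "\<theta> g \<le> \<theta> f" by (rule D_pos_mono[OF \<theta>(1) A_pos_A[OF gA(1)] A_pos_A[OF f] gA(2)])
      ultimately show "\<psi> g \<le> \<theta> f" by simp
    qed
    then show "0 \<le> \<theta> f - P f" using Pp[OF f] by simp
  qed
  ultimately show ?thesis using P by (intro bexI[of _ P]) auto
qed

lemma interpolate_imp_Choquet: "effects_interpolate \<Longrightarrow> Choquet_simplex K"
  by (rule lattice_if_positive_parts[OF positive_part_exists])

text \<open>The canonical embedding of the predual into its bidual, read through
  \<open>\<Phi>\<close>.\<close>

definition predual_functional :: "'p \<Rightarrow> ('a \<Rightarrow> real) \<Rightarrow> real" where
  "predual_functional q f = (if f \<in> A then blinfun_apply (SOME e. \<Phi> e = f) q else 0)"

lemma predual_functional_Phi: "predual_functional q (\<Phi> e) = blinfun_apply e q"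
proof -
  have "\<Phi> (SOME e'. \<Phi> e' = \<Phi> e) = \<Phi> e" by (rule someI) simp
  then have "(SOME e'. \<Phi> e' = \<Phi> e) = e" by (intro Phi_eqI) simp
  then show ?thesis by (simp add: predual_functional_def Phi_A)
qed

text \<open>This is \<open>bounded_functional_decomposition\<close> with \<open>C = norm q\<close>.
  The two parts are multiples of evaluations and need not come from the predual, which is why later
  constructions are carried out on all of \<open>D_pos\<close>.\<close>

lemma predual_functional_decomposition:
  "\<exists>\<alpha>\<in>D_pos. \<exists>\<beta>\<in>D_pos. predual_functional q = (\<lambda>f. \<alpha> f - \<beta> f) \<and> \<alpha> unit + \<beta> unit = norm q"
proof -
  have lin: "linear_functional_on A (predual_functional q)"
    unfolding linear_functional_on_def
  proof (intro conjI ballI allI)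
    fix f g assume fg: "f \<in> A" "g \<in> A"
    obtain a where a: "f = \<Phi> a" using Phi_surj[OF fg(1)] by blast
    obtain b where b: "g = \<Phi> b" using Phi_surj[OF fg(2)] by blast
    have "(\<lambda>x. f x + g x) = \<Phi> (a + b)" by (simp add: a b fun_eq_iff)
    then show "predual_functional q (\<lambda>x. f x + g x) = predual_functional q f + predual_functional q g"
      by (simp add: predual_functional_Phi a b blinfun.add_left)
  next
    fix c f assume f: "f \<in> A"
    obtain a where a: "f = \<Phi> a" using Phi_surj[OF f] by blast
    have "(\<lambda>x. c * f x) = \<Phi> (c *\<^sub>R a)" by (simp add: a fun_eq_iff)
    then show "predual_functional q (\<lambda>x. c * f x) = c * predual_functional q f"
      by (simp add: predual_functional_Phi a blinfun.scaleR_left)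
  qed
  have "\<bar>predual_functional q f\<bar> \<le> norm q * A_norm K f" if "f \<in> A" for f
  proof -
    obtain a where a: "f = \<Phi> a" using Phi_surj[OF \<open>f \<in> A\<close>] by blast
    show ?thesis using norm_blinfun[of a q] by (simp add: a predual_functional_Phi norm_Phi mult.commute)
  qed
  from bounded_functional_decomposition[OF lin norm_ge_zero this]
  obtain y z a b where *: "y \<in> K" "z \<in> K" "0 \<le> a" "0 \<le> b" "a + b = norm q"
      "\<And>f. f \<in> A \<Longrightarrow> predual_functional q f = a * f y - b * f z" by blast
  let ?\<alpha> = "\<lambda>f. if f \<in> A then a * f y else 0" and ?\<beta> = "\<lambda>f. if f \<in> A then b * f z else 0"
  have "predual_functional q = (\<lambda>f. ?\<alpha> f - ?\<beta> f)"
    using *(6) by (auto simp: fun_eq_iff predual_functional_def)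
  moreover have "?\<alpha> unit + ?\<beta> unit = norm q" using * unit_A by simp
  ultimately show ?thesis
    by (intro bexI[OF bexI[OF _ evaluation_D_pos[OF *(2,4)]] evaluation_D_pos[OF *(1,3)]] conjI)
qed

text \<open>
  The predual sits inside \<open>D\<close>, and its norm there is the base norm. So an additive functional on \<open>D_pos\<close>
  with values between \<open>0\<close> and the total mass restricts to an element of the unit interval.
\<close>

lemma unit_interval_of_additive:
  assumes s_add: "\<And>\<alpha> \<beta>. \<alpha> \<in> D_pos \<Longrightarrow> \<beta> \<in> D_pos \<Longrightarrow> s (\<lambda>f. \<alpha> f + \<beta> f) = s \<alpha> + s \<beta>"
    and s_scale: "\<And>\<alpha> c. \<alpha> \<in> D_pos \<Longrightarrow> 0 \<le> c \<Longrightarrow> s (\<lambda>f. c * \<alpha> f) = c * s \<alpha>"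
    and s_ge: "\<And>\<alpha>. \<alpha> \<in> D_pos \<Longrightarrow> 0 \<le> s \<alpha>" and s_le: "\<And>\<alpha>. \<alpha> \<in> D_pos \<Longrightarrow> s \<alpha> \<le> \<alpha> unit"
  shows "\<exists>e\<in>unit_interval. \<forall>\<alpha>\<in>D_pos. \<forall>\<beta>\<in>D_pos. \<forall>q.
    predual_functional q = (\<lambda>f. \<alpha> f - \<beta> f) \<longrightarrow> blinfun_apply e q = s \<alpha> - s \<beta>"
proof -
  let ?V = "{\<phi>. \<exists>\<alpha>\<in>D_pos. \<exists>\<beta>\<in>D_pos. \<phi> = (\<lambda>f. \<alpha> f - \<beta> f)}"
  obtain S where S: "linear_functional_on ?V S"
      and S_eq: "\<And>\<alpha> \<beta>. \<alpha> \<in> D_pos \<Longrightarrow> \<beta> \<in> D_pos \<Longrightarrow> S (\<lambda>f. \<alpha> f - \<beta> f) = s \<alpha> - s \<beta>"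
    using cone_functional_extension[of D_pos s, OF D_pos_add D_pos_scale s_add s_scale] by blast
  have V: "predual_functional q \<in> ?V" for q using predual_functional_decomposition[of q] by blast
  define w where "w q = S (predual_functional q)" for q
  have add: "w (q + r) = w q + w r" for q r
  proof -
    have "predual_functional (q + r) = (\<lambda>f. predual_functional q f + predual_functional r f)"
      by (auto simp: predual_functional_def fun_eq_iff blinfun.add_right)
    then show ?thesis unfolding w_def using linear_functional_on_add[OF S V V] by simp
  qed
  have scale: "w (c *\<^sub>R q) = c * w q" for c q
  proof -
    have "predual_functional (c *\<^sub>R q) = (\<lambda>f. c * predual_functional q f)"
      by (auto simp: predual_functional_def fun_eq_iff blinfun.scaleR_right)
    then show ?thesis unfolding w_def using linear_functional_on_scale[OF S V] by simp
  qed
  \<comment> \<open>Since \<open>s\<close> lies between 0 and the mass on both parts,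
    \<open>2 * w q - u q\<close> is bounded by the total mass
    \<open>\<alpha> unit + \<beta> unit\<close>, which is \<open>norm q\<close>.\<close>
  have bound: "\<bar>2 * w q - blinfun_apply u q\<bar> \<le> norm q" for q
  proof -
    obtain \<alpha> \<beta> where ab: "\<alpha> \<in> D_pos" "\<beta> \<in> D_pos" "predual_functional q = (\<lambda>f. \<alpha> f - \<beta> f)" "\<alpha> unit + \<beta> unit = norm q"
      using predual_functional_decomposition[of q] by blast
    have "w q = s \<alpha> - s \<beta>" unfolding w_def ab(3) by (rule S_eq[OF ab(1,2)])
    moreover have "blinfun_apply u q = \<alpha> unit - \<beta> unit"
      using predual_functional_Phi[of q u] fun_cong[OF ab(3), of unit] by (simp add: Phi_u)
    ultimately show ?thesis
      using s_ge[OF ab(1)] s_ge[OF ab(2)] s_le[OF ab(1)] s_le[OF ab(2)] ab(4) by linarith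
  qed
  have "\<bar>w q\<bar> \<le> (1 + norm u) * norm q" for q
  proof -
    have "\<bar>blinfun_apply u q\<bar> \<le> norm u * norm q" using norm_blinfun[of u q] by simp
    moreover have "(1 + norm u) * norm q = norm q + norm u * norm q" by (simp add: distrib_right)
    ultimately show ?thesis using bound[of q] norm_ge_zero[of q] by linarith
  qed
  then obtain e where e: "blinfun_apply e = w" using blinfun_of_linear[of w "1 + norm u"] add scale by blast
  have "e \<in> unit_interval" using bound interval_iff[of 1 e] by (simp add: unit_interval_def e)
  moreover have "blinfun_apply e q = s \<alpha> - s \<beta>"
    if "\<alpha> \<in> D_pos" "\<beta> \<in> D_pos" "predual_functional q = (\<lambda>f. \<alpha> f - \<beta> f)" for \<alpha> \<beta> q
    unfolding e w_def that(3) by (rule S_eq[OF that(1,2)])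
  ultimately show ?thesis by (intro bexI[of _ e]) auto
qed

text \<open>The Riesz--Kantorovich formula over splittings of \<open>\<alpha>\<close> gives
  \<open>s \<alpha>\<close>, the infimum of \<open>f\<close> and \<open>g\<close> in the bidual; its
  restriction to the predual is the interpolating effect. The lattice property enters through
  superadditivity of \<open>s\<close>.\<close>

lemma Choquet_imp_interpolate:
  assumes simplex: "Choquet_simplex K"
  shows effects_interpolate
  unfolding effects_interpolate_def
proof (intro ballI)
  fix f g assume "f \<in> effects" "g \<in> effects"
  then have f: "f \<in> A_pos K" "\<And>x. x \<in> K \<Longrightarrow> f x \<le> 1" and g: "g \<in> A_pos K" "\<And>x. x \<in> K \<Longrightarrow> g x \<le> 1"
    by (auto simp: effects_def A_pos_def)
  note fA = A_pos_A[OF f(1)] and gA = A_pos_A[OF g(1)]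
  have le1: "\<alpha> f \<le> \<alpha> unit" "\<alpha> g \<le> \<alpha> unit" if "\<alpha> \<in> D_pos" for \<alpha>
    by (rule D_pos_mono[OF that fA unit_A], simp add: f, rule D_pos_mono[OF that gA unit_A], simp add: g)
  have ge0: "0 \<le> \<alpha> f" "0 \<le> \<alpha> g" if "\<alpha> \<in> D_pos" for \<alpha>
    by (rule D_pos_nonneg[OF that f(1)], rule D_pos_nonneg[OF that g(1)])
  define Q where "Q \<alpha> = {\<beta> \<in> D_pos. (\<lambda>k. \<alpha> k - \<beta> k) \<in> D_pos}" for \<alpha>
  define v where "v \<alpha> \<beta> = \<beta> f + (\<alpha> g - \<beta> g)" for \<alpha> \<beta> :: "('a \<Rightarrow> real) \<Rightarrow> real"
  define s where "s \<alpha> = (INF \<beta>\<in>Q \<alpha>. v \<alpha> \<beta>)" for \<alpha>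
  have Q0: "(\<lambda>_. 0) \<in> Q \<alpha>" and Q1: "\<alpha> \<in> Q \<alpha>" if "\<alpha> \<in> D_pos" for \<alpha>
    using that D_pos_zero by (simp_all add: Q_def)
  have v0: "0 \<le> v \<alpha> \<beta>" if "\<beta> \<in> Q \<alpha>" for \<alpha> \<beta>
    using that ge0(1)[of \<beta>] ge0(2)[of "\<lambda>k. \<alpha> k - \<beta> k"] by (simp add: Q_def v_def)
  have v1: "\<alpha> f + \<alpha> g - \<alpha> unit \<le> v \<alpha> \<beta>" if "\<beta> \<in> Q \<alpha>" for \<alpha> \<beta>
    using that le1(2)[of \<beta>] le1(1)[of "\<lambda>k. \<alpha> k - \<beta> k"] by (simp add: Q_def v_def)
  have bdd: "bdd_below (v \<alpha> ` Q \<alpha>)" for \<alpha> by (rule bdd_belowI2[of _ 0]) (rule v0)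
  have s_lower: "s \<alpha> \<le> v \<alpha> \<beta>" if "\<beta> \<in> Q \<alpha>" for \<alpha> \<beta>
    unfolding s_def by (rule cINF_lower[OF bdd that])
  have s_greatest: "b \<le> s \<alpha>" if "\<alpha> \<in> D_pos" "\<And>\<beta>. \<beta> \<in> Q \<alpha> \<Longrightarrow> b \<le> v \<alpha> \<beta>" for \<alpha> b
    unfolding s_def using Q0[OF that(1)] that(2) by (intro cINF_greatest) auto
  have s_ge0: "0 \<le> s \<alpha>" and s_ge1: "\<alpha> f + \<alpha> g - \<alpha> unit \<le> s \<alpha>" if "\<alpha> \<in> D_pos" for \<alpha>
    by (rule s_greatest[OF that v0], assumption, rule s_greatest[OF that v1])
  have s_f: "s \<alpha> \<le> \<alpha> f" and s_g: "s \<alpha> \<le> \<alpha> g" if "\<alpha> \<in> D_pos" for \<alpha>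
    using s_lower[OF Q1[OF that]] s_lower[OF Q0[OF that]] by (simp_all add: v_def)
  have s_add: "s (\<lambda>k. \<alpha> k + \<alpha>' k) = s \<alpha> + s \<alpha>'" if a: "\<alpha> \<in> D_pos" "\<alpha>' \<in> D_pos" for \<alpha> \<alpha>'
  proof (rule antisym)
    have aa: "(\<lambda>k. \<alpha> k + \<alpha>' k) \<in> D_pos" by (rule D_pos_add[OF a])
    have *: "s (\<lambda>k. \<alpha> k + \<alpha>' k) \<le> v \<alpha> \<beta> + v \<alpha>' \<beta>'" if b: "\<beta> \<in> Q \<alpha>" "\<beta>' \<in> Q \<alpha>'" for \<beta> \<beta>'
    proof -
      have "(\<lambda>k. \<beta> k + \<beta>' k) \<in> Q (\<lambda>k. \<alpha> k + \<alpha>' k)"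
        using b D_pos_add[of \<beta> \<beta>'] D_pos_add[of "\<lambda>k. \<alpha> k - \<beta> k" "\<lambda>k. \<alpha>' k - \<beta>' k"]
        by (simp add: Q_def algebra_simps)
      from s_lower[OF this] show ?thesis by (simp add: v_def)
    qed
    have "s (\<lambda>k. \<alpha> k + \<alpha>' k) - v \<alpha>' \<beta>' \<le> s \<alpha>" if "\<beta>' \<in> Q \<alpha>'" for \<beta>'
      by (rule s_greatest[OF a(1)]) (use *[OF _ that] in force)
    then have "s (\<lambda>k. \<alpha> k + \<alpha>' k) - s \<alpha> \<le> s \<alpha>'"
      by (intro s_greatest[OF a(2)]) force
    then show "s (\<lambda>k. \<alpha> k + \<alpha>' k) \<le> s \<alpha> + s \<alpha>'" by simp
    show "s \<alpha> + s \<alpha>' \<le> s (\<lambda>k. \<alpha> k + \<alpha>' k)"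
    proof (rule s_greatest[OF aa])
      fix \<beta> assume "\<beta> \<in> Q (\<lambda>k. \<alpha> k + \<alpha>' k)"
      then have b: "\<beta> \<in> D_pos" "(\<lambda>k. \<alpha> k + \<alpha>' k - \<beta> k) \<in> D_pos" by (simp_all add: Q_def)
      \<comment> \<open>A splitting of \<open>\<alpha> + \<alpha>'\<close> into
        \<open>\<beta>\<close> and its rest is refined into a splitting of \<open>\<alpha>\<close>
        and one of \<open>\<alpha>'\<close>.\<close>
      obtain \<rho> where \<rho>: "\<rho> \<in> D_pos" "(\<lambda>k. \<alpha> k - \<rho> k) \<in> D_pos" "(\<lambda>k. \<beta> k - \<rho> k) \<in> D_pos"
          "(\<lambda>k. (\<alpha> k + \<alpha>' k - \<beta> k) - (\<alpha> k - \<rho> k)) \<in> D_pos"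
        using dual_refinement[OF simplex a b] by auto
      have "(\<lambda>k. (\<alpha> k + \<alpha>' k - \<beta> k) - (\<alpha> k - \<rho> k)) = (\<lambda>k. \<alpha>' k - (\<beta> k - \<rho> k))" by (simp add: fun_eq_iff)
      then have "\<rho> \<in> Q \<alpha>" "(\<lambda>k. \<beta> k - \<rho> k) \<in> Q \<alpha>'" using \<rho> by (simp_all add: Q_def)
      from s_lower[OF this(1)] s_lower[OF this(2)]
      show "s \<alpha> + s \<alpha>' \<le> v (\<lambda>k. \<alpha> k + \<alpha>' k) \<beta>" by (simp add: v_def)
    qed
  qed
  have s_scale_ge: "c * s \<alpha> \<le> s (\<lambda>k. c * \<alpha> k)" if a: "\<alpha> \<in> D_pos" and c: "0 < c" for \<alpha> c
  proof (rule s_greatest[OF D_pos_scale[OF a]])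
    fix \<beta> assume "\<beta> \<in> Q (\<lambda>k. c * \<alpha> k)"
    then have b: "\<beta> \<in> D_pos" "(\<lambda>k. c * \<alpha> k - \<beta> k) \<in> D_pos" by (simp_all add: Q_def)
    have c': "0 \<le> 1 / c" using c by simp
    have "(\<lambda>k. (1 / c) * \<beta> k) \<in> D_pos" "(\<lambda>k. (1 / c) * (c * \<alpha> k - \<beta> k)) \<in> D_pos"
      by (rule D_pos_scale[OF b(1) c'], rule D_pos_scale[OF b(2) c'])
    moreover have "(\<lambda>k. (1 / c) * (c * \<alpha> k - \<beta> k)) = (\<lambda>k. \<alpha> k - (1 / c) * \<beta> k)"
      using c by (simp add: fun_eq_iff field_simps)
    ultimately have "(\<lambda>k. (1 / c) * \<beta> k) \<in> Q \<alpha>" by (simp add: Q_def)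
    from s_lower[OF this] show "c * s \<alpha> \<le> v (\<lambda>k. c * \<alpha> k) \<beta>" using c by (simp add: v_def field_simps)
  qed (use c in simp)
  have s_scale: "s (\<lambda>k. c * \<alpha> k) = c * s \<alpha>" if a: "\<alpha> \<in> D_pos" and c: "0 \<le> c" for \<alpha> c
  proof (cases "c = 0")
    case True
    then show ?thesis using s_ge0[OF D_pos_zero] s_f[OF D_pos_zero] by simp
  next
    case False
    then have c: "0 < c" using c by simp
    have "(1 / c) * s (\<lambda>k. c * \<alpha> k) \<le> s (\<lambda>k. (1 / c) * (c * \<alpha> k))"
      by (rule s_scale_ge[OF D_pos_scale[OF a]]) (use c in auto)
    then have "s (\<lambda>k. c * \<alpha> k) \<le> c * s \<alpha>" using c by (simp add: field_simps)
    then show ?thesis using s_scale_ge[OF a c] by simp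
  qed
  obtain a where a: "\<Phi> a = f" using Phi_surj[OF fA] by blast
  obtain b where b: "\<Phi> b = g" using Phi_surj[OF gA] by blast
  have split: "blinfun_apply a q = \<alpha> f - \<beta> f" "blinfun_apply b q = \<alpha> g - \<beta> g" "blinfun_apply u q = \<alpha> unit - \<beta> unit"
    if "predual_functional q = (\<lambda>f. \<alpha> f - \<beta> f)" for q \<alpha> \<beta>
    using predual_functional_Phi[of q a] predual_functional_Phi[of q b] predual_functional_Phi[of q u] that
    by (simp_all add: a b Phi_u)
  \<comment> \<open>Since \<open>h\<close> is tied to \<open>s\<close> only on the predual, its
    value at a point of K cannot be compared with \<open>s\<close> of the evaluation. Each
    inequality is instead proved by restricting a combination of \<open>f\<close>, \<open>g\<close>,
    \<open>unit\<close> and \<open>s\<close> to the predual, which produces an element of the unit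
    interval that must be the corresponding combination with \<open>h\<close>.\<close>
  have mem: "c1 *\<^sub>R a + c2 *\<^sub>R b + c3 *\<^sub>R u + c4 *\<^sub>R h \<in> unit_interval"
    if h: "\<forall>\<alpha>\<in>D_pos. \<forall>\<beta>\<in>D_pos. \<forall>q. predual_functional q = (\<lambda>f. \<alpha> f - \<beta> f) \<longrightarrow> blinfun_apply h q = s \<alpha> - s \<beta>"
      and bd: "\<And>\<alpha>. \<alpha> \<in> D_pos \<Longrightarrow> 0 \<le> c1 * \<alpha> f + c2 * \<alpha> g + c3 * \<alpha> unit + c4 * s \<alpha>"
        "\<And>\<alpha>. \<alpha> \<in> D_pos \<Longrightarrow> c1 * \<alpha> f + c2 * \<alpha> g + c3 * \<alpha> unit + c4 * s \<alpha> \<le> \<alpha> unit" for c1 c2 c3 c4 h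
  proof -
    define t where "t \<alpha> = c1 * \<alpha> f + c2 * \<alpha> g + c3 * \<alpha> unit + c4 * s \<alpha>" for \<alpha>
    have "\<exists>e\<in>unit_interval. \<forall>\<alpha>\<in>D_pos. \<forall>\<beta>\<in>D_pos. \<forall>q.
        predual_functional q = (\<lambda>f. \<alpha> f - \<beta> f) \<longrightarrow> blinfun_apply e q = t \<alpha> - t \<beta>"
    proof (rule unit_interval_of_additive)
      show "t (\<lambda>f. \<alpha> f + \<beta> f) = t \<alpha> + t \<beta>" if "\<alpha> \<in> D_pos" "\<beta> \<in> D_pos" for \<alpha> \<beta>
        using s_add[OF that] by (simp add: t_def algebra_simps)
      show "t (\<lambda>f. c * \<alpha> f) = c * t \<alpha>" if "\<alpha> \<in> D_pos" "0 \<le> c" for \<alpha> c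
        using s_scale[OF that] by (simp add: t_def algebra_simps)
    qed (use bd in \<open>simp_all add: t_def\<close>)
    then obtain e where e: "e \<in> unit_interval" and et: "\<forall>\<alpha>\<in>D_pos. \<forall>\<beta>\<in>D_pos. \<forall>q.
        predual_functional q = (\<lambda>f. \<alpha> f - \<beta> f) \<longrightarrow> blinfun_apply e q = t \<alpha> - t \<beta>" by (rule bexE)
    have "blinfun_apply e q = blinfun_apply (c1 *\<^sub>R a + c2 *\<^sub>R b + c3 *\<^sub>R u + c4 *\<^sub>R h) q" for q
    proof -
      obtain \<alpha> \<beta> where ab: "\<alpha> \<in> D_pos" "\<beta> \<in> D_pos" "predual_functional q = (\<lambda>f. \<alpha> f - \<beta> f)"
        using predual_functional_decomposition[of q] by blast
      have eq: "blinfun_apply e q = t \<alpha> - t \<beta>" "blinfun_apply h q = s \<alpha> - s \<beta>"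
        using et h ab by blast+
      show ?thesis
        unfolding blinfun.add_left blinfun.scaleR_left eq split[OF ab(3)] t_def by (simp add: algebra_simps)
    qed
    then have "e = c1 *\<^sub>R a + c2 *\<^sub>R b + c3 *\<^sub>R u + c4 *\<^sub>R h" by (intro blinfun_eqI)
    then show ?thesis using e by simp
  qed
  obtain h where h: "h \<in> unit_interval" and hs: "\<forall>\<alpha>\<in>D_pos. \<forall>\<beta>\<in>D_pos. \<forall>q.
      predual_functional q = (\<lambda>f. \<alpha> f - \<beta> f) \<longrightarrow> blinfun_apply h q = s \<alpha> - s \<beta>"
    using unit_interval_of_additive[of s, OF s_add s_scale s_ge0 order_trans[OF s_f le1(1)]] by blast
  \<comment> \<open>The three combinations are \<open>f - h\<close>, \<open>g - h\<close> and
    \<open>1 - f - g + h\<close>; together with \<open>h\<close> they are the four entries of the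
    table.\<close>
  have "1 *\<^sub>R a + 0 *\<^sub>R b + 0 *\<^sub>R u + (-1) *\<^sub>R h \<in> unit_interval"
    by (rule mem[OF hs]) (use s_f s_ge0 le1 in force)+
  moreover have "0 *\<^sub>R a + 1 *\<^sub>R b + 0 *\<^sub>R u + (-1) *\<^sub>R h \<in> unit_interval"
    by (rule mem[OF hs]) (use s_g s_ge0 le1 in force)+
  moreover have "(-1) *\<^sub>R a + (-1) *\<^sub>R b + 1 *\<^sub>R u + 1 *\<^sub>R h \<in> unit_interval"
    by (rule mem[OF hs]) (use s_ge1 s_f ge0 in force)+
  ultimately have "0 \<le> \<Phi> h x \<and> f x + g x - 1 \<le> \<Phi> h x \<and> \<Phi> h x \<le> f x \<and> \<Phi> h x \<le> g x" if "x \<in> K" for x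
    using h that by (auto simp: unit_interval_def a b)
  then show "\<exists>h\<in>A. \<forall>x\<in>K. 0 \<le> h x \<and> f x + g x - 1 \<le> h x \<and> h x \<le> f x \<and> h x \<le> g x"
    by (intro bexI[OF _ Phi_A[of h]]) auto
qed

end

section \<open>The empty convex set\<close>

lemma A_space_empty: "A_space {} = {\<lambda>_. 0}"
  by (auto simp: A_space_def affine_fun_on_def)

lemma Bauer_simplex_empty: "Bauer_simplex {}"
  by (simp add: Bauer_simplex_def extreme_point_of_def)

lemma A_dual_empty:
  "A_dual ({} :: 'a::{real_vector, topological_space} set) = {\<lambda>_. 0}" "A_dual_pos ({} :: 'a set) = {\<lambda>_. 0}"
proof -
  have 1: "\<psi> = (\<lambda>_. 0)" if \<psi>: "\<psi> \<in> A_dual {}" for \<psi> :: "('a \<Rightarrow> real) \<Rightarrow> real"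
  proof
    fix f
    have "\<forall>c. \<psi> (\<lambda>x. c * 0) = c * \<psi> (\<lambda>_. 0)" using \<psi> by (simp add: A_dual_def A_space_empty)
    from spec[OF this, of 0] have "\<psi> (\<lambda>_. 0) = 0" by simp
    then show "\<psi> f = 0" using \<psi> by (cases "f = (\<lambda>_. 0)") (auto simp: A_dual_def A_space_empty)
  qed
  have 2: "(\<lambda>_. 0) \<in> A_dual ({} :: 'a set)" by (auto simp: A_dual_def A_norm_def)
  show eq: "A_dual ({} :: 'a set) = {\<lambda>_. 0}"
    by (rule equalityI, rule subsetI, drule 1, simp) (simp add: 2)
  show "A_dual_pos ({} :: 'a set) = {\<lambda>_. 0}" unfolding A_dual_pos_def eq by auto
qed

lemma Choquet_simplex_empty: "Choquet_simplex {}"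
  unfolding Choquet_simplex_def
  by unfold_locales (auto simp: A_dual_order_def least_def greatest_def Upper_def Lower_def A_dual_empty)

lemma compatible_empty:
  assumes "measurement {} m F" "measurement {} n G" shows "compatible {} m F n G"
proof -
  have "F k = (\<lambda>_. 0)" if "k \<in> {1..m}" for k using assms(1) that by (auto simp: measurement_def A_pos_def A_space_empty)
  moreover have "G k = (\<lambda>_. 0)" if "k \<in> {1..n}" for k using assms(2) that by (auto simp: measurement_def A_pos_def A_space_empty)
  ultimately show ?thesis
    unfolding compatible_def by (intro exI[of _ "\<lambda>_ _ _. 0"]) (simp add: A_pos_def A_space_empty)
qed

theorem theorem2:
  fixes K :: "'a::locally_convex_space set"
  assumes "compact K" and "convex K"
    and "\<exists>\<Phi> :: ('p::banach \<Rightarrow>\<^sub>L real) \<Rightarrow> 'a \<Rightarrow> real. predual_iso K \<Phi>"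
  shows "(Bauer_simplex K \<longleftrightarrow> Choquet_simplex K) \<and>
    (Choquet_simplex K \<longleftrightarrow>
      (\<forall>f g. measurement K 2 f \<and> measurement K 2 g \<longrightarrow> compatible K 2 f 2 g))"
proof (cases "K = {}")
  case True
  then show ?thesis by (simp add: Bauer_simplex_empty Choquet_simplex_empty compatible_empty)
next
  case False
  obtain \<Phi> :: "('p \<Rightarrow>\<^sub>L real) \<Rightarrow> 'a \<Rightarrow> real" where "predual_iso K \<Phi>" using assms(3) by blast
  then interpret predual_state_space K \<Phi> using assms False by unfold_locales
  show ?thesis
    unfolding compatible_iff_interpolate
    using Bauer_imp_interpolate interpolate_imp_Bauer interpolate_imp_Choquet Choquet_imp_interpolate by blast
qed

end
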